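(* The horizontal cohomology spaces of the differential algebra $(\mathcal A(\mathbf{CE}),\{D_\mu\}_{\mu\in M})$ are $$H^q_{\mathrm H}(\mathbf{CE})\cong\begin{cases}0,& q<0,\ 1\le q\le m-2,\ q>m;\\ \mathbb R,& q=0;\\ \ker D_1^{m-1}=\mathbb R\cdot[u^\mu d_\mu x],& q=m-1;\\ H^{m-1}(\Theta)/\operatorname{im}D_1^{m-1},& q=m.\end{cases}$$
   Context: Fix an integer $m\ge 2$, $M=\{1,\dots,m\}$, $N=\{2,\dots,m\}$. Indices $\lambda,\mu,\nu$ range over $M$, indices $\alpha,\beta$ over $N$; repeated upper/lower indices are summed. $\mathbb I=\mathbb Z_+^m$ is the set of multi-indices $\mathrm i=(i^1,\dots,i^m)$; $\mathrm i+(\mu)$ is $\mathrm i$ with its $\mu$-th entry increased by $1$, $(\mu)=0+(\mu)$; $\mathbb I_0=\{\mathrm i\in\mathbb I: i^1=0\}$. The infinite-dimensional space $\mathbf B$ has coordinates $x^\mu$, $u^\mu_{\mathrm i}$, $p_{\mathrm i}$ ($\mu\in M$, $\mathrm i\in\mathbb I$); $\mathcal A(\mathbf B)$ is the algebra of smooth real functions on $\mathbf B$ depending on finitely many coordinates. Total derivatives: $D_\mu=\partial_{x^\mu}+u^\lambda_{\mathrm i+(\mu)}\partial_{u^\lambda_{\mathrm i}}+p_{\mathrm i+(\mu)}\partial_{p_{\mathrm i}}$; they commute. Let $\mathcal I\subset\mathcal A(\mathbf B)$ be the ideal generated by all $CE_{\mathrm i}=u^\mu_{\mathrm i+(\mu)}$,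 $\mathrm i\in\mathbb I$, and $\mathcal A(\mathbf{CE})=\mathcal A(\mathbf B)/\mathcal I$ with the induced derivations $D_\mu$ (concretely: smooth functions of finitely many of $x^\mu$, $u^1_{\mathrm i}$ ($\mathrm i\in\mathbb I_0$), $u^\alpha_{\mathrm i}$, $p_{\mathrm i}$ ($\mathrm i\in\mathbb I$), with $u^1_{\mathrm k}$, $k^1\ge1$, replaced recursively by $-u^\beta_{\mathrm k-(1)+(\beta)}$). Horizontal forms: $\Omega^0_{\mathrm H}(\mathbf{CE})=\mathcal A(\mathbf{CE})$, for $1\le q\le m$ $\Omega^q_{\mathrm H}(\mathbf{CE})$ consists of $\omega=\omega_{\mu_1\dots\mu_q}dx^{\mu_1}\wedge\dots\wedge dx^{\mu_q}$ with skew-symmetric coefficients in $\mathcal A(\mathbf{CE})$, $\Omega^q_{\mathrm H}=0$ otherwise; $d_{\mathrm H}\omega=(D_\mu\omega_{\mu_1\dots\mu_q})\,dx^\mu\wedge dx^{\mu_1}\wedge\dots\wedge dx^{\mu_q}$; $H^q_{\mathrm H}(\mathbf{CE})=\ker d_{\mathrm H}/\operatorname{im}d_{\mathrm H}$ in degree $q$. Auxiliary complex: $\Theta^q$ is the space of forms $\theta=\theta_{\alpha_1\dots\alpha_q}dx^{\alpha_1}\wedge\dots\wedge dx^{\alpha_q}$ involving only $dx^\alpha$, $\alpha\in N$, with skew-symmetric coefficients in $\mathcal A(\mathbf{CE})$ ($\Theta^0=\mathcal A(\mathbf{CE})$), with differential $d_\Theta\theta=(D_\alpha\theta_{\alpha_1\dots\alpha_q})dx^\alpha\wedge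 dx^{\alpha_1}\wedge\dots\wedge dx^{\alpha_q}$, and $H^q(\Theta)=\ker d_\Theta/\operatorname{im}d_\Theta$ in degree $q$. The derivation $D_1$ acting coefficientwise on $\Theta^q$ commutes with $d_\Theta$ and so induces linear maps $D_1^q:H^q(\Theta)\to H^q(\Theta)$, $[\theta]\mapsto[D_1\theta]$. $d_\mu x=(-1)^{\mu-1}dx^1\wedge\dots\wedge\widehat{dx^\mu}\wedge\dots\wedge dx^m$ (hat = omission). *)

theory Defs
  imports "HOL-Analysis.Analysis" "HOL-Library.Function_Algebras"
begin

instantiation "fun" :: (type, real_vector) real_vector
begin
definition scaleR_fun :: "real \<Rightarrow> ('a \<Rightarrow> 'b) \<Rightarrow> 'a \<Rightarrow> 'b"
  where "scaleR_fun c f = (\<lambda>x. c *\<^sub>R f x)"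
instance
  by standard (simp_all add: scaleR_fun_def fun_eq_iff scaleR_add_right scaleR_add_left)
end

text \<open>Multi-indices i in Z_+^m are functions nat => nat vanishing outside {1..m}.\<close>
definition MI :: "nat \<Rightarrow> (nat \<Rightarrow> nat) set" where
  "MI m = {i. \<forall>k. k \<notin> {1..m} \<longrightarrow> i k = 0}"

definition addm :: "(nat \<Rightarrow> nat) \<Rightarrow> nat \<Rightarrow> (nat \<Rightarrow> nat)" where
  "addm i \<mu> = i(\<mu> := Suc (i \<mu>))"

datatype coord = Xc nat | Uc nat "nat \<Rightarrow> nat" | Pc "nat \<Rightarrow> nat"

definition coords :: "nat \<Rightarrow> coord set" where
  "coords m = {Xc \<mu> | \<mu>. \<mu> \<in> {1..m}}
            \<union> {Uc \<mu> i | \<mu> i. \<mu> \<in> {1..m} \<and> i \<in> MI m}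
            \<union> {Pc i | i. i \<in> MI m}"

text \<open>Points of B are assignments of real values to coordinates.\<close>
type_synonym fnB = "(coord \<Rightarrow> real) \<Rightarrow> real"

definition pd :: "coord \<Rightarrow> fnB \<Rightarrow> fnB" where
  "pd c f = (\<lambda>y. deriv (\<lambda>t. f (y(c := t))) (y c))"

text \<open>The algebra A(B): smooth functions depending on finitely many coordinates.
  Smoothness (C-infinity) is expressed coinductively: the function depends only on a
  finite set of coordinates, is continuous, all partial derivatives exist everywhere
  and are again smooth.\<close>
coinductive smoothB :: "nat \<Rightarrow> fnB \<Rightarrow> bool" for m where
  "\<lbrakk> finite S; S \<subseteq> coords m;
     \<forall>y z. (\<forall>c\<in>S. y c = z c) \<longrightarrow> f y = f z;
     continuous_on UNIV f;
     \<forall>c y. (\<lambda>t. f (y(c := t))) differentiable (at (y c));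
     \<forall>c. smoothB m (pd c f) \<rbrakk> \<Longrightarrow> smoothB m f"

definition AB :: "nat \<Rightarrow> fnB set" where
  "AB m = {f. smoothB m f}"

definition dep :: "fnB \<Rightarrow> coord set" where
  "dep f = {c. \<exists>y t. f (y(c := t)) \<noteq> f y}"

definition shiftc :: "nat \<Rightarrow> coord \<Rightarrow> (coord \<Rightarrow> real) \<Rightarrow> real" where
  "shiftc \<mu> c y = (case c of Xc _ \<Rightarrow> 0
                            | Uc l i \<Rightarrow> y (Uc l (addm i \<mu>))
                            | Pc i \<Rightarrow> y (Pc (addm i \<mu>)))"

definition TD :: "nat \<Rightarrow> fnB \<Rightarrow> fnB" where
  "TD \<mu> f = (\<lambda>y. pd (Xc \<mu>) f y + (\<Sum>c\<in>dep f. shiftc \<mu> c y * pd c f y))"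

definition CE :: "nat \<Rightarrow> (nat \<Rightarrow> nat) \<Rightarrow> fnB" where
  "CE m i = (\<lambda>y. \<Sum>\<mu>=1..m. y (Uc \<mu> (addm i \<mu>)))"

definition ICE :: "nat \<Rightarrow> fnB set" where
  "ICE m = {f. \<exists>K a. finite K \<and> K \<subseteq> MI m \<and> (\<forall>i\<in>K. a i \<in> AB m)
                   \<and> f = (\<lambda>y. \<Sum>i\<in>K. a i y * CE m i y)}"

text \<open>A q-form over the index set S is represented by its coefficients in the basis
  dx^{j_1} \<and> ... \<and> dx^{j_q}, j_1 < ... < j_q in S (a strictly increasing list);
  coefficients are elements of A(B), and the forms over A(CE) are these modulo I
  (coefficientwise).\<close>
type_synonym form = "nat list \<Rightarrow> fnB"

definition Omega :: "nat \<Rightarrow> nat set \<Rightarrow> int \<Rightarrow> form set" where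
  "Omega m S q = {\<omega>. \<forall>J. (\<omega> J \<noteq> 0 \<longrightarrow> sorted_wrt (<) J \<and> set J \<subseteq> S \<and> int (length J) = q)
                          \<and> \<omega> J \<in> AB m}"

definition dH :: "nat \<Rightarrow> nat set \<Rightarrow> form \<Rightarrow> form" where
  "dH m S \<omega> = (\<lambda>J. if sorted_wrt (<) J \<and> set J \<subseteq> S
      then (\<lambda>y. \<Sum>k<length J. (-1) ^ k * TD (J ! k) (\<omega> (take k J @ drop (Suc k) J)) y)
      else 0)"

text \<open>Cocycles and coboundaries of the complex with coefficients in A(CE) = A(B)/I.\<close>
definition Zc :: "nat \<Rightarrow> nat set \<Rightarrow> int \<Rightarrow> form set" where
  "Zc m S q = {\<omega> \<in> Omega m S q. \<forall>J. dH m S \<omega> J \<in> ICE m}"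

definition Bc :: "nat \<Rightarrow> nat set \<Rightarrow> int \<Rightarrow> form set" where
  "Bc m S q = {\<omega> \<in> Omega m S q. \<exists>\<eta> \<in> Omega m S (q - 1).
                  \<forall>J. (\<lambda>y. \<omega> J y - dH m S \<eta> J y) \<in> ICE m}"

text \<open>Horizontal complex of CE: S = M = {1..m}; auxiliary complex Theta: S = N = {2..m}.\<close>
abbreviation ZH where "ZH m q \<equiv> Zc m {1..m} q"
abbreviation BH where "BH m q \<equiv> Bc m {1..m} q"
abbreviation ZTh where "ZTh m q \<equiv> Zc m {2..m} q"
abbreviation BTh where "BTh m q \<equiv> Bc m {2..m} q"

definition D1f :: "form \<Rightarrow> form" where
  "D1f \<theta> = (\<lambda>J. TD 1 (\<theta> J))"

text \<open>Representatives of ker D_1^q (a subspace of H^q(Theta) = ZTh/BTh).\<close>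
definition kerD1 :: "nat \<Rightarrow> int \<Rightarrow> form set" where
  "kerD1 m q = {\<theta> \<in> ZTh m q. D1f \<theta> \<in> BTh m q}"

text \<open>Representatives of im D_1^q, i.e. preimage of im D_1^q in ZTh.\<close>
definition imD1 :: "nat \<Rightarrow> int \<Rightarrow> form set" where
  "imD1 m q = {\<beta> + D1f \<zeta> | \<beta> \<zeta>. \<beta> \<in> BTh m q \<and> \<zeta> \<in> ZTh m q}"

definition u1d1x :: "nat \<Rightarrow> form" where
  "u1d1x m = (\<lambda>J. if J = [2..<Suc m] then (\<lambda>y. y (Uc 1 (\<lambda>_. 0))) else 0)"

definition quot_iso :: "('a::real_vector \<Rightarrow> 'b::real_vector) \<Rightarrow> 'a set \<Rightarrow> 'a set \<Rightarrow> 'b set \<Rightarrow> 'b set \<Rightarrow> bool"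
  where "quot_iso f Z1 W1 Z2 W2 \<longleftrightarrow>
     linear f \<and> f ` Z1 \<subseteq> Z2 \<and> f ` W1 \<subseteq> W2
     \<and> (\<forall>z\<in>Z2. \<exists>a\<in>Z1. z - f a \<in> W2)
     \<and> (\<forall>a\<in>Z1. f a \<in> W2 \<longrightarrow> a \<in> W1)"

definition quot_isomorphic :: "'a::real_vector set \<Rightarrow> 'a set \<Rightarrow> 'b::real_vector set \<Rightarrow> 'b set \<Rightarrow> bool"
  where "quot_isomorphic Z1 W1 Z2 W2 \<longleftrightarrow> (\<exists>f. quot_iso f Z1 W1 Z2 W2)"

end

theory Submission
  imports Defs
begin

text \<open>
  The continuity equations are solved for the coordinates \<open>u\<^sup>1\<^sub>k\<close> with \<open>k\<^sup>1 > 0\<close>, so that functions on CE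
  become smooth functions of the remaining coordinates; by Hadamard's lemma the ideal is exactly
  the kernel of this substitution. With respect to \<open>D\<^sub>2, \<dots>, D\<^sub>m\<close> the remaining coordinates are free
  jets. Splitting off one \<open>dx\<^sup>s\<close> at a time relates the complex over \<open>{s..m}\<close> to the one over
  \<open>{s+1..m}\<close> by a long exact sequence whose connecting map is \<open>D\<^sub>s\<close>. Everything then rests on
  the kernel of \<open>D\<^sub>s\<close> on functions modulo the images of \<open>D\<^sub>\<alpha>\<close>, \<open>\<alpha> > s\<close>. A scaling homotopy shows that a
  function lies in the sum of these images iff its Euler derivatives vanish, and
  \<open>E\<^sub>c (D\<^sub>s f) = D\<^sub>s (E\<^sub>c f) + E\<^sub>c\<^sub>-\<^sub>s f\<close>, so that vanishing of the left-hand side propagates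
  down from high order to \<open>E f = 0\<close>. For \<open>s = 1\<close> the elimination adds a term \<open>D\<^sub>\<beta> (E\<^sub>u f)\<close>, \<open>u = u\<^sup>1\<close>, to
  the equation for \<open>c = u\<^sup>\<beta>\<close>; it only forces \<open>E\<^sub>u f\<close> to be constant, and this constant is the class of
  \<open>u\<^sup>\<mu> d\<^sub>\<mu>x\<close>.
\<close>

section \<open>Finitely differentiable functions of finitely many coordinates\<close>

text \<open>Direction 1 is the obstacle. Solving for u^1_k with k^1 > 0 leaves D_2, ..., D_m free
  jet derivatives, but D_1 u^1_i becomes minus the sum of the u^beta_{i+(beta)}: u^1 cannot be
  raised in direction 1, so the recursion from high order has no start there. Exactness is therefore
  established over {s..m} with s \<ge> 2, and s = 1 is reached only in a last step whose possible
  defect is the class of u^1. At its lower end the exact sequence does not start from zero: H^0 over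
  {s+1..m} consists of functions of x^1, ..., x^s. Since D_s is onto there, degree 1 is handled by
  integration in x^s. The scaling homotopy similarly leaves the value of f at zero jets, a function
  of x alone, which is absorbed by integrating in one x^alpha. Every function has finite order but
  there is no common bound, so Euler derivatives are truncated sums whose length N is chosen anew in
  each argument. The space of points carries only the product topology and partial derivatives, so
  the chain rule, symmetry of second derivatives and parameter integrals have to be derived from
  dependence on finitely many coordinates.\<close>

lemma sum_fun_apply: "(\<Sum>i\<in>A. f i) y = (\<Sum>i\<in>A. (f i y :: 'a::comm_monoid_add))"
  by (induction A rule: infinite_finite_induct) auto

definition depends_on :: "coord set \<Rightarrow> fnB \<Rightarrow> bool" where
  "depends_on S f \<longleftrightarrow> (\<forall>y z. (\<forall>c\<in>S. y c = z c) \<longrightarrow> f y = f z)"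

definition fin_dep :: "coord set \<Rightarrow> fnB \<Rightarrow> bool" where
  "fin_dep K f \<longleftrightarrow> (\<exists>S. finite S \<and> S \<subseteq> K \<and> depends_on S f)"

definition part_diff :: "fnB \<Rightarrow> bool" where
  "part_diff f \<longleftrightarrow> (\<forall>c y. (\<lambda>t. f (y(c := t))) differentiable (at (y c)))"

text \<open>Smoothness cut off at order \<open>n\<close>, so that closure properties become
  inductions on \<open>n\<close>; \<open>AB_eq_smooth\<close> identifies the intersection over all
  \<open>n\<close> with the coinductive notion. The set \<open>K\<close> confines the coordinates a
  function may depend on.\<close>

primrec Cn :: "coord set \<Rightarrow> nat \<Rightarrow> fnB \<Rightarrow> bool" where
  "Cn K 0 f = (fin_dep K f \<and> continuous_on UNIV f)"
| "Cn K (Suc n) f = (fin_dep K f \<and> continuous_on UNIV f \<and> part_diff f \<and> (\<forall>c. Cn K n (pd c f)))"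

definition smooth :: "coord set \<Rightarrow> fnB set" where
  "smooth K = {f. \<forall>n. Cn K n f}"

lemma depends_onD: "depends_on S f \<Longrightarrow> (\<And>c. c \<in> S \<Longrightarrow> y c = z c) \<Longrightarrow> f y = f z"
  unfolding depends_on_def by blast

lemma fin_dep_mono: "fin_dep K f \<Longrightarrow> K \<subseteq> L \<Longrightarrow> fin_dep L f"
  unfolding fin_dep_def by blast

lemma Cn_fin_dep: "Cn K n f \<Longrightarrow> fin_dep K f"
  by (cases n) auto

lemma Cn_continuous: "Cn K n f \<Longrightarrow> continuous_on UNIV f"
  by (cases n) auto

lemma Cn_Suc_imp: "Cn K (Suc n) f \<Longrightarrow> Cn K n f"
  by (induction n arbitrary: f) auto

lemma Cn_mono: "Cn K n f \<Longrightarrow> K \<subseteq> L \<Longrightarrow> Cn L n f"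
  by (induction n arbitrary: f) (auto intro: fin_dep_mono)

lemma smooth_mono: "f \<in> smooth K \<Longrightarrow> K \<subseteq> L \<Longrightarrow> f \<in> smooth L"
  unfolding smooth_def using Cn_mono by blast

lemma AB_eq_smooth: "AB m = smooth (coords m)"
proof -
  have "Cn (coords m) n f" if "smoothB m f" for n f
    using that
  proof (induction n arbitrary: f)
    case 0
    then show ?case
      by (rule smoothB.cases) (auto simp: fin_dep_def depends_on_def)
  next
    case (Suc n)
    from Suc.prems have "fin_dep (coords m) f \<and> continuous_on UNIV f \<and> part_diff f \<and> (\<forall>c. smoothB m (pd c f))"
      by (rule smoothB.cases) (auto simp: fin_dep_def depends_on_def part_diff_def)
    then show ?case using Suc.IH by simp
  qed
  moreover have "smoothB m f" if "\<forall>n. Cn (coords m) n f" for f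
    using that
  proof (coinduction arbitrary: f)
    case smoothB
    from smoothB have *: "Cn (coords m) (Suc n) f" for n by blast
    then obtain S where "finite S" "S \<subseteq> coords m" "depends_on S f"
      using Cn_fin_dep[OF *[of 0]] unfolding fin_dep_def by blast
    moreover have "\<forall>c n. Cn (coords m) n (pd c f)" using * by simp
    ultimately show ?case
      using *[of 0] unfolding depends_on_def part_diff_def by (intro exI[of _ S] exI[of _ f]) (simp add: part_diff_def)
  qed
  ultimately show ?thesis unfolding AB_def smooth_def by blast
qed

lemma part_diff_DERIV:
  assumes "part_diff f"
  shows "((\<lambda>t. f (y(c := t))) has_real_derivative pd c f (y(c := s))) (at s)"
proof -
  have "(\<lambda>t. f ((y(c := s))(c := t))) differentiable (at ((y(c := s)) c))"
    using assms unfolding part_diff_def by blast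
  then show ?thesis
    by (simp add: pd_def DERIV_deriv_iff_real_differentiable)
qed

lemma pd_eqI:
  "(\<And>y. ((\<lambda>t. f (y(c := t))) has_real_derivative g y) (at (y c))) \<Longrightarrow> pd c f = g"
  unfolding pd_def by (rule ext) (rule DERIV_imp_deriv)

lemma part_diffI:
  "(\<And>c y. ((\<lambda>t. f (y(c := t))) has_real_derivative g c y) (at (y c))) \<Longrightarrow> part_diff f"
  unfolding part_diff_def real_differentiable_def by blast

lemma Cn_SucI:
  assumes "fin_dep K f" "continuous_on UNIV f"
    and d: "\<And>c y. ((\<lambda>t. f (y(c := t))) has_real_derivative g c y) (at (y c))"
    and "\<And>c. Cn K n (g c)"
  shows "Cn K (Suc n) f"
proof -
  have "pd c f = g c" for c using d by (rule pd_eqI)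
  moreover have "part_diff f" using d by (rule part_diffI)
  ultimately show ?thesis using assms(1,2,4) by simp
qed

lemma part_diff_DERIV': "part_diff f \<Longrightarrow>
   ((\<lambda>t. f (y(c := t))) has_real_derivative pd c f y) (at (y c))"
  using part_diff_DERIV[of f y c "y c"] by simp

lemma fin_dep_binop:
  assumes "fin_dep K f" "fin_dep K g"
  shows "fin_dep K (\<lambda>y. h (f y) (g y))"
proof -
  obtain S T where S: "finite S" "S \<subseteq> K" "depends_on S f"
    and T: "finite T" "T \<subseteq> K" "depends_on T g"
    using assms unfolding fin_dep_def by blast
  have "depends_on (S \<union> T) (\<lambda>y. h (f y) (g y))"
    unfolding depends_on_def
  proof (intro allI impI)
    fix y z :: "coord \<Rightarrow> real" assume *: "\<forall>c\<in>S \<union> T. y c = z c"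
    have "f y = f z" "g y = g z"
      using * by (auto intro: depends_onD[OF S(3)] depends_onD[OF T(3)])
    then show "h (f y) (g y) = h (f z) (g z)" by simp
  qed
  then show ?thesis unfolding fin_dep_def using S T by (intro exI[of _ "S \<union> T"]) simp
qed

lemma fin_dep_const: "fin_dep K (\<lambda>y. a)"
  unfolding fin_dep_def depends_on_def by (auto intro: exI[of _ "{}"])

lemma Cn_const: "Cn K n (\<lambda>y. a)"
proof (induction n arbitrary: a)
  case (Suc n)
  show ?case
    by (rule Cn_SucI[where g="\<lambda>c y. 0"]) (rule fin_dep_const continuous_on_const DERIV_const Suc.IH)+
qed (simp add: fin_dep_const)

lemma pd_const [simp]: "pd c (\<lambda>y. a) = 0"
  by (rule pd_eqI) simp

lemma pd_0 [simp]: "pd c 0 = 0" and pd_1 [simp]: "pd c 1 = 0"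
  using pd_const[of c 0] pd_const[of c 1] by (simp_all add: zero_fun_def one_fun_def)

definition cx :: "coord \<Rightarrow> fnB" where "cx c = (\<lambda>y. y c)"

lemma cx_apply [simp]: "cx c y = y c" by (simp add: cx_def)

lemma cx_DERIV:
  "((\<lambda>t. cx d (y(c := t))) has_real_derivative (if c = d then 1 else 0)) (at s)"
  by (cases "c = d") auto

lemma pd_cx: "pd c (cx d) = (if c = d then 1 else 0)"
  by (subst pd_eqI[of "cx d" c "\<lambda>_. if c = d then 1 else 0", OF cx_DERIV])
     (auto simp: one_fun_def zero_fun_def)

lemma fin_dep_cx: "d \<in> K \<Longrightarrow> fin_dep K (cx d)"
  unfolding fin_dep_def depends_on_def by (auto intro!: exI[of _ "{d}"])

lemma continuous_cx: "continuous_on A (cx d)"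
  unfolding cx_def by (rule continuous_on_subset[OF continuous_on_product_coordinates]) auto

lemma Cn_cx: "d \<in> K \<Longrightarrow> Cn K n (cx d)"
proof (cases n)
  case (Suc k)
  assume "d \<in> K"
  then show ?thesis unfolding Suc
    by (intro Cn_SucI[where g="\<lambda>c y. if c = d then 1 else 0"] fin_dep_cx continuous_cx Cn_const cx_DERIV)
qed (simp add: fin_dep_cx continuous_cx)

lemma Cn_add: "Cn K n f \<Longrightarrow> Cn K n g \<Longrightarrow> Cn K n (f + g)"
proof (induction n arbitrary: f g)
  case 0
  then show ?case
    by (auto simp: plus_fun_def intro: fin_dep_binop[where h="(+)"] continuous_on_add)
next
  case (Suc n)
  show ?case
  proof (rule Cn_SucI[where g="\<lambda>c. pd c f + pd c g"])
    show "((\<lambda>t. (f + g) (y(c := t))) has_real_derivative (pd c f + pd c g) y) (at (y c))" for c y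
      unfolding plus_fun_apply by (intro DERIV_add part_diff_DERIV') (use Suc.prems in auto)
    show "fin_dep K (f + g)" "continuous_on UNIV (f + g)"
      unfolding plus_fun_def using Suc.prems by (auto intro: fin_dep_binop[where h="(+)"] continuous_on_add)
    show "Cn K n (pd c f + pd c g)" for c
      using Suc.prems by (intro Suc.IH) auto
  qed
qed

lemma pd_add: "part_diff f \<Longrightarrow> part_diff g \<Longrightarrow> pd c (f + g) = pd c f + pd c g"
  by (rule pd_eqI) (unfold plus_fun_apply, intro DERIV_add part_diff_DERIV')

lemma Cn_mult: "Cn K n f \<Longrightarrow> Cn K n g \<Longrightarrow> Cn K n (f * g)"
proof (induction n arbitrary: f g)
  case 0
  then show ?case
    by (auto simp: times_fun_def intro: fin_dep_binop[where h="(*)"] continuous_on_mult)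
next
  case (Suc n)
  have "Cn K n f" "Cn K n g"
    using Suc.prems Cn_Suc_imp by blast+
  show ?case
  proof (rule Cn_SucI[where g="\<lambda>c. pd c f * g + pd c g * f"])
    show "((\<lambda>t. (f * g) (y(c := t))) has_real_derivative (pd c f * g + pd c g * f) y) (at (y c))" for c y
      unfolding plus_fun_apply times_fun_apply
      using DERIV_mult[OF part_diff_DERIV'[of f y c] part_diff_DERIV'[of g y c]] Suc.prems by simp
    show "fin_dep K (f * g)" "continuous_on UNIV (f * g)"
      unfolding times_fun_def using Suc.prems by (auto intro: fin_dep_binop[where h="(*)"] continuous_on_mult)
    show "Cn K n (pd c f * g + pd c g * f)" for c
      using Suc.prems \<open>Cn K n f\<close> \<open>Cn K n g\<close> by (intro Cn_add Suc.IH) auto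
  qed
qed

lemma pd_mult:
  assumes "part_diff f" "part_diff g"
  shows "pd c (f * g) = pd c f * g + pd c g * f"
proof (rule pd_eqI)
  show "((\<lambda>t. (f * g) (y(c := t))) has_real_derivative (pd c f * g + pd c g * f) y) (at (y c))" for y
    unfolding plus_fun_apply times_fun_apply
    using DERIV_mult[OF part_diff_DERIV'[of f y c] part_diff_DERIV'[of g y c]] assms by simp
qed

lemma Cn_sum: "(\<And>i. i \<in> I \<Longrightarrow> Cn K n (f i)) \<Longrightarrow> Cn K n (\<Sum>i\<in>I. f i)"
  by (induction I rule: infinite_finite_induct)
     (use Cn_const[of K n 0] in \<open>auto simp: Cn_add zero_fun_def\<close>)

text \<open>Only partial derivatives are available, so moving coordinates are added one at a time:
  those of \<open>S\<close> move with one variable, the new one with a second, and a function of two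
  variables is differentiable as soon as one partial derivative exists and the other is continuous.
  Coordinates outside \<open>S\<close> are frozen at \<open>w\<close>.\<close>

lemma part_diff_chain:
  fixes \<gamma> :: "coord \<Rightarrow> real \<Rightarrow> real"
  assumes "finite S" and f: "part_diff f" and cont: "\<And>c. continuous_on UNIV (pd c f)"
    and \<gamma>: "\<And>c t. c \<in> S \<Longrightarrow> (\<gamma> c has_real_derivative \<gamma>' c t) (at t)"
  shows "((\<lambda>t. f (\<lambda>c. if c \<in> S then \<gamma> c t else w c)) has_real_derivative
     (\<Sum>c\<in>S. pd c f (\<lambda>c. if c \<in> S then \<gamma> c t0 else w c) * \<gamma>' c t0)) (at t0)"
  using assms(1) \<gamma>
proof (induction S arbitrary: w rule: finite_induct)
  case empty
  then show ?case by simp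
next
  case (insert a S)
  define z where "z t s = (\<lambda>c. if c \<in> S then \<gamma> c t else (w(a := s)) c)" for t s
  have z_upd: "z t s = (z t s')(a := s)" for t s s'
    using insert.hyps by (auto simp: z_def)
  have z_eq: "(\<lambda>c. if c \<in> insert a S then \<gamma> c t else w c) = z t (\<gamma> a t)" for t
    using insert.hyps by (auto simp: z_def)
  have zc: "continuous_on UNIV (\<lambda>p. z (fst p) (snd p))"
  proof (rule continuous_on_coordinatewise_then_product)
    fix c
    have "continuous_on UNIV (\<gamma> c)" if "c \<in> S"
      using insert.prems that by (meson DERIV_isCont continuous_at_imp_continuous_on insertI2)
    then have "c \<in> S \<Longrightarrow> continuous_on UNIV (\<lambda>p::real\<times>real. \<gamma> c (fst p))"
      by (rule continuous_on_compose2) (auto intro: continuous_on_fst continuous_on_snd continuous_on_id continuous_on_const continuous_on_Pair)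
    then show "continuous_on UNIV (\<lambda>p::real\<times>real. z (fst p) (snd p) c)"
      unfolding z_def by (cases "c \<in> S"; cases "c = a") (auto intro: continuous_on_fst continuous_on_snd continuous_on_id continuous_on_const continuous_on_Pair)
  qed
  have gc: "continuous_on UNIV (\<lambda>p. pd a f (z (fst p) (snd p)))"
    by (rule continuous_on_compose2[OF cont zc]) auto
  let ?A = "\<Sum>c\<in>S. pd c f (z t0 (\<gamma> a t0)) * \<gamma>' c t0"
  have "((\<lambda>(t, s). f (z t s)) has_derivative
      (\<lambda>(tx, ty). (\<lambda>x. ?A * x) tx + blinfun_apply (blinfun_mult_right (pd a f (z t0 (\<gamma> a t0)))) ty))
      (at (t0, \<gamma> a t0) within UNIV \<times> UNIV)"
  proof (rule has_derivative_partialsI)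
    have "((\<lambda>t. f (z t (\<gamma> a t0))) has_real_derivative ?A) (at t0)"
      using insert.IH[of "w(a := \<gamma> a t0)"] insert.prems unfolding z_def by blast
    then show "((\<lambda>t. f (z t (\<gamma> a t0))) has_derivative (\<lambda>x. ?A * x)) (at t0)"
      by (simp add: has_field_derivative_def)
    fix t s
    have "((\<lambda>s'. f ((z t s)(a := s'))) has_real_derivative pd a f ((z t s)(a := s))) (at s)"
      by (rule part_diff_DERIV[OF f])
    then have "((\<lambda>s'. f (z t s')) has_real_derivative pd a f (z t s)) (at s)"
      unfolding z_upd[of t _ s, symmetric] .
    then show "((\<lambda>s. f (z t s)) has_derivative blinfun_apply (blinfun_mult_right (pd a f (z t s)))) (at s within UNIV)"
      by (simp add: has_field_derivative_def)
  next
    have "continuous_on UNIV (\<lambda>p. blinfun_mult_right (pd a f (z (fst p) (snd p))))"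
      by (intro bounded_linear.continuous_on[OF bounded_linear_blinfun_mult_right] gc)
    then show "continuous (at (t0, \<gamma> a t0) within UNIV \<times> UNIV) (\<lambda>(x, y). blinfun_mult_right (pd a f (z x y)))"
      by (simp add: continuous_on_eq_continuous_at case_prod_beta')
  qed auto
  then have F: "((\<lambda>p. f (z (fst p) (snd p))) has_derivative (\<lambda>p. ?A * fst p + pd a f (z t0 (\<gamma> a t0)) * snd p)) (at (t0, \<gamma> a t0))"
    by (simp add: case_prod_beta')
  \<comment> \<open>Restricting the two variables to this curve makes all coordinates move
    together.\<close>
  have g: "((\<lambda>t. (t, \<gamma> a t)) has_derivative (\<lambda>x. (x, \<gamma>' a t0 * x))) (at t0)"
    using insert.prems[of a t0]
    by (auto intro!: derivative_eq_intros simp: has_field_derivative_def)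
  have "((\<lambda>t. f (z t (\<gamma> a t))) has_derivative (\<lambda>x. ?A * x + pd a f (z t0 (\<gamma> a t0)) * (\<gamma>' a t0 * x))) (at t0)"
    using has_derivative_compose[OF g F] by simp
  then have "((\<lambda>t. f (z t (\<gamma> a t))) has_real_derivative ?A + pd a f (z t0 (\<gamma> a t0)) * \<gamma>' a t0) (at t0)"
    unfolding has_field_derivative_def by (rule has_derivative_eq_rhs) (simp add: fun_eq_iff distrib_right mult.assoc)
  then show ?case
    unfolding z_eq using insert.hyps by (simp add: add.commute)
qed

lemma Cn_chain:
  assumes f: "Cn K (Suc n) f" and S: "finite S" "depends_on S f"
    and \<gamma>: "\<And>c t. c \<in> S \<Longrightarrow> (\<gamma> c has_real_derivative \<gamma>' c t) (at t)"
  shows "((\<lambda>t. f (\<lambda>c. \<gamma> c t)) has_real_derivative (\<Sum>c\<in>S. pd c f (\<lambda>c. \<gamma> c t0) * \<gamma>' c t0)) (at t0)"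
proof -
  have *: "((\<lambda>t. f (\<lambda>c. if c \<in> S then \<gamma> c t else \<gamma> c t0)) has_real_derivative
     (\<Sum>c\<in>S. pd c f (\<lambda>c. if c \<in> S then \<gamma> c t0 else \<gamma> c t0) * \<gamma>' c t0)) (at t0)"
  proof (rule part_diff_chain[OF S(1)])
    show "part_diff f" "continuous_on UNIV (pd c f)" for c
      using f Cn_continuous[of K n "pd c f"] by auto
  qed (rule \<gamma>)
  have "f (\<lambda>c. if c \<in> S then \<gamma> c t else \<gamma> c t0) = f (\<lambda>c. \<gamma> c t)" for t
    by (rule depends_onD[OF S(2)]) auto
  with * show ?thesis by simp
qed

text \<open>Finite dependence of \<open>f\<close> lets only finitely many \<open>\<sigma> c\<close>
  enter, so the composite again sees finitely many coordinates and the chain rule is a finite sum.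
  The base case is proved separately because the induction step needs it again for the composite
  itself.\<close>

lemma Cn_compose:
  assumes "Cn K n f" "\<And>c. c \<in> K \<Longrightarrow> Cn L n (\<sigma> c)"
  shows "Cn L n (\<lambda>y. f (\<lambda>c. \<sigma> c y))"
  using assms
proof (induction n arbitrary: f)
  have base: "fin_dep L (\<lambda>y. f (\<lambda>c. \<sigma> c y)) \<and> continuous_on UNIV (\<lambda>y. f (\<lambda>c. \<sigma> c y))"
    if f: "Cn K 0 f" and \<sigma>: "\<And>c. c \<in> K \<Longrightarrow> Cn L 0 (\<sigma> c)" for f
  proof -
    obtain S where S: "finite S" "S \<subseteq> K" "depends_on S f"
      using f unfolding Cn.simps fin_dep_def by blast
    have "\<exists>T. \<forall>c\<in>S. finite (T c) \<and> T c \<subseteq> L \<and> depends_on (T c) (\<sigma> c)"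
      using \<sigma> S(2) unfolding Cn.simps fin_dep_def by (intro bchoice) blast
    then obtain T where T: "\<And>c. c \<in> S \<Longrightarrow> finite (T c) \<and> T c \<subseteq> L \<and> depends_on (T c) (\<sigma> c)"
      by blast
    have "depends_on (\<Union>c\<in>S. T c) (\<lambda>y. f (\<lambda>c. \<sigma> c y))"
      unfolding depends_on_def
    proof (intro allI impI)
      fix y z :: "coord \<Rightarrow> real" assume "\<forall>c\<in>\<Union>c\<in>S. T c. y c = z c"
      then have "\<sigma> c y = \<sigma> c z" if "c \<in> S" for c
        using T[OF that] that by (intro depends_onD[of "T c" "\<sigma> c"]) auto
      then show "f (\<lambda>c. \<sigma> c y) = f (\<lambda>c. \<sigma> c z)"
        by (intro depends_onD[OF S(3)]) auto
    qed
    then have 1: "fin_dep L (\<lambda>y. f (\<lambda>c. \<sigma> c y))"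
      unfolding fin_dep_def using T S(1) by (intro exI[of _ "\<Union>c\<in>S. T c"]) auto
    have "f (\<lambda>c. \<sigma> c y) = f (\<lambda>c. if c \<in> S then \<sigma> c y else 0)" for y
      by (rule depends_onD[OF S(3)]) auto
    moreover have "continuous_on UNIV (\<lambda>y. f (\<lambda>c. if c \<in> S then \<sigma> c y else 0))"
    proof (rule continuous_on_compose2[OF Cn_continuous[OF f]])
      show "continuous_on UNIV (\<lambda>y c. if c \<in> S then \<sigma> c y else 0)"
      proof (rule continuous_on_coordinatewise_then_product)
        show "continuous_on UNIV (\<lambda>y. if c \<in> S then \<sigma> c y else 0)" for c
          using \<sigma>[of c] S(2) by (cases "c \<in> S") auto
      qed
    qed auto
    ultimately show ?thesis using 1 by simp
  qed
  {
    case 0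
    show ?case using base[OF 0] by (simp only: Cn.simps)
  next
    case (Suc n)
    obtain S where S: "finite S" "S \<subseteq> K" "depends_on S f"
      using Suc.prems unfolding Cn.simps fin_dep_def by blast
    define g where "g d = (\<Sum>c\<in>S. (\<lambda>y. pd c f (\<lambda>c. \<sigma> c y)) * pd d (\<sigma> c))" for d
    have b: "fin_dep L (\<lambda>y. f (\<lambda>c. \<sigma> c y)) \<and> continuous_on UNIV (\<lambda>y. f (\<lambda>c. \<sigma> c y))"
    proof (rule base[of f])
      show "Cn K 0 f" using Suc.prems(1) by simp
      show "Cn L 0 (\<sigma> c)" if "c \<in> K" for c using Suc.prems(2)[OF that] by simp
    qed
    show ?case
    proof (rule Cn_SucI[where g=g])
      show "Cn L n (g d)" for d
        unfolding g_def
      proof (intro Cn_sum Cn_mult)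
        fix c assume "c \<in> S"
        with S(2) have "c \<in> K" by blast
        from Suc.prems(2)[OF this] show "Cn L n (pd d (\<sigma> c))" by simp
        have "Cn K n (pd c f)" using Suc.prems(1) by simp
        then show "Cn L n (\<lambda>y. pd c f (\<lambda>c. \<sigma> c y))"
          by (rule Suc.IH) (rule Cn_Suc_imp, rule Suc.prems(2))
      qed
      fix d y
      have "((\<lambda>t. f (\<lambda>c. \<sigma> c (y(d := t)))) has_real_derivative
         (\<Sum>c\<in>S. pd c f (\<lambda>c. \<sigma> c (y(d := y d))) * pd d (\<sigma> c) (y(d := y d)))) (at (y d))"
      proof (rule Cn_chain[OF Suc.prems(1) S(1,3)])
        fix c t assume "c \<in> S"
        with S(2) Suc.prems(2)[of c] have "part_diff (\<sigma> c)" by auto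
        then show "((\<lambda>t. \<sigma> c (y(d := t))) has_real_derivative pd d (\<sigma> c) (y(d := t))) (at t)"
          by (rule part_diff_DERIV)
      qed
      then show "((\<lambda>t. f (\<lambda>c. \<sigma> c (y(d := t)))) has_real_derivative g d y) (at (y d))"
        by (simp add: g_def sum_fun_apply)
    qed (use b in blast)+
  }
qed

section \<open>Integrals over one coordinate, and symmetry of second derivatives\<close>

lemma continuous_on_upd: "continuous_on UNIV (\<lambda>p. (fst p :: coord \<Rightarrow> real)(c := snd p))"
proof (rule continuous_on_coordinatewise_then_product)
  fix d
  have "continuous_on UNIV (\<lambda>p::(coord \<Rightarrow> real) \<times> real. fst p d)"
    by (rule continuous_on_compose2[OF continuous_on_product_coordinates[where i=d]]) (auto intro: continuous_on_fst)
  then show "continuous_on UNIV (\<lambda>p. ((fst p :: coord \<Rightarrow> real)(c := snd p)) d)"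
    by (cases "d = c") (auto intro: continuous_on_fst continuous_on_snd continuous_on_id continuous_on_const continuous_on_Pair)
qed

lemma continuous_on_comp_upd:
  assumes "continuous_on UNIV f" "continuous_on A g" "continuous_on A h"
  shows "continuous_on A (\<lambda>x. f ((g x :: coord \<Rightarrow> real)(c := h x)))"
proof -
  have "continuous_on A (\<lambda>x. (g x)(c := h x))"
    using continuous_on_compose2[OF continuous_on_upd[of c], of A "\<lambda>x. (g x, h x)"] assms
    by (auto intro: continuous_on_fst continuous_on_snd continuous_on_id continuous_on_const continuous_on_Pair)
  then show ?thesis by (rule continuous_on_compose2[OF assms(1)]) auto
qed

text \<open>The integration variable is a coordinate, so integrands are again members of
  \<open>fnB\<close> and the closure properties apply to them.\<close>

definition pint :: "coord \<Rightarrow> fnB \<Rightarrow> fnB" where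
  "pint e f = (\<lambda>y. integral {0..1} (\<lambda>t. f (y(e := t))))"

lemma continuous_pint:
  assumes "continuous_on UNIV f"
  shows "continuous_on UNIV (pint e f)"
proof -
  have "continuous_on (UNIV \<times> cbox 0 1) (\<lambda>(y, t). f (y(e := t)))"
    unfolding split_beta by (intro continuous_on_comp_upd assms continuous_on_fst continuous_on_snd continuous_on_id)
  then show ?thesis
    unfolding pint_def using integral_continuous_on_param by fastforce
qed

lemma integrable_upd:
  fixes f :: fnB
  assumes "continuous_on UNIV f"
  shows "(\<lambda>t::real. f (y(e := t))) integrable_on {a..b}"
  by (rule integrable_continuous_real)
     (rule continuous_on_comp_upd[OF assms, where g="\<lambda>_. y" and h="\<lambda>t. t"], auto)

lemma pint_DERIV:
  assumes f: "Cn K (Suc n) f"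
  shows "((\<lambda>t. pint e f (y(c := t))) has_real_derivative (if c = e then 0 else pint e (pd c f)) y) (at (y c))"
proof (cases "c = e")
  case True
  then show ?thesis unfolding pint_def by simp
next
  case False
  have cont: "continuous_on UNIV f" "continuous_on UNIV (pd c f)"
    using f Cn_continuous by auto
  have "((\<lambda>s. integral (cbox 0 1) (\<lambda>t. f ((y(e := t))(c := s)))) has_real_derivative
     integral (cbox 0 1) (\<lambda>t. pd c f ((y(e := t))(c := y c)))) (at (y c) within UNIV)"
  proof (rule leibniz_rule_field_derivative)
    show "((\<lambda>s. f ((y(e := t))(c := s))) has_real_derivative pd c f ((y(e := t))(c := s))) (at s within UNIV)" for s t
      using f by (auto intro: part_diff_DERIV)
    show "(\<lambda>t. f ((y(e := t))(c := s))) integrable_on cbox 0 1" for s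
      using integrable_upd[OF cont(1), of "y(c := s)" e] False by (simp add: fun_upd_twist)
    show "continuous_on (UNIV \<times> cbox 0 1) (\<lambda>(s, t). pd c f ((y(e := t))(c := s)))"
      unfolding split_beta
      by (intro continuous_on_comp_upd[OF cont(2)] continuous_on_comp_upd[where f="\<lambda>x. x"] continuous_on_const continuous_on_fst continuous_on_snd continuous_on_id)
  qed auto
  moreover have "(y(e := t))(c := s) = (y(c := s))(e := t)" for s t
    using False by (simp add: fun_upd_twist)
  ultimately show ?thesis using False unfolding pint_def by simp
qed

lemma fin_dep_pint: "fin_dep K f \<Longrightarrow> fin_dep (K - {e}) (pint e f)"
proof -
  assume "fin_dep K f"
  then obtain S where S: "finite S" "S \<subseteq> K" "depends_on S f" unfolding fin_dep_def by blast
  have "depends_on (S - {e}) (pint e f)"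
    unfolding depends_on_def pint_def
  proof (intro allI impI arg_cong[where f="integral _"] ext)
    fix y z :: "coord \<Rightarrow> real" and t assume "\<forall>c\<in>S - {e}. y c = z c"
    then show "f (y(e := t)) = f (z(e := t))" by (intro depends_onD[OF S(3)]) auto
  qed
  then show ?thesis unfolding fin_dep_def using S by (intro exI[of _ "S - {e}"]) auto
qed

lemma Cn_pint: "Cn K n f \<Longrightarrow> Cn (K - {e}) n (pint e f)"
proof (induction n arbitrary: f)
  case 0
  then show ?case by (auto intro: fin_dep_pint continuous_pint)
next
  case (Suc n)
  show ?case
  proof (rule Cn_SucI[where g="\<lambda>c. if c = e then 0 else pint e (pd c f)"])
    show "Cn (K - {e}) n (if c = e then 0 else pint e (pd c f))" for c
      using Suc Cn_const[of _ _ 0] by (auto simp: zero_fun_def)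
    show "((\<lambda>t. pint e f (y(c := t))) has_real_derivative (if c = e then 0 else pint e (pd c f)) y) (at (y c))" for c y
      by (rule pint_DERIV[OF Suc.prems])
  qed (use Suc.prems in \<open>auto intro: fin_dep_pint continuous_pint\<close>)
qed

lemma pd_pint: "Cn K (Suc n) f \<Longrightarrow> c \<noteq> e \<Longrightarrow> pd c (pint e f) = pint e (pd c f)"
  using pd_eqI[OF pint_DERIV] by auto

text \<open>A difference of values of \<open>f\<close> is the integral of \<open>pd d f\<close>.
  Differentiating under the integral by \<open>c\<close>, and then by the upper limit, exhibits
  \<open>pd c (pd d f)\<close> as the \<open>d\<close>-derivative of \<open>pd c f\<close>.\<close>

lemma Cn_pd_commute:
  assumes f: "Cn K (Suc (Suc n)) f"
  shows "pd c (pd d f) = pd d (pd c f)"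
proof (cases "c = d")
  case False
  have pdf: "part_diff f" "part_diff (pd c f)" "part_diff (pd d f)"
    and cont: "continuous_on UNIV (pd d f)" "continuous_on UNIV (pd c (pd d f))"
    using f Cn_continuous[of K n] by auto
  show ?thesis
  proof
    fix y :: "coord \<Rightarrow> real"
    \<comment> \<open>A base point strictly below \<open>y d\<close> makes \<open>y d\<close>
      interior to the interval of integration, so the derivative within the interval becomes
      two-sided.\<close>
    define B where "B = y d - 1"
    define u where "u a s = y(c := a, d := s)" for a s :: real
    have u': "u a s = (y(d := s))(c := a)" "u a s = (y(c := a))(d := s)" for a s
      using False by (auto simp: u_def)
    have ftc: "integral {B..s} (\<lambda>\<tau>. pd d f (u a \<tau>)) = f (u a s) - f (u a B)" if "B \<le> s" for a s
    proof (rule integral_unique, rule fundamental_theorem_of_calculus[OF that])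
      show "((\<lambda>s. f (u a s)) has_vector_derivative pd d f (u a x)) (at x within {B..s})" for x
        unfolding u'(2) has_real_derivative_iff_has_vector_derivative[symmetric]
        by (rule has_field_derivative_at_within, rule part_diff_DERIV[OF pdf(1)])
    qed
    have key: "integral {B..s} (\<lambda>\<tau>. pd c (pd d f) (u (y c) \<tau>)) = pd c f (u (y c) s) - pd c f (u (y c) B)"
      if "B \<le> s" for s
    proof -
      have "((\<lambda>a. integral (cbox B s) (\<lambda>\<tau>. pd d f (u a \<tau>))) has_real_derivative
          integral (cbox B s) (\<lambda>\<tau>. pd c (pd d f) (u (y c) \<tau>))) (at (y c) within UNIV)"
      proof (rule leibniz_rule_field_derivative)
        show "((\<lambda>a. pd d f (u a t)) has_real_derivative pd c (pd d f) (u a t)) (at a within UNIV)" for a t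
          unfolding u'(1) using part_diff_DERIV[OF pdf(3)] by simp
        show "(\<lambda>\<tau>. pd d f (u a \<tau>)) integrable_on cbox B s" for a
          using integrable_upd[OF cont(1)] unfolding u'(2) by simp
        show "continuous_on (UNIV \<times> cbox B s) (\<lambda>(a, \<tau>). pd c (pd d f) (u a \<tau>))"
          unfolding u_def split_beta
          by (intro continuous_on_comp_upd[OF cont(2)] continuous_on_comp_upd[where f="\<lambda>x. x"] continuous_on_const continuous_on_fst continuous_on_snd continuous_on_id)
      qed auto
      then have 1: "((\<lambda>a. f (u a s) - f (u a B)) has_real_derivative
          integral {B..s} (\<lambda>\<tau>. pd c (pd d f) (u (y c) \<tau>))) (at (y c))"
        using ftc[OF that] by simp
      have "((\<lambda>a. f (u a s) - f (u a B)) has_real_derivative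
          pd c f (u (y c) s) - pd c f (u (y c) B)) (at (y c))"
        unfolding u'(1) by (intro derivative_intros part_diff_DERIV[OF pdf(1)])
      with 1 show ?thesis by (rule DERIV_unique)
    qed
    have "((\<lambda>s. integral {B..s} (\<lambda>\<tau>. pd c (pd d f) (u (y c) \<tau>))) has_real_derivative
        pd c (pd d f) (u (y c) (y d))) (at (y d) within {B..y d + 1})"
      by (rule integral_has_real_derivative)
         (auto simp: u'(2) B_def intro!: continuous_on_comp_upd[OF cont(2)] continuous_on_const continuous_on_id)
    then have "((\<lambda>s. pd c f (u (y c) s) - pd c f (u (y c) B)) has_real_derivative
        pd c (pd d f) (u (y c) (y d))) (at (y d) within {B..y d + 1})"
      by (rule has_field_derivative_transform_within[where d=1]) (use key in \<open>auto simp: B_def\<close>)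
    then have 1: "((\<lambda>s. pd c f (u (y c) s) - pd c f (u (y c) B)) has_real_derivative
        pd c (pd d f) y) (at (y d))"
      by (subst (asm) at_within_Icc_at) (auto simp: B_def u_def)
    have "((\<lambda>s. pd c f (u (y c) s) - pd c f (u (y c) B)) has_real_derivative
        pd d (pd c f) ((y(c := y c))(d := y d)) - 0) (at (y d))"
      unfolding u'(2) by (intro derivative_intros part_diff_DERIV[OF pdf(2)])
    then have "((\<lambda>s. pd c f (u (y c) s) - pd c f (u (y c) B)) has_real_derivative pd d (pd c f) y) (at (y d))"
      by simp
    with 1 show "pd c (pd d f) y = pd d (pd c f) y" by (rule DERIV_unique)
  qed
qed auto

section \<open>The algebra of smooth functions and its derivations\<close>

lemma smoothI: "(\<And>n. Cn K n f) \<Longrightarrow> f \<in> smooth K"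
  by (simp add: smooth_def)

lemma smoothD: "f \<in> smooth K \<Longrightarrow> Cn K n f"
  by (simp add: smooth_def)

lemma smooth_part_diff: "f \<in> smooth K \<Longrightarrow> part_diff f"
  using smoothD[of f K "Suc 0"] by simp

lemma smooth_continuous: "f \<in> smooth K \<Longrightarrow> continuous_on UNIV f"
  by (rule Cn_continuous[OF smoothD[where n=0]])

lemma smooth_fin_dep: "f \<in> smooth K \<Longrightarrow> fin_dep K f"
  by (rule Cn_fin_dep[OF smoothD[where n=0]])

lemma smooth_pd [intro]: "f \<in> smooth K \<Longrightarrow> pd c f \<in> smooth K"
  by (rule smoothI) (use smoothD[of f K "Suc n" for n] in simp)

lemma smooth_const [intro, simp]: "(\<lambda>y. a) \<in> smooth K"
  by (rule smoothI) (rule Cn_const)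

lemma smooth_0 [intro, simp]: "0 \<in> smooth K" and smooth_1 [intro, simp]: "1 \<in> smooth K"
  unfolding zero_fun_def one_fun_def by (rule smooth_const)+

lemma smooth_cx [intro]: "c \<in> K \<Longrightarrow> cx c \<in> smooth K"
  by (rule smoothI) (rule Cn_cx)

lemma smooth_add [intro]: "f \<in> smooth K \<Longrightarrow> g \<in> smooth K \<Longrightarrow> f + g \<in> smooth K"
  by (rule smoothI, rule Cn_add; rule smoothD; blast)

lemma smooth_mult [intro]: "f \<in> smooth K \<Longrightarrow> g \<in> smooth K \<Longrightarrow> f * g \<in> smooth K"
  by (rule smoothI, rule Cn_mult; rule smoothD; blast)

lemma smooth_sum: "(\<And>i. i \<in> I \<Longrightarrow> f i \<in> smooth K) \<Longrightarrow> (\<Sum>i\<in>I. f i) \<in> smooth K"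
  by (rule smoothI, rule Cn_sum; rule smoothD; blast)

lemma fnB_uminus_eq: "- f = (\<lambda>y. -1) * (f :: fnB)"
  by (simp add: fun_eq_iff)

lemma smooth_uminus [intro]: "f \<in> smooth K \<Longrightarrow> - f \<in> smooth K"
  unfolding fnB_uminus_eq by (intro smooth_mult smooth_const)

lemma smooth_diff [intro]: "f \<in> smooth K \<Longrightarrow> g \<in> smooth K \<Longrightarrow> f - g \<in> smooth K"
  unfolding diff_conv_add_uminus by (intro smooth_add smooth_uminus)

lemma smooth_compose:
  assumes "f \<in> smooth K" "\<And>c. c \<in> K \<Longrightarrow> \<sigma> c \<in> smooth L"
  shows "(\<lambda>y. f (\<lambda>c. \<sigma> c y)) \<in> smooth L"
proof (rule smoothI)
  show "Cn L n (\<lambda>y. f (\<lambda>c. \<sigma> c y))" for n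
    by (rule Cn_compose[OF smoothD[OF assms(1)] smoothD[OF assms(2)]])
qed

lemma smooth_pint: "f \<in> smooth K \<Longrightarrow> pint e f \<in> smooth (K - {e})"
  by (rule smoothI, rule Cn_pint; rule smoothD; blast)

lemma smooth_pd_pint: "f \<in> smooth K \<Longrightarrow> c \<noteq> e \<Longrightarrow> pd c (pint e f) = pint e (pd c f)"
  by (rule pd_pint[OF smoothD[where n="Suc 0"]])

lemma smooth_pd_commute: "f \<in> smooth K \<Longrightarrow> pd c (pd d f) = pd d (pd c f)"
  by (rule Cn_pd_commute[OF smoothD[where n="Suc (Suc 0)"]])

lemma smooth_pd_add: "f \<in> smooth K \<Longrightarrow> g \<in> smooth L \<Longrightarrow> pd c (f + g) = pd c f + pd c g"
  by (intro pd_add smooth_part_diff)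

lemma smooth_pd_mult: "f \<in> smooth K \<Longrightarrow> g \<in> smooth L \<Longrightarrow> pd c (f * g) = pd c f * g + f * pd c g"
  by (simp add: pd_mult[OF smooth_part_diff smooth_part_diff] mult.commute)

lemma smooth_pd_uminus: "f \<in> smooth K \<Longrightarrow> pd c (- f) = - pd c f"
  unfolding fnB_uminus_eq[of f] fnB_uminus_eq[of "pd c f"]
  by (simp add: smooth_pd_mult[OF smooth_const[where K=K]])

lemma smooth_pd_sum:
  "(\<And>i. i \<in> I \<Longrightarrow> f i \<in> smooth K) \<Longrightarrow> pd c (\<Sum>i\<in>I. f i) = (\<Sum>i\<in>I. pd c (f i))"
proof (induction I rule: infinite_finite_induct)
  case (insert i I)
  have "pd c (f i + (\<Sum>i\<in>I. f i)) = pd c (f i) + pd c (\<Sum>i\<in>I. f i)"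
    using insert by (intro smooth_pd_add[of _ K _ K] smooth_sum) auto
  also have "pd c (\<Sum>i\<in>I. f i) = (\<Sum>i\<in>I. pd c (f i))"
    using insert by auto
  finally show ?case by (simp only: sum.insert[OF insert.hyps])
qed auto

text \<open>\<open>dep\<close> tests one coordinate at a time, which in infinitely many variables
  does not determine a function. Finite dependence closes the gap: between two points agreeing on
  \<open>dep f\<close>, the finitely many remaining coordinates of \<open>S\<close> are changed one
  by one.\<close>

lemma smooth_dep:
  assumes "f \<in> smooth K"
  shows "finite (dep f)" "dep f \<subseteq> K" "depends_on (dep f) f"
proof -
  obtain S where S: "finite S" "S \<subseteq> K" "depends_on S f"
    using smooth_fin_dep[OF assms] unfolding fin_dep_def by blast
  have "dep f \<subseteq> S"
  proof (rule subsetI, rule ccontr)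
    fix c assume "c \<in> dep f" "c \<notin> S"
    then obtain y t where "f (y(c := t)) \<noteq> f y" unfolding dep_def by blast
    moreover have "f (y(c := t)) = f y"
      by (rule depends_onD[OF S(3)]) (use \<open>c \<notin> S\<close> in auto)
    ultimately show False by simp
  qed
  then show "finite (dep f)" "dep f \<subseteq> K" using S finite_subset by auto
  have upd: "finite T \<Longrightarrow> T \<inter> dep f = {} \<Longrightarrow> f (\<lambda>c. if c \<in> T then z c else y c) = f y" for T y z
  proof (induction T rule: finite_induct)
    case (insert a T)
    have "(\<lambda>c. if c \<in> insert a T then z c else y c) = (\<lambda>c. if c \<in> T then z c else y c)(a := z a)"
      by auto
    then show ?case using insert unfolding dep_def by auto
  qed simp
  show "depends_on (dep f) f"
    unfolding depends_on_def
  proof (intro allI impI)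
    fix y z :: "coord \<Rightarrow> real" assume *: "\<forall>c\<in>dep f. y c = z c"
    have "f y = f (\<lambda>c. if c \<in> S - dep f then z c else y c)"
      by (rule upd[symmetric]) (use S in auto)
    also have "\<dots> = f z" by (rule depends_onD[OF S(3)]) (use * in auto)
    finally show "f y = f z" .
  qed
qed

lemma pd_notin_dep:
  assumes "c \<notin> dep f"
  shows "pd c f = 0"
proof -
  have "f (y(c := t)) = f y" for y t using assms unfolding dep_def by blast
  then show ?thesis unfolding pd_def by (simp add: zero_fun_def)
qed

lemma notin_dep_if_pd_0:
  assumes "part_diff f" "pd c f = 0"
  shows "c \<notin> dep f"
proof
  assume "c \<in> dep f"
  then obtain y t where *: "f (y(c := t)) \<noteq> f y" unfolding dep_def by blast
  have "((\<lambda>t. f (y(c := t))) has_real_derivative 0) (at s)" for s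
    using part_diff_DERIV[OF assms(1), of y c s] assms(2) by simp
  then have "f (y(c := t)) = f (y(c := y c))"
    by (rule DERIV_isconst_all[rule_format])
  with * show False by simp
qed

text \<open>Partial derivatives of a function of the coordinates in \<open>D\<close> again depend on
  \<open>D\<close> alone, so one finite set serves all orders.\<close>

lemma smooth_if_dep:
  assumes "f \<in> smooth K" "dep f \<subseteq> L"
  shows "f \<in> smooth L"
proof -
  have "Cn L n f" if "Cn K n f" "finite D" "D \<subseteq> L" "depends_on D f" for n D f
    using that
  proof (induction n arbitrary: f)
    case (Suc n)
    have "depends_on D (pd c f)" for c
      unfolding depends_on_def
    proof (intro allI impI)
      fix y z :: "coord \<Rightarrow> real" assume *: "\<forall>c\<in>D. y c = z c"
      have eq: "f (y(c := t)) = f (z(c := t))" for t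
        by (rule depends_onD[OF Suc.prems(4)]) (use * in auto)
      show "pd c f y = pd c f z"
      proof (cases "c \<in> D")
        case True
        then show ?thesis using * unfolding pd_def eq by simp
      next
        case False
        have "f (w(c := t)) = f w" for w t
          by (rule depends_onD[OF Suc.prems(4)]) (use False in auto)
        then show ?thesis unfolding pd_def by simp
      qed
    qed
    moreover have "fin_dep L f" using Suc.prems unfolding fin_dep_def by blast
    ultimately show ?case using Suc by auto
  qed (auto simp: fin_dep_def)
  then show ?thesis using assms smooth_dep[OF assms(1)] by (intro smoothI) (blast dest: smoothD)
qed

section \<open>Vector fields in infinitely many coordinates acting on functions of finitely
  many\<close>

definition vf :: "(coord \<Rightarrow> fnB) \<Rightarrow> fnB \<Rightarrow> fnB" where
  "vf b f = (\<Sum>c\<in>dep f. b c * pd c f)"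

lemma vf_eq: "finite S \<Longrightarrow> dep f \<subseteq> S \<Longrightarrow> vf b f = (\<Sum>c\<in>S. b c * pd c f)"
  unfolding vf_def by (rule sum.mono_neutral_left) (auto simp: pd_notin_dep)

lemma vf_eq2:
  assumes "f \<in> smooth K" "g \<in> smooth L"
  shows "vf b f = (\<Sum>c\<in>dep f \<union> dep g. b c * pd c f)" "vf b g = (\<Sum>c\<in>dep f \<union> dep g. b c * pd c g)"
  using assms by (auto intro!: vf_eq dest: smooth_dep(1))

lemma dep_binop: "dep (\<lambda>y. h (f y) (g y)) \<subseteq> dep f \<union> dep g"
  unfolding dep_def by auto metis

lemma vf_add:
  assumes "f \<in> smooth K" "g \<in> smooth K"
  shows "vf b (f + g) = vf b f + vf b g"
proof -
  have "dep (f + g) \<subseteq> dep f \<union> dep g"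
    unfolding plus_fun_def by (rule dep_binop)
  then have "vf b (f + g) = (\<Sum>c\<in>dep f \<union> dep g. b c * pd c (f + g))"
    by (intro vf_eq) (use assms smooth_dep in auto)
  then show ?thesis
    using assms by (simp add: vf_eq2[OF assms] smooth_pd_add sum.distrib distrib_left)
qed

lemma vf_mult:
  assumes "f \<in> smooth K" "g \<in> smooth K"
  shows "vf b (f * g) = vf b f * g + f * vf b g"
proof -
  have "dep (f * g) \<subseteq> dep f \<union> dep g"
    unfolding times_fun_def by (rule dep_binop)
  then have "vf b (f * g) = (\<Sum>c\<in>dep f \<union> dep g. b c * pd c (f * g))"
    by (intro vf_eq) (use assms smooth_dep in auto)
  then show ?thesis
    using assms by (simp add: vf_eq2[OF assms] smooth_pd_mult[OF assms] sum.distrib distrib_left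
        sum_distrib_left sum_distrib_right ac_simps)
qed

lemma vf_const [simp]: "vf b (\<lambda>y. a) = 0" "vf b 0 = 0" "vf b 1 = 0"
  by (simp_all add: vf_def)

lemma vf_cx [simp]: "vf b (cx c) = b c"
proof -
  have "vf b (cx c) = (\<Sum>d\<in>{c}. b d * pd d (cx c))"
    by (rule vf_eq) (auto simp: dep_def split: if_splits)
  then show ?thesis by (simp add: pd_cx)
qed

lemma vf_uminus: "f \<in> smooth K \<Longrightarrow> vf b (- f) = - vf b f"
  by (simp add: fnB_uminus_eq[of f] vf_mult[OF smooth_const] fnB_uminus_eq[of "vf b f"])

lemma vf_diff: "f \<in> smooth K \<Longrightarrow> g \<in> smooth K \<Longrightarrow> vf b (f - g) = vf b f - vf b g"
  unfolding diff_conv_add_uminus by (subst vf_add[of _ K]) (auto simp: vf_uminus)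

lemma vf_sum:
  "(\<And>i. i \<in> I \<Longrightarrow> f i \<in> smooth K) \<Longrightarrow> vf b (\<Sum>i\<in>I. f i) = (\<Sum>i\<in>I. vf b (f i))"
proof (induction I rule: infinite_finite_induct)
  case (insert i I)
  have "vf b (f i + (\<Sum>i\<in>I. f i)) = vf b (f i) + vf b (\<Sum>i\<in>I. f i)"
    using insert by (intro vf_add[of _ K] smooth_sum) auto
  also have "vf b (\<Sum>i\<in>I. f i) = (\<Sum>i\<in>I. vf b (f i))"
    using insert by auto
  finally show ?case by (simp only: sum.insert[OF insert.hyps])
qed auto

lemma vf_smooth:
  assumes "f \<in> smooth K" "K \<subseteq> L" "\<And>c. c \<in> K \<Longrightarrow> b c \<in> smooth L"
  shows "vf b f \<in> smooth L"
  unfolding vf_def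
proof (intro smooth_sum smooth_mult)
  fix c assume "c \<in> dep f"
  then show "b c \<in> smooth L" using smooth_dep(2)[OF assms(1)] assms(3) by blast
  show "pd c f \<in> smooth L" using assms(1,2) by (auto intro: smooth_mono)
qed

lemma dep_pd:
  assumes "f \<in> smooth K"
  shows "dep (pd c f) \<subseteq> dep f"
proof -
  have "f \<in> smooth (dep f)" using smooth_if_dep[OF assms] by blast
  then show ?thesis by (rule smooth_dep(2)[OF smooth_pd])
qed

text \<open>The commutator of a coordinate derivative with a vector field is the field with
  differentiated components; the correction terms in \<open>pd_D\<close> and \<open>pd_D1\<close>
  come from here.\<close>

lemma pd_vf:
  assumes f: "f \<in> smooth K" and b: "\<And>c. c \<in> K \<Longrightarrow> b c \<in> smooth L"
  shows "pd d (vf b f) = vf b (pd d f) + (\<Sum>c\<in>dep f. pd d (b c) * pd c f)"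
proof -
  have fin: "finite (dep f)" and sub: "dep f \<subseteq> K" using smooth_dep[OF f] by auto
  have "pd d (vf b f) = (\<Sum>c\<in>dep f. pd d (b c * pd c f))"
    unfolding vf_def
    by (rule smooth_pd_sum[of _ _ "K \<union> L"])
       (use sub f b in \<open>auto intro!: smooth_mult intro: smooth_mono\<close>)
  also have "\<dots> = (\<Sum>c\<in>dep f. pd d (b c) * pd c f + b c * pd d (pd c f))"
    using sub b f by (intro sum.cong refl smooth_pd_mult[of _ L _ K]) auto
  also have "\<dots> = (\<Sum>c\<in>dep f. b c * pd c (pd d f)) + (\<Sum>c\<in>dep f. pd d (b c) * pd c f)"
    by (simp add: sum.distrib smooth_pd_commute[OF f, of d] add.commute)
  also have "(\<Sum>c\<in>dep f. b c * pd c (pd d f)) = vf b (pd d f)"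
    by (rule vf_eq[symmetric, OF fin dep_pd[OF f]])
  finally show ?thesis .
qed

lemma vf_vf:
  assumes f: "f \<in> smooth K" and b: "\<And>c. c \<in> K \<Longrightarrow> b c \<in> smooth K"
  shows "vf a (vf b f) = (\<Sum>c\<in>dep f. vf a (b c) * pd c f) + (\<Sum>c\<in>dep f. \<Sum>d\<in>dep f. b c * a d * pd d (pd c f))"
proof -
  have fin: "finite (dep f)" and sub: "dep f \<subseteq> K" using smooth_dep[OF f] by auto
  have "vf a (vf b f) = (\<Sum>c\<in>dep f. vf a (b c * pd c f))"
    unfolding vf_def[of b]
    by (rule vf_sum[of _ _ K]) (use sub f b in \<open>auto intro!: smooth_mult\<close>)
  also have "\<dots> = (\<Sum>c\<in>dep f. vf a (b c) * pd c f + b c * vf a (pd c f))"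
    using sub b f by (intro sum.cong refl vf_mult[of _ K]) auto
  also have "\<dots> = (\<Sum>c\<in>dep f. vf a (b c) * pd c f) + (\<Sum>c\<in>dep f. b c * vf a (pd c f))"
    by (simp add: sum.distrib)
  also have "(\<Sum>c\<in>dep f. b c * vf a (pd c f)) = (\<Sum>c\<in>dep f. \<Sum>d\<in>dep f. b c * a d * pd d (pd c f))"
    by (simp add: vf_eq[OF fin dep_pd[OF f]] sum_distrib_left mult.assoc)
  finally show ?thesis .
qed

text \<open>The second-order part of \<open>vf_vf\<close> is symmetric in the two fields because
  partial derivatives commute, so commuting on coordinates suffices.\<close>

lemma vf_commute:
  assumes f: "f \<in> smooth K"
    and ab: "\<And>c. c \<in> K \<Longrightarrow> a c \<in> smooth K" "\<And>c. c \<in> K \<Longrightarrow> b c \<in> smooth K"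
    and comm: "\<And>c. c \<in> K \<Longrightarrow> vf a (b c) = vf b (a c)"
  shows "vf a (vf b f) = vf b (vf a f)"
proof -
  have sub: "dep f \<subseteq> K" using smooth_dep[OF f] by auto
  have "(\<Sum>c\<in>dep f. \<Sum>d\<in>dep f. b c * a d * pd d (pd c f)) = (\<Sum>c\<in>dep f. \<Sum>d\<in>dep f. a c * b d * pd d (pd c f))"
    by (subst sum.swap) (simp add: smooth_pd_commute[OF f] mult.commute)
  moreover have "(\<Sum>c\<in>dep f. vf a (b c) * pd c f) = (\<Sum>c\<in>dep f. vf b (a c) * pd c f)"
    using comm sub by (intro sum.cong) auto
  ultimately show ?thesis
    by (simp only: vf_vf[OF f ab(1)] vf_vf[OF f ab(2)])
qed

section \<open>Total derivatives\<close>

primrec up :: "nat \<Rightarrow> nat \<Rightarrow> coord \<Rightarrow> coord" where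
  "up \<alpha> n (Xc \<mu>) = Xc \<mu>"
| "up \<alpha> n (Uc l i) = Uc l (i(\<alpha> := i \<alpha> + n))"
| "up \<alpha> n (Pc i) = Pc (i(\<alpha> := i \<alpha> + n))"

primrec tdb :: "nat \<Rightarrow> coord \<Rightarrow> fnB" where
  "tdb \<mu> (Xc \<nu>) = (if \<nu> = \<mu> then 1 else 0)"
| "tdb \<mu> (Uc l i) = cx (Uc l (addm i \<mu>))"
| "tdb \<mu> (Pc i) = cx (Pc (addm i \<mu>))"

lemma TD_eq_vf:
  assumes "f \<in> smooth K"
  shows "TD \<mu> f = vf (tdb \<mu>) f"
proof -
  have fin: "finite (dep f)" by (rule smooth_dep(1)[OF assms])
  have "tdb \<mu> c * pd c f = (if c = Xc \<mu> then pd (Xc \<mu>) f else 0) + shiftc \<mu> c * pd c f" for c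
    by (cases c) (auto simp: fun_eq_iff shiftc_def)
  then have "vf (tdb \<mu>) f = (\<Sum>c\<in>dep f. if c = Xc \<mu> then pd (Xc \<mu>) f else 0) + (\<Sum>c\<in>dep f. shiftc \<mu> c * pd c f)"
    unfolding vf_def by (simp add: sum.distrib)
  also have "(\<Sum>c\<in>dep f. if c = Xc \<mu> then pd (Xc \<mu>) f else 0) = pd (Xc \<mu>) f"
    using fin pd_notin_dep[of "Xc \<mu>" f] by simp
  finally show ?thesis
    unfolding TD_def by (simp add: fun_eq_iff sum_fun_apply)
qed

lemma addm_MI: "i \<in> MI m \<Longrightarrow> \<mu> \<in> {1..m} \<Longrightarrow> addm i \<mu> \<in> MI m"
  unfolding MI_def addm_def by auto

lemma addm_commute: "addm (addm i \<mu>) \<nu> = addm (addm i \<nu>) \<mu>"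
  unfolding addm_def by (auto simp: fun_eq_iff)

lemma coords_simps [simp]:
  "Xc \<mu> \<in> coords m \<longleftrightarrow> \<mu> \<in> {1..m}"
  "Uc l i \<in> coords m \<longleftrightarrow> l \<in> {1..m} \<and> i \<in> MI m"
  "Pc i \<in> coords m \<longleftrightarrow> i \<in> MI m"
  unfolding coords_def by auto

lemma tdb_smooth: "\<mu> \<in> {1..m} \<Longrightarrow> c \<in> coords m \<Longrightarrow> tdb \<mu> c \<in> smooth (coords m)"
  by (cases c) (auto intro!: smooth_cx addm_MI)

lemma TD_AB:
  assumes "f \<in> AB m" "\<mu> \<in> {1..m}"
  shows "TD \<mu> f \<in> AB m"
proof -
  have f: "f \<in> smooth (coords m)" using assms by (simp add: AB_eq_smooth)
  show ?thesis
    unfolding AB_eq_smooth TD_eq_vf[OF f]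
    by (rule vf_smooth[OF f subset_refl tdb_smooth[OF assms(2)]])
qed

lemma TD_commute:
  assumes "f \<in> AB m" "\<mu> \<in> {1..m}" "\<nu> \<in> {1..m}"
  shows "TD \<mu> (TD \<nu> f) = TD \<nu> (TD \<mu> f)"
proof -
  have f: "f \<in> smooth (coords m)" "TD \<mu> f \<in> smooth (coords m)" "TD \<nu> f \<in> smooth (coords m)"
    using assms TD_AB by (simp_all add: AB_eq_smooth)
  have "vf (tdb \<mu>) (vf (tdb \<nu>) f) = vf (tdb \<nu>) (vf (tdb \<mu>) f)"
  proof (rule vf_commute[OF f(1) tdb_smooth[OF assms(2)] tdb_smooth[OF assms(3)]])
    show "vf (tdb \<mu>) (tdb \<nu> c) = vf (tdb \<nu>) (tdb \<mu> c)" for c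
      by (cases c) (auto simp: addm_commute)
  qed
  then show ?thesis
    by (simp only: TD_eq_vf[OF f(1)] TD_eq_vf[OF f(2)[unfolded TD_eq_vf[OF f(1)]]] TD_eq_vf[OF f(3)[unfolded TD_eq_vf[OF f(1)]]])
qed

section \<open>Homotopy integrals\<close>

lemma smooth_upd_other:
  assumes "f \<in> smooth K" "e \<notin> K"
  shows "f (y(e := t)) = f y"
  by (rule depends_onD[OF smooth_dep(3)[OF assms(1)]]) (use assms smooth_dep(2)[OF assms(1)] in auto)

definition hmix :: "coord \<Rightarrow> (coord \<Rightarrow> fnB) \<Rightarrow> coord \<Rightarrow> fnB" where
  "hmix e \<tau> d = \<tau> d + cx e * (cx d - \<tau> d)"

text \<open>The integral of \<open>h\<close> along the segment from \<open>\<tau> y\<close> to \<open>y\<close>; the coordinate \<open>e\<close>, on which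
  nothing else depends, carries the integration variable.\<close>
definition hint :: "coord \<Rightarrow> (coord \<Rightarrow> fnB) \<Rightarrow> fnB \<Rightarrow> fnB" where
  "hint e \<tau> h = pint e (\<lambda>y. h (\<lambda>d. hmix e \<tau> d y))"

lemma hmix_smooth: "c \<in> K \<Longrightarrow> \<tau> c \<in> smooth K \<Longrightarrow> hmix e \<tau> c \<in> smooth (insert e K)"
  unfolding hmix_def by (intro smooth_add smooth_mult smooth_diff smooth_cx) (auto intro: smooth_mono)

lemma hmix_compose_smooth:
  assumes "h \<in> smooth K" "\<And>c. c \<in> K \<Longrightarrow> \<tau> c \<in> smooth K"
  shows "(\<lambda>y. h (\<lambda>d. hmix e \<tau> d y)) \<in> smooth (insert e K)"
  by (rule smooth_compose[OF assms(1)]) (use assms(2) hmix_smooth in blast)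

lemma hint_smooth:
  assumes "h \<in> smooth K" "\<And>c. c \<in> K \<Longrightarrow> \<tau> c \<in> smooth K" "e \<notin> K"
  shows "hint e \<tau> h \<in> smooth K"
proof -
  have "hint e \<tau> h \<in> smooth (insert e K - {e})"
    unfolding hint_def by (rule smooth_pint[OF hmix_compose_smooth]) (use assms in auto)
  with assms(3) show ?thesis by simp
qed

text \<open>The fundamental theorem of calculus along the segment from \<open>\<tau> y\<close> to
  \<open>y\<close>. With \<open>\<tau>\<close> the elimination of the continuity equations it yields
  ideal membership; with \<open>\<tau>\<close> sending all jets to zero it yields the scaling
  homotopy.\<close>

lemma hadamard:
  assumes f: "f \<in> smooth K" and \<tau>: "\<And>c. c \<in> K \<Longrightarrow> \<tau> c \<in> smooth K" and e: "e \<notin> K"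
  shows "f - (\<lambda>y. f (\<lambda>d. \<tau> d y)) = (\<Sum>c\<in>dep f. (cx c - \<tau> c) * hint e \<tau> (pd c f))"
proof
  fix y :: "coord \<Rightarrow> real"
  have fin: "finite (dep f)" and sub: "dep f \<subseteq> K" and dp: "depends_on (dep f) f"
    using smooth_dep[OF f] by auto
  define \<gamma> where "\<gamma> d t = hmix e \<tau> d (y(e := t))" for d t
  have \<gamma>: "\<gamma> d = (\<lambda>t. \<tau> d y + t * (y d - \<tau> d y))" if "d \<in> dep f" for d
  proof
    fix t
    have "d \<in> K" "d \<noteq> e" using that sub e by auto
    then show "\<gamma> d t = \<tau> d y + t * (y d - \<tau> d y)"
      using smooth_upd_other[OF \<tau> e, of d y t] by (simp add: \<gamma>_def hmix_def)
  qed
  have der: "((\<lambda>t. f (\<lambda>d. \<gamma> d t)) has_real_derivative (\<Sum>c\<in>dep f. pd c f (\<lambda>d. \<gamma> d t) * (y c - \<tau> c y))) (at t)" for t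
    by (rule Cn_chain[OF smoothD[OF f] fin dp]) (auto simp: \<gamma> intro!: derivative_eq_intros)
  have 1: "((\<lambda>t. \<Sum>c\<in>dep f. pd c f (\<lambda>d. \<gamma> d t) * (y c - \<tau> c y)) has_integral
        f (\<lambda>d. \<gamma> d 1) - f (\<lambda>d. \<gamma> d 0)) {0..1}"
    by (rule fundamental_theorem_of_calculus)
       (auto simp: has_real_derivative_iff_has_vector_derivative[symmetric] intro: has_field_derivative_at_within der)
  have "((\<lambda>t. pd c f (\<lambda>d. \<gamma> d t)) has_integral hint e \<tau> (pd c f) y) {0..1}" for c
    unfolding hint_def pint_def \<gamma>_def
    by (rule integrable_integral)
       (rule integrable_upd[OF smooth_continuous[OF hmix_compose_smooth[OF smooth_pd[OF f] \<tau>]]])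
  then have 2: "((\<lambda>t. \<Sum>c\<in>dep f. pd c f (\<lambda>d. \<gamma> d t) * (y c - \<tau> c y)) has_integral
       (\<Sum>c\<in>dep f. hint e \<tau> (pd c f) y * (y c - \<tau> c y))) {0..1}"
    by (intro has_integral_sum fin has_integral_mult_left) auto
  have "f (\<lambda>d. \<gamma> d 1) = f y" "f (\<lambda>d. \<gamma> d 0) = f (\<lambda>d. \<tau> d y)"
    by (rule depends_onD[OF dp], simp add: \<gamma>)+
  with has_integral_unique[OF 1 2]
  show "(f - (\<lambda>y. f (\<lambda>d. \<tau> d y))) y = (\<Sum>c\<in>dep f. (cx c - \<tau> c) * hint e \<tau> (pd c f)) y"
    by (simp add: sum_fun_apply mult.commute)
qed

section \<open>Elimination of the continuity equation\<close>

definition rc :: "nat \<Rightarrow> coord set" where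
  "rc m = {c \<in> coords m. \<forall>k. c = Uc 1 k \<longrightarrow> k 1 = 0}"

lemma rc_simps [simp]:
  "Xc \<mu> \<in> rc m \<longleftrightarrow> \<mu> \<in> {1..m}"
  "Uc l i \<in> rc m \<longleftrightarrow> l \<in> {1..m} \<and> i \<in> MI m \<and> (l = 1 \<longrightarrow> i 1 = 0)"
  "Pc i \<in> rc m \<longleftrightarrow> i \<in> MI m"
  unfolding rc_def by auto

lemma rc_coords: "rc m \<subseteq> coords m"
  unfolding rc_def by auto

text \<open>The coordinates \<open>rc m\<close> parametrize CE; \<open>rho\<close> expresses all coordinates by them on CE, hence
  \<open>red\<close> restricts functions to CE.\<close>
primrec rho :: "nat \<Rightarrow> coord \<Rightarrow> fnB" where
  "rho m (Xc \<mu>) = cx (Xc \<mu>)"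
| "rho m (Uc l k) = (if l = 1 \<and> k 1 > 0 then - (\<Sum>\<beta>=2..m. cx (Uc \<beta> (addm (k(1 := k 1 - 1)) \<beta>))) else cx (Uc l k))"
| "rho m (Pc i) = cx (Pc i)"

definition red :: "nat \<Rightarrow> fnB \<Rightarrow> fnB" where
  "red m f = (\<lambda>y. f (\<lambda>c. rho m c y))"

lemma rho_rc: "c \<in> rc m \<Longrightarrow> rho m c = cx c"
  by (cases c) auto

lemma MI_upd: "k \<in> MI m \<Longrightarrow> \<mu> \<in> {1..m} \<Longrightarrow> k(\<mu> := n) \<in> MI m"
  unfolding MI_def by auto

lemma rho_smooth:
  assumes "c \<in> coords m"
  shows "rho m c \<in> smooth (rc m)"
proof (cases "c \<in> rc m")
  case True
  then show ?thesis by (simp add: rho_rc smooth_cx)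
next
  case False
  then obtain k where c: "c = Uc 1 k" "k 1 > 0" "k \<in> MI m" "1 \<le> m"
    using assms unfolding rc_def by auto
  have "cx (Uc \<beta> (addm (k(1 := k 1 - 1)) \<beta>)) \<in> smooth (rc m)" if "\<beta> \<in> {2..m}" for \<beta>
    using that c by (intro smooth_cx) (auto intro!: addm_MI MI_upd)
  then show ?thesis unfolding c using c(2) by (auto intro!: smooth_uminus smooth_sum)
qed

lemma red_add: "red m (f + g) = red m f + red m g"
  and red_mult: "red m (f * g) = red m f * red m g"
  and red_diff: "red m (f - g) = red m f - red m g"
  and red_0 [simp]: "red m 0 = 0" and red_1 [simp]: "red m 1 = 1"
  and red_cx: "red m (cx c) = rho m c"
  by (simp_all add: red_def fun_eq_iff)

lemma red_sum: "red m (\<Sum>i\<in>I. f i) = (\<Sum>i\<in>I. red m (f i))"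
  by (simp add: red_def fun_eq_iff sum_fun_apply)

lemma red_smooth: "f \<in> smooth (coords m) \<Longrightarrow> red m f \<in> smooth (rc m)"
  unfolding red_def by (rule smooth_compose) (auto intro: rho_smooth)

lemma red_id:
  assumes "f \<in> smooth (rc m)"
  shows "red m f = f"
  unfolding red_def
proof
  fix y
  show "f (\<lambda>c. rho m c y) = f y"
    by (rule depends_onD[OF smooth_dep(3)[OF assms]])
       (use smooth_dep(2)[OF assms] rho_rc in auto)
qed

lemma rc_smooth_AB: "f \<in> smooth (rc m) \<Longrightarrow> f \<in> AB m"
  unfolding AB_eq_smooth using smooth_mono rc_coords by blast

lemma CE_eq: "CE m i = (\<Sum>\<mu>=1..m. cx (Uc \<mu> (addm i \<mu>)))"
  by (simp add: CE_def fun_eq_iff sum_fun_apply)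

lemma CE_AB: "i \<in> MI m \<Longrightarrow> CE m i \<in> AB m"
  unfolding CE_eq AB_eq_smooth by (intro smooth_sum smooth_cx) (auto intro: addm_MI)

lemma atLeast1_insert: "1 \<le> m \<Longrightarrow> {1..m} = insert 1 {2..m}" for m :: nat
  by auto

lemma addm_dn: "k \<mu> > 0 \<Longrightarrow> addm (k(\<mu> := k \<mu> - 1)) \<mu> = k"
  by (auto simp: addm_def)

lemma dn_addm: "(addm k \<mu>)(\<mu> := addm k \<mu> \<mu> - 1) = k"
  by (auto simp: addm_def)

lemma CE_dn:
  assumes "1 \<le> m" "k 1 > 0"
  shows "CE m (k(1 := k 1 - 1)) = cx (Uc 1 k) - rho m (Uc 1 k)"
  unfolding CE_eq atLeast1_insert[OF assms(1)]
  using assms(2) addm_dn[of k 1] by simp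

lemma red_CE:
  assumes "1 \<le> m"
  shows "red m (CE m i) = 0"
proof -
  have "rho m (Uc 1 (addm i 1)) = - (\<Sum>\<beta>=2..m. cx (Uc \<beta> (addm i \<beta>)))"
    using dn_addm[of i 1] by (simp add: addm_def)
  then show ?thesis
    unfolding CE_eq atLeast1_insert[OF assms] by (simp add: red_sum red_add red_cx)
qed

text \<open>If \<open>red m f = 0\<close>, Hadamard's formula writes \<open>f\<close> as a
  combination of the differences \<open>cx c - rho m c\<close>. These vanish for \<open>c\<close> in
  \<open>rc m\<close>, and for c = u^1_k with k^1 > 0 the difference is the generator with index k -
  (1).\<close>

lemma ICE_eq:
  assumes m: "1 \<le> m"
  shows "ICE m = {f \<in> AB m. red m f = 0}"
proof (intro set_eqI iffI)
  fix f assume "f \<in> ICE m"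
  then obtain K a where K: "finite K" "K \<subseteq> MI m" "\<forall>i\<in>K. a i \<in> AB m"
    and f: "f = (\<lambda>y. \<Sum>i\<in>K. a i y * CE m i y)"
    unfolding ICE_def by auto
  have f': "f = (\<Sum>i\<in>K. a i * CE m i)" unfolding f by (simp add: fun_eq_iff sum_fun_apply)
  have "f \<in> AB m"
    unfolding f' AB_eq_smooth
    by (intro smooth_sum smooth_mult) (use K CE_AB in \<open>auto simp: AB_eq_smooth\<close>)
  moreover have "red m f = 0" unfolding f' by (simp add: red_sum red_mult red_CE[OF m])
  ultimately show "f \<in> {f \<in> AB m. red m f = 0}" by simp
next
  fix f assume "f \<in> {f \<in> AB m. red m f = 0}"
  then have f: "f \<in> smooth (coords m)" and r0: "red m f = 0" by (auto simp: AB_eq_smooth)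
  have \<tau>: "rho m c \<in> smooth (coords m)" if "c \<in> coords m" for c
    using rho_smooth[OF that] rc_coords smooth_mono by blast
  \<comment> \<open>Indices of B start at 1, so the coordinate \<open>Xc 0\<close> of the type is
    free to carry the integration variable.\<close>
  have e: "Xc 0 \<notin> coords m" by simp
  have fin: "finite (dep f)" and sub: "dep f \<subseteq> coords m" using smooth_dep[OF f] by auto
  define a where "a c = hint (Xc 0) (rho m) (pd c f)" for c
  have a: "a c \<in> AB m" for c
    unfolding a_def AB_eq_smooth by (rule hint_smooth[OF smooth_pd[OF f] \<tau> e])
  define T where "T = {k. Uc 1 k \<in> dep f \<and> k 1 > 0}"
  define dn where "dn k = k(1 := k 1 - 1)" for k :: "nat \<Rightarrow> nat"
  have TM: "T \<subseteq> MI m" using sub unfolding T_def by auto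
  have dn_inv: "addm (dn k) 1 = k" if "k \<in> T" for k
    using that addm_dn[of k 1] unfolding dn_def T_def by simp
  then have inj: "inj_on dn T" by (rule inj_on_inverseI[where g="\<lambda>i. addm i 1"])
  have inj2: "inj_on (Uc 1) T" by (simp add: inj_on_def)
  have finT: "finite T"
    using finite_vimageI[OF fin, of "Uc 1"] unfolding T_def by (auto simp: inj_on_def vimage_def intro: finite_subset)
  have "f = f - red m f" by (simp add: r0)
  also have "\<dots> = (\<Sum>c\<in>dep f. (cx c - rho m c) * a c)"
    unfolding red_def a_def by (rule hadamard[OF f \<tau> e])
  also have "\<dots> = (\<Sum>c\<in>Uc 1 ` T. (cx c - rho m c) * a c)"
  proof (rule sum.mono_neutral_right[OF fin])
    show "\<forall>c\<in>dep f - Uc 1 ` T. (cx c - rho m c) * a c = 0"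
    proof
      fix c assume c: "c \<in> dep f - Uc 1 ` T"
      then have "c \<in> rc m" using sub unfolding rc_def T_def by auto
      then show "(cx c - rho m c) * a c = 0" by (simp add: rho_rc)
    qed
  qed (auto simp: T_def)
  also have "\<dots> = (\<Sum>k\<in>T. CE m (dn k) * a (Uc 1 k))"
    unfolding sum.reindex[OF inj2] comp_def
    by (rule sum.cong[OF refl]) (simp only: T_def dn_def CE_dn[OF m] mem_Collect_eq)
  also have "\<dots> = (\<Sum>i\<in>dn ` T. a (Uc 1 (addm i 1)) * CE m i)"
    unfolding sum.reindex[OF inj] comp_def
    by (rule sum.cong[OF refl]) (simp only: dn_inv mult.commute)
  finally have "f = (\<lambda>y. \<Sum>i\<in>dn ` T. a (Uc 1 (addm i 1)) y * CE m i y)"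
    by (simp add: fun_eq_iff sum_fun_apply)
  moreover have "dn ` T \<subseteq> MI m" using TM m unfolding dn_def by (auto intro!: MI_upd)
  ultimately show "f \<in> ICE m"
    unfolding ICE_def using finT a by (auto intro!: exI[of _ "dn ` T"] exI[of _ "\<lambda>i. a (Uc 1 (addm i 1))"])
qed

text \<open>The derivation induced on the quotient by the ideal, as a vector field in the
  coordinates \<open>rc m\<close>; \<open>red_TD\<close> justifies this reading.\<close>

definition Dr :: "nat \<Rightarrow> nat \<Rightarrow> fnB \<Rightarrow> fnB" where
  "Dr m \<mu> f = vf (\<lambda>c. red m (tdb \<mu> c)) f"

lemma TD_CE: "TD \<mu> (CE m i) = CE m (addm i \<mu>)" if "i \<in> MI m"
proof -
  have s: "CE m i \<in> smooth (coords m)" using CE_AB[OF that] by (simp add: AB_eq_smooth)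
  have "vf (tdb \<mu>) (CE m i) = (\<Sum>\<nu>=1..m. vf (tdb \<mu>) (cx (Uc \<nu> (addm i \<nu>))))"
    unfolding CE_eq by (rule vf_sum[of _ _ "coords m"]) (use that in \<open>auto intro!: smooth_cx addm_MI\<close>)
  then show ?thesis
    unfolding TD_eq_vf[OF s] by (simp add: CE_eq[of m "addm i \<mu>"] addm_commute del: cx_apply)
qed

text \<open>By the Leibniz rule and \<open>TD_CE\<close>, a combination of generators goes to
  another one: a total derivative only raises the index of a generator.\<close>

lemma TD_ICE:
  assumes m: "1 \<le> m" and f: "f \<in> ICE m" and \<mu>: "\<mu> \<in> {1..m}"
  shows "TD \<mu> f \<in> ICE m"
proof -
  have fAB: "f \<in> AB m" using f ICE_eq[OF m] by auto
  obtain K a where K: "finite K" "K \<subseteq> MI m" "\<forall>i\<in>K. a i \<in> AB m"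
    and f: "f = (\<lambda>y. \<Sum>i\<in>K. a i y * CE m i y)"
    using f unfolding ICE_def by auto
  have f': "f = (\<Sum>i\<in>K. a i * CE m i)" unfolding f by (simp add: fun_eq_iff sum_fun_apply)
  have s: "a i \<in> smooth (coords m)" "CE m i \<in> smooth (coords m)" if "i \<in> K" for i
    using K CE_AB that by (auto simp: AB_eq_smooth)
  have "TD \<mu> f = vf (tdb \<mu>) f" using fAB by (intro TD_eq_vf[of _ "coords m"]) (simp add: AB_eq_smooth)
  also have "\<dots> = (\<Sum>i\<in>K. vf (tdb \<mu>) (a i * CE m i))"
    unfolding f' by (rule vf_sum[of _ _ "coords m"]) (use s in auto)
  also have "\<dots> = (\<Sum>i\<in>K. vf (tdb \<mu>) (a i) * CE m i + a i * CE m (addm i \<mu>))"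
  proof (rule sum.cong[OF refl])
    fix i assume i: "i \<in> K"
    then have "vf (tdb \<mu>) (CE m i) = CE m (addm i \<mu>)"
      using TD_CE[of i m \<mu>] K(2) TD_eq_vf[OF s(2)[OF i]] by auto
    then show "vf (tdb \<mu>) (a i * CE m i) = vf (tdb \<mu>) (a i) * CE m i + a i * CE m (addm i \<mu>)"
      using vf_mult[OF s[OF i]] by simp
  qed
  finally have "red m (TD \<mu> f) = 0"
    by (simp add: red_sum red_add red_mult red_CE[OF m])
  then show ?thesis using TD_AB[OF fAB \<mu>] ICE_eq[OF m] by simp
qed

text \<open>\<open>f - red m f\<close> lies in the ideal, which \<open>TD \<mu>\<close> preserves,
  so \<open>f\<close> may be replaced by \<open>red m f\<close>. The partial derivatives of the
  latter are fixed by \<open>red\<close>, which then affects only the components of the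
  field.\<close>

lemma red_TD:
  assumes m: "1 \<le> m" and f: "f \<in> AB m" and \<mu>: "\<mu> \<in> {1..m}"
  shows "red m (TD \<mu> f) = Dr m \<mu> (red m f)"
proof -
  have fs: "f \<in> smooth (coords m)" using f by (simp add: AB_eq_smooth)
  have r: "red m f \<in> smooth (rc m)" by (rule red_smooth[OF fs])
  have rs: "red m f \<in> smooth (coords m)" using rc_smooth_AB[OF r] by (simp add: AB_eq_smooth)
  have ds: "f - red m f \<in> smooth (coords m)" using fs rs by (rule smooth_diff)
  have "f - red m f \<in> ICE m"
    unfolding ICE_eq[OF m] using ds red_id[OF r] by (simp add: AB_eq_smooth red_diff)
  from TD_ICE[OF m this \<mu>] have "red m (vf (tdb \<mu>) (f - red m f)) = 0"
    unfolding ICE_eq[OF m] TD_eq_vf[OF ds] by simp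
  then have "red m (vf (tdb \<mu>) f) = red m (vf (tdb \<mu>) (red m f))"
    by (simp add: vf_diff[OF fs rs] red_diff)
  also have "\<dots> = Dr m \<mu> (red m f)"
    unfolding Dr_def vf_def
    by (simp add: red_sum red_mult red_id[OF smooth_pd[OF r]])
  finally show ?thesis unfolding TD_eq_vf[OF fs] .
qed

lemma Dr_smooth:
  assumes "1 \<le> m" "\<mu> \<in> {1..m}" "f \<in> smooth (rc m)"
  shows "Dr m \<mu> f \<in> smooth (rc m)"
proof -
  have "f \<in> AB m" by (rule rc_smooth_AB[OF assms(3)])
  from red_smooth[OF TD_AB[OF this assms(2), unfolded AB_eq_smooth]]
  show ?thesis using red_TD[OF assms(1) \<open>f \<in> AB m\<close> assms(2)] red_id[OF assms(3)] by simp
qed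

lemma Dr_commute:
  assumes "1 \<le> m" "\<mu> \<in> {1..m}" "\<nu> \<in> {1..m}" "f \<in> smooth (rc m)"
  shows "Dr m \<mu> (Dr m \<nu> f) = Dr m \<nu> (Dr m \<mu> f)"
proof -
  have f: "f \<in> AB m" by (rule rc_smooth_AB[OF assms(4)])
  have "red m (TD \<mu> (TD \<nu> f)) = red m (TD \<nu> (TD \<mu> f))"
    by (simp only: TD_commute[OF f assms(2,3)])
  then show ?thesis
    by (simp only: red_TD[OF assms(1) TD_AB[OF f assms(3)] assms(2)]
        red_TD[OF assms(1) TD_AB[OF f assms(2)] assms(3)]
        red_TD[OF assms(1) f assms(2)] red_TD[OF assms(1) f assms(3)] red_id[OF assms(4)])
qed

lemma Dr_add: "f \<in> smooth (rc m) \<Longrightarrow> g \<in> smooth (rc m) \<Longrightarrow> Dr m \<mu> (f + g) = Dr m \<mu> f + Dr m \<mu> g"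
  and Dr_mult: "f \<in> smooth (rc m) \<Longrightarrow> g \<in> smooth (rc m) \<Longrightarrow> Dr m \<mu> (f * g) = Dr m \<mu> f * g + f * Dr m \<mu> g"
  and Dr_uminus: "f \<in> smooth (rc m) \<Longrightarrow> Dr m \<mu> (- f) = - Dr m \<mu> f"
  and Dr_diff: "f \<in> smooth (rc m) \<Longrightarrow> g \<in> smooth (rc m) \<Longrightarrow> Dr m \<mu> (f - g) = Dr m \<mu> f - Dr m \<mu> g"
  and Dr_0 [simp]: "Dr m \<mu> 0 = 0"
  and Dr_const [simp]: "Dr m \<mu> (\<lambda>y. a) = 0"
  and Dr_cx: "Dr m \<mu> (cx c) = red m (tdb \<mu> c)"
  unfolding Dr_def by (simp_all add: vf_add vf_mult vf_uminus vf_diff)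

lemma Dr_sum: "(\<And>i. i \<in> I \<Longrightarrow> f i \<in> smooth (rc m)) \<Longrightarrow> Dr m \<mu> (\<Sum>i\<in>I. f i) = (\<Sum>i\<in>I. Dr m \<mu> (f i))"
  unfolding Dr_def by (rule vf_sum)

section \<open>Jet coordinates\<close>

text \<open>Identities between functions are proved in the ring of functions: pointwise expansion would
  destroy their ring structure under binders.\<close>
declare plus_fun_apply [simp del] zero_fun_apply [simp del] times_fun_apply [simp del]
  one_fun_apply [simp del] minus_apply [simp del] uminus_apply [simp del] cx_apply [simp del]

primrec jet :: "coord \<Rightarrow> bool" where
  "jet (Xc \<mu>) = False" | "jet (Uc l i) = True" | "jet (Pc i) = True"

primrec cnt :: "nat \<Rightarrow> coord \<Rightarrow> nat" where
  "cnt \<alpha> (Xc \<mu>) = 0" | "cnt \<alpha> (Uc l i) = i \<alpha>" | "cnt \<alpha> (Pc i) = i \<alpha>"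

primrec dn :: "nat \<Rightarrow> coord \<Rightarrow> coord" where
  "dn \<alpha> (Xc \<mu>) = Xc \<mu>"
| "dn \<alpha> (Uc l i) = Uc l (i(\<alpha> := i \<alpha> - 1))"
| "dn \<alpha> (Pc i) = Pc (i(\<alpha> := i \<alpha> - 1))"

primrec zr :: "nat \<Rightarrow> coord \<Rightarrow> coord" where
  "zr \<alpha> (Xc \<mu>) = Xc \<mu>"
| "zr \<alpha> (Uc l i) = Uc l (i(\<alpha> := 0))"
| "zr \<alpha> (Pc i) = Pc (i(\<alpha> := 0))"

lemma up_0 [simp]: "up \<alpha> 0 c = c"
  by (cases c) auto

lemma up_up: "up \<alpha> n (up \<alpha> k c) = up \<alpha> (k + n) c"
  by (cases c) (auto simp: add.assoc)

lemma jet_up [simp]: "jet (up \<alpha> n c) = jet c" and jet_dn [simp]: "jet (dn \<alpha> c) = jet c"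
  by (cases c; simp)+

lemma cnt_up [simp]: "jet c \<Longrightarrow> cnt \<alpha> (up \<alpha> n c) = cnt \<alpha> c + n"
  by (cases c) auto

lemma cnt_up_other [simp]: "\<alpha> \<noteq> \<beta> \<Longrightarrow> cnt \<beta> (up \<alpha> n c) = cnt \<beta> c"
  by (cases c) auto

lemma dn_up [simp]: "dn \<alpha> (up \<alpha> (Suc n) c) = up \<alpha> n c"
  by (cases c) auto

lemma dn_up_other: "\<alpha> \<noteq> \<beta> \<Longrightarrow> dn \<beta> (up \<alpha> n c) = up \<alpha> n (dn \<beta> c)"
  by (cases c) (auto simp: fun_upd_twist)

lemma up_Suc_iff: "jet c \<Longrightarrow> c = up \<alpha> 1 d \<longleftrightarrow> cnt \<alpha> c > 0 \<and> d = dn \<alpha> c"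
  by (cases c; cases d) (auto simp: fun_eq_iff)

text \<open>The commutator term of a free jet derivative: commuting \<open>pd c\<close> past
  \<open>D \<alpha>\<close> produces the derivative by the coordinate one step below
  \<open>c\<close> in direction \<open>\<alpha>\<close>, if there is one.\<close>

definition low :: "nat \<Rightarrow> (coord \<Rightarrow> fnB) \<Rightarrow> coord \<Rightarrow> fnB" where
  "low \<alpha> k c = (if cnt \<alpha> c > 0 then k (dn \<alpha> c) else 0)"

text \<open>Since D_1 u^1_i is minus the sum of the u^beta_{i+(beta)}, the commutator with D_1 at
  u^beta_j also receives the derivative by u^1_{j-(beta)}. It is expressed as
  \<open>low \<beta>\<close> of a family transferred from u^1 to u^beta.\<close>

primrec relab :: "nat \<Rightarrow> (coord \<Rightarrow> fnB) \<Rightarrow> coord \<Rightarrow> fnB" where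
  "relab \<beta> k (Xc \<mu>) = 0"
| "relab \<beta> k (Uc l i) = (if l = \<beta> then k (Uc 1 i) else 0)"
| "relab \<beta> k (Pc i) = 0"

lemma tdb_jet: "jet c \<Longrightarrow> tdb \<alpha> c = cx (up \<alpha> 1 c)"
  by (cases c) (auto simp: addm_def)

locale cont_eq =
  fixes m :: nat
  assumes m2: "2 \<le> m"
begin

abbreviation A :: "fnB set" where "A \<equiv> smooth (rc m)"
abbreviation D :: "nat \<Rightarrow> fnB \<Rightarrow> fnB" where "D \<equiv> Dr m"

lemma m1: "1 \<le> m" using m2 by simp

lemma D_smooth: "\<mu> \<in> {1..m} \<Longrightarrow> f \<in> A \<Longrightarrow> D \<mu> f \<in> A"
  by (rule Dr_smooth[OF m1])

lemma D_commute: "\<mu> \<in> {1..m} \<Longrightarrow> \<nu> \<in> {1..m} \<Longrightarrow> f \<in> A \<Longrightarrow> D \<mu> (D \<nu> f) = D \<nu> (D \<mu> f)"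
  by (rule Dr_commute[OF m1])

definition RJ :: "coord set" where "RJ = {c \<in> rc m. jet c}"

text \<open>The excluded case is u^1 raised in direction 1, which is an eliminated
  coordinate.\<close>

lemma RJ_up:
  assumes "c \<in> RJ" "\<alpha> \<in> {1..m}" "\<alpha> = 1 \<Longrightarrow> \<forall>i. c \<noteq> Uc 1 i"
  shows "up \<alpha> n c \<in> RJ"
  using assms by (cases c) (auto simp: RJ_def intro!: MI_upd)

lemma RJ_up2: "c \<in> RJ \<Longrightarrow> \<alpha> \<in> {2..m} \<Longrightarrow> up \<alpha> n c \<in> RJ"
  by (rule RJ_up) auto

lemma RJ_jet: "c \<in> RJ \<Longrightarrow> jet c" and RJ_rc: "c \<in> RJ \<Longrightarrow> c \<in> rc m"
  by (auto simp: RJ_def)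

lemma cx_RJ: "c \<in> RJ \<Longrightarrow> cx c \<in> A"
  by (auto simp: RJ_def)

lemma red_tdb: "c \<in> rc m \<Longrightarrow> \<alpha> \<in> {2..m} \<Longrightarrow> red m (tdb \<alpha> c) = tdb \<alpha> c"
  by (cases c) (auto simp: red_cx addm_def)

lemma D_cx: "c \<in> RJ \<Longrightarrow> \<alpha> \<in> {2..m} \<Longrightarrow> D \<alpha> (cx c) = cx (up \<alpha> 1 c)"
  using red_tdb[OF RJ_rc] tdb_jet[OF RJ_jet] by (simp only: Dr_cx)

lemma tdb_red_smooth: "c \<in> rc m \<Longrightarrow> \<mu> \<in> {1..m} \<Longrightarrow> red m (tdb \<mu> c) \<in> A"
  using tdb_smooth rc_coords red_smooth by blast

lemma pd_D:
  assumes f: "f \<in> A" and \<alpha>: "\<alpha> \<in> {2..m}" and c: "jet c"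
  shows "pd c (D \<alpha> f) = D \<alpha> (pd c f) + low \<alpha> (\<lambda>d. pd d f) c"
proof -
  have fin: "finite (dep f)" and sub: "dep f \<subseteq> rc m" using smooth_dep[OF f] by auto
  have \<alpha>1: "\<alpha> \<in> {1..m}" using \<alpha> by auto
  have "pd c (red m (tdb \<alpha> d)) * pd d f = (if d = dn \<alpha> c then low \<alpha> (\<lambda>d. pd d f) c else 0)"
    if "d \<in> dep f" for d
  proof (cases "jet d")
    case True
    have "red m (tdb \<alpha> d) = cx (up \<alpha> 1 d)"
      using red_tdb[OF subsetD[OF sub that] \<alpha>] by (simp only: tdb_jet[OF True])
    then show ?thesis
      using up_Suc_iff[OF c, of \<alpha> d] by (auto simp: pd_cx low_def)
  next
    case False
    then obtain \<nu> where "d = Xc \<nu>" by (cases d) auto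
    then show ?thesis using c by (cases c) auto
  qed
  then have "(\<Sum>d\<in>dep f. pd c (red m (tdb \<alpha> d)) * pd d f) = (\<Sum>d\<in>dep f. if d = dn \<alpha> c then low \<alpha> (\<lambda>d. pd d f) c else 0)"
    by (rule sum.cong[OF refl])
  also have "\<dots> = low \<alpha> (\<lambda>d. pd d f) c"
    using fin pd_notin_dep[of "dn \<alpha> c" f] by (simp add: low_def)
  finally show ?thesis
    unfolding Dr_def using pd_vf[OF f tdb_red_smooth[OF _ \<alpha>1]] by simp
qed

text \<open>The component of D_1 at \<open>d\<close> depends on \<open>c\<close> in two ways: either
  \<open>c\<close> is \<open>d\<close> raised in direction 1, or d = u^1_i and \<open>c\<close> is
  one of the u^beta_{i+(beta)} that replace u^1_{i+(1)}.\<close>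

lemma pd_D1:
  assumes f: "f \<in> A" and c: "c \<in> RJ"
  shows "pd c (D 1 f) = D 1 (pd c f) + low 1 (\<lambda>d. pd d f) c
           - (\<Sum>\<beta>=2..m. low \<beta> (relab \<beta> (\<lambda>d. pd d f)) c)"
proof -
  have fin: "finite (dep f)" and sub: "dep f \<subseteq> rc m" using smooth_dep[OF f] by auto
  have 11: "1 \<in> {1..m}" using m1 by auto
  have cj: "jet c" by (rule RJ_jet[OF c])
  \<comment> \<open>Marks \<open>c\<close> as the summand of index \<open>\<beta>\<close> in the
    replacement of the raised \<open>d\<close>.\<close>
  define w where "w \<beta> d = (\<exists>i. d = Uc 1 i \<and> c = Uc \<beta> (addm i \<beta>))" for \<beta> d
  have eq: "pd c (red m (tdb 1 d)) = (if c = up 1 1 d then 1 else 0) - (\<Sum>\<beta>=2..m. if w \<beta> d then 1 else 0)"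
    if "d \<in> dep f" for d
  proof (cases "\<exists>i. d = Uc 1 i")
    case True
    then obtain i where d: "d = Uc 1 i" by blast
    with that sub have i: "i \<in> MI m" "i 1 = 0" by auto
    have "c \<noteq> up 1 1 d" using c d by (auto simp: RJ_def)
    moreover have "red m (tdb 1 d) = - (\<Sum>\<beta>=2..m. cx (Uc \<beta> (addm i \<beta>)))"
      unfolding d using dn_addm[of i 1] by (simp add: red_cx addm_def del: fun_upd_apply) (simp add: addm_def)
    moreover have "cx (Uc \<beta> (addm i \<beta>)) \<in> A" if "\<beta> \<in> {2..m}" for \<beta>
      using that i by (intro smooth_cx) (use addm_MI[of i m \<beta>] in \<open>auto simp: addm_def\<close>)
    ultimately have "pd c (red m (tdb 1 d)) = - (\<Sum>\<beta>=2..m. pd c (cx (Uc \<beta> (addm i \<beta>))))"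
      by (subst smooth_pd_sum[of _ _ "rc m", symmetric]) (auto intro!: smooth_pd_uminus smooth_sum)
    also have "\<dots> = - (\<Sum>\<beta>=2..m. if w \<beta> d then 1 else 0)"
      by (simp add: pd_cx w_def d del: cx_apply)
    finally show ?thesis using \<open>c \<noteq> up 1 1 d\<close> by simp
  next
    case False
    then have w: "\<not> w \<beta> d" for \<beta> by (auto simp: w_def)
    show ?thesis
    proof (cases "jet d")
      case True
      have "up 1 1 d \<in> rc m"
        using RJ_up[of d 1 1] that sub True False 11 by (auto simp: RJ_def)
      then have "red m (tdb 1 d) = cx (up 1 1 d)"
        by (simp only: tdb_jet[OF True] red_cx rho_rc)
      then show ?thesis using w by (simp add: pd_cx)
    next
      case False
      then obtain \<nu> where d: "d = Xc \<nu>" by (cases d) auto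
      then show ?thesis using w cj by (cases c) auto
    qed
  qed
  have s1: "(\<Sum>d\<in>dep f. (if c = up 1 1 d then 1 else 0) * pd d f) = low 1 (\<lambda>d. pd d f) c"
  proof -
    have "(if c = up 1 1 d then 1 else 0) * pd d f = (if d = dn 1 c then low 1 (\<lambda>d. pd d f) c else 0)" for d
      using up_Suc_iff[OF cj, of 1 d] by (auto simp: low_def)
    then show ?thesis using fin pd_notin_dep[of "dn 1 c" f] by (simp add: low_def)
  qed
  have s2: "(\<Sum>d\<in>dep f. (if w \<beta> d then 1 else 0) * pd d f) = low \<beta> (relab \<beta> (\<lambda>d. pd d f)) c" for \<beta>
  proof (cases "\<exists>j. c = Uc \<beta> j \<and> j \<beta> > 0")
    case True
    then obtain j where j: "c = Uc \<beta> j" "j \<beta> > 0" by blast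
    have "w \<beta> d \<longleftrightarrow> d = Uc 1 (j(\<beta> := j \<beta> - 1))" for d
      unfolding w_def j using addm_dn[of j \<beta>, OF j(2)] dn_addm[of _ \<beta>] by auto
    then have "(if w \<beta> d then 1 else 0) * pd d f = (if d = Uc 1 (j(\<beta> := j \<beta> - 1)) then pd (Uc 1 (j(\<beta> := j \<beta> - 1))) f else 0)" for d
      by auto
    then have "(\<Sum>d\<in>dep f. (if w \<beta> d then 1 else 0) * pd d f) = pd (Uc 1 (j(\<beta> := j \<beta> - 1))) f"
      using fin pd_notin_dep[of "Uc 1 (j(\<beta> := j \<beta> - 1))" f] by simp
    then show ?thesis using j by (simp add: low_def)
  next
    case False
    then have "\<not> w \<beta> d" for d by (auto simp: w_def addm_def)
    moreover have "low \<beta> (relab \<beta> (\<lambda>d. pd d f)) c = 0"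
      using False by (cases c) (auto simp: low_def)
    ultimately show ?thesis by simp
  qed
  have "(\<Sum>d\<in>dep f. pd c (red m (tdb 1 d)) * pd d f) =
      (\<Sum>d\<in>dep f. (if c = up 1 1 d then 1 else 0) * pd d f - (\<Sum>\<beta>=2..m. (if w \<beta> d then 1 else 0) * pd d f))"
    by (rule sum.cong[OF refl]) (simp only: eq left_diff_distrib sum_distrib_right)
  also have "\<dots> = low 1 (\<lambda>d. pd d f) c - (\<Sum>\<beta>=2..m. low \<beta> (relab \<beta> (\<lambda>d. pd d f)) c)"
    by (simp only: sum_subtractf s1 sum.swap[of _ "{2..m}"] s2)
  finally show ?thesis
    unfolding Dr_def using pd_vf[OF f tdb_red_smooth[OF _ 11]] by (simp add: algebra_simps)
qed

section \<open>Partial Euler operators\<close>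

definition nD :: "nat \<Rightarrow> fnB \<Rightarrow> fnB" where "nD \<alpha> f = - D \<alpha> f"

text \<open>Let \<open>c\<close> be a coordinate with \<open>cnt \<beta> c = 0\<close> for all \<open>\<beta>\<close> in the list \<open>\<alpha>s\<close>, and let \<open>N\<close> exceed the order of
  \<open>f\<close>. Then \<open>LL N \<alpha>s (\<lambda>c. pd c f) c\<close> is the Euler derivative of \<open>f\<close> by \<open>c\<close> with respect to the
  independent variables in \<open>\<alpha>s\<close>.\<close>
definition Ls :: "nat \<Rightarrow> nat \<Rightarrow> (coord \<Rightarrow> fnB) \<Rightarrow> coord \<Rightarrow> fnB" where
  "Ls N \<alpha> h c = (\<Sum>n<N. (nD \<alpha> ^^ n) (h (up \<alpha> n c)))"

primrec LL :: "nat \<Rightarrow> nat list \<Rightarrow> (coord \<Rightarrow> fnB) \<Rightarrow> coord \<Rightarrow> fnB" where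
  "LL N [] h = h"
| "LL N (\<alpha> # \<alpha>s) h = Ls N \<alpha> (LL N \<alpha>s h)"

lemma nD_pow_smooth: "\<alpha> \<in> {1..m} \<Longrightarrow> f \<in> A \<Longrightarrow> (nD \<alpha> ^^ n) f \<in> A"
  by (induction n) (auto simp: nD_def intro!: D_smooth smooth_uminus)

lemma nD_pow_0 [simp]: "(nD \<alpha> ^^ n) 0 = 0"
  by (induction n) (auto simp: nD_def)

lemma nD_pow_add:
  "\<alpha> \<in> {1..m} \<Longrightarrow> f \<in> A \<Longrightarrow> g \<in> A \<Longrightarrow> (nD \<alpha> ^^ n) (f + g) = (nD \<alpha> ^^ n) f + (nD \<alpha> ^^ n) g"
proof (induction n)
  case (Suc n)
  then have "(nD \<alpha> ^^ Suc n) (f + g) = - D \<alpha> ((nD \<alpha> ^^ n) f + (nD \<alpha> ^^ n) g)"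
    by (simp add: nD_def[of \<alpha> "(nD \<alpha> ^^ n) f + _"])
  also have "\<dots> = (nD \<alpha> ^^ Suc n) f + (nD \<alpha> ^^ Suc n) g"
    using Suc.prems nD_pow_smooth by (simp add: Dr_add nD_def[of \<alpha> "(nD \<alpha> ^^ n) _"])
  finally show ?case .
qed simp

lemma nD_pow_uminus: "\<alpha> \<in> {1..m} \<Longrightarrow> f \<in> A \<Longrightarrow> (nD \<alpha> ^^ n) (- f) = - (nD \<alpha> ^^ n) f"
proof -
  assume *: "\<alpha> \<in> {1..m}" "f \<in> A"
  then have "(nD \<alpha> ^^ n) (- f) + (nD \<alpha> ^^ n) f = 0"
    using nD_pow_add[of \<alpha> "- f" f n] by (simp add: smooth_uminus)
  then show ?thesis by (simp add: eq_neg_iff_add_eq_0)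
qed

lemma nD_pow_D:
  assumes "\<alpha> \<in> {1..m}" "\<mu> \<in> {1..m}" "f \<in> A"
  shows "(nD \<alpha> ^^ n) (D \<mu> f) = D \<mu> ((nD \<alpha> ^^ n) f)"
proof (induction n)
  case (Suc n)
  have g: "(nD \<alpha> ^^ n) f \<in> A" by (rule nD_pow_smooth[OF assms(1,3)])
  have "(nD \<alpha> ^^ Suc n) (D \<mu> f) = nD \<alpha> (D \<mu> ((nD \<alpha> ^^ n) f))" by (simp add: Suc)
  also have "\<dots> = D \<mu> (nD \<alpha> ((nD \<alpha> ^^ n) f))"
    unfolding nD_def[of \<alpha> "D \<mu> ((nD \<alpha> ^^ n) f)"] nD_def[of \<alpha> "(nD \<alpha> ^^ n) f"]
    using assms g by (simp only: D_commute[of \<alpha> \<mu>] Dr_uminus D_smooth)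
  finally show ?case by simp
qed simp

lemma Ls_smooth: "\<alpha> \<in> {1..m} \<Longrightarrow> (\<And>c. h c \<in> A) \<Longrightarrow> Ls N \<alpha> h c \<in> A"
  unfolding Ls_def by (intro smooth_sum nD_pow_smooth)

lemma LL_smooth: "set \<alpha>s \<subseteq> {1..m} \<Longrightarrow> (\<And>c. h c \<in> A) \<Longrightarrow> LL N \<alpha>s h c \<in> A"
  by (induction \<alpha>s arbitrary: c) (auto intro!: Ls_smooth)

lemma Ls_D:
  assumes "\<alpha> \<in> {1..m}" "\<mu> \<in> {1..m}" "\<And>c. h c \<in> A"
  shows "Ls N \<alpha> (\<lambda>c. D \<mu> (h c)) c = D \<mu> (Ls N \<alpha> h c)"
  unfolding Ls_def using assms
  by (simp add: nD_pow_D) (rule Dr_sum[symmetric], simp add: nD_pow_smooth)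

lemma LL_D:
  assumes "set \<alpha>s \<subseteq> {1..m}" "\<mu> \<in> {1..m}" "\<And>c. h c \<in> A"
  shows "LL N \<alpha>s (\<lambda>c. D \<mu> (h c)) = (\<lambda>c. D \<mu> (LL N \<alpha>s h c))"
  using assms(1)
proof (induction \<alpha>s)
  case (Cons \<alpha> \<alpha>s)
  then show ?case
    using Ls_D[of \<alpha> \<mu> "LL N \<alpha>s h" N] assms LL_smooth[of \<alpha>s h N] by auto
qed simp

lemma LL_add:
  assumes "set \<alpha>s \<subseteq> {1..m}" "\<And>c. h c \<in> A" "\<And>c. k c \<in> A"
  shows "LL N \<alpha>s (\<lambda>c. h c + k c) = (\<lambda>c. LL N \<alpha>s h c + LL N \<alpha>s k c)"
  using assms(1)
proof (induction \<alpha>s)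
  case (Cons \<alpha> \<alpha>s)
  then show ?case
    using assms LL_smooth[of \<alpha>s h N] LL_smooth[of \<alpha>s k N]
    by (simp add: Ls_def nD_pow_add sum.distrib)
qed simp

lemma LL_uminus:
  assumes "set \<alpha>s \<subseteq> {1..m}" "\<And>c. h c \<in> A"
  shows "LL N \<alpha>s (\<lambda>c. - h c) = (\<lambda>c. - LL N \<alpha>s h c)"
  using assms(1)
proof (induction \<alpha>s)
  case (Cons \<alpha> \<alpha>s)
  then show ?case
    using assms LL_smooth[of \<alpha>s h N] by (simp add: Ls_def nD_pow_uminus sum_negf)
qed simp

lemma LL_0: "LL N \<alpha>s (\<lambda>c. 0) = (\<lambda>c. 0)"
  by (induction \<alpha>s) (auto simp: Ls_def)

lemma LL_sum:
  assumes "set \<alpha>s \<subseteq> {1..m}" "\<And>i c. i \<in> I \<Longrightarrow> h i c \<in> A"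
  shows "LL N \<alpha>s (\<lambda>c. \<Sum>i\<in>I. h i c) = (\<lambda>c. \<Sum>i\<in>I. LL N \<alpha>s (h i) c)"
  using assms(2)
proof (induction I rule: infinite_finite_induct)
  case (insert i I)
  have "LL N \<alpha>s (\<lambda>c. h i c + (\<Sum>i\<in>I. h i c)) = (\<lambda>c. LL N \<alpha>s (h i) c + LL N \<alpha>s (\<lambda>c. \<Sum>i\<in>I. h i c) c)"
    using insert.prems by (intro LL_add[OF assms(1)] smooth_sum) auto
  also have "LL N \<alpha>s (\<lambda>c. \<Sum>i\<in>I. h i c) = (\<lambda>c. \<Sum>i\<in>I. LL N \<alpha>s (h i) c)"
    using insert by blast
  finally show ?case by (simp only: sum.insert[OF insert.hyps])
qed (simp_all only: sum.infinite sum.empty LL_0 not_False_eq_True)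

lemma low_smooth: "(\<And>c. h c \<in> A) \<Longrightarrow> low \<beta> h c \<in> A"
  by (simp add: low_def)

lemma relab_smooth: "(\<And>c. h c \<in> A) \<Longrightarrow> relab \<beta> h c \<in> A"
  by (cases c) auto

lemma LL_low:
  assumes "\<beta> \<notin> set \<alpha>s"
  shows "LL N \<alpha>s (low \<beta> h) = low \<beta> (LL N \<alpha>s h)"
  using assms
proof (induction \<alpha>s)
  case (Cons \<alpha> \<alpha>s)
  have "Ls N \<alpha> (low \<beta> k) c = low \<beta> (Ls N \<alpha> k) c" for k c
    using Cons.prems unfolding Ls_def low_def by (auto simp: dn_up_other)
  then show ?case using Cons by auto
qed simp

lemma LL_relab: "LL N \<alpha>s (relab \<beta> h) = relab \<beta> (LL N \<alpha>s h)"
proof (induction \<alpha>s)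
  case (Cons \<alpha> \<alpha>s)
  have "Ls N \<alpha> (relab \<beta> k) c = relab \<beta> (Ls N \<alpha> k) c" for k c
    unfolding Ls_def by (cases c) auto
  then show ?case using Cons by auto
qed simp

text \<open>\<open>LL\<close> samples its family only at coordinates raised in directions from
  \<open>\<alpha>s\<close>, and for directions at least 2 these stay in \<open>RJ\<close>. The
  commutator formula for \<open>D 1\<close> is available only there.\<close>

lemma LL_cong:
  assumes "set \<alpha>s \<subseteq> {2..m}" "\<And>c. c \<in> RJ \<Longrightarrow> h c = k c" "c \<in> RJ"
  shows "LL N \<alpha>s h c = LL N \<alpha>s k c"
  using assms(1,3)
proof (induction \<alpha>s arbitrary: c)
  case (Cons \<alpha> \<alpha>s)
  then show ?case by (auto simp: Ls_def RJ_up2)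
qed (use assms in simp)

lemma LL_vanish:
  assumes "\<And>c. jet c \<Longrightarrow> cnt \<alpha> c \<ge> B \<Longrightarrow> h c = 0" "\<alpha> \<notin> set \<alpha>s" "jet c" "cnt \<alpha> c \<ge> B"
  shows "LL N \<alpha>s h c = 0"
  using assms(2-)
proof (induction \<alpha>s arbitrary: c)
  case (Cons \<beta> \<alpha>s)
  then show ?case by (auto simp: Ls_def)
qed (use assms(1) in simp)

text \<open>The Euler operator in one variable annihilates total derivatives because the sum
  telescopes: the lowered term at order n cancels the derivative term at order n - 1.\<close>

lemma Ls_kill:
  assumes \<alpha>: "\<alpha> \<in> {1..m}" and h: "\<And>c. h c \<in> A" and c: "jet c" "cnt \<alpha> c = 0"
    and bd: "\<And>c. jet c \<Longrightarrow> cnt \<alpha> c \<ge> N - 1 \<Longrightarrow> h c = 0"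
  shows "Ls N \<alpha> (\<lambda>c. D \<alpha> (h c) + low \<alpha> h c) c = 0"
proof -
  \<comment> \<open>\<open>F 0 = 0\<close> because \<open>cnt \<alpha> c = 0\<close> leaves no lower
    coordinate. For positive \<open>N\<close>, \<open>F N\<close> contains \<open>h\<close> at order
    \<open>N - 1\<close>, which is why the bound must hold from \<open>N - 1\<close> on.\<close>
  define F where "F n = (nD \<alpha> ^^ n) (if n = 0 then 0 else h (up \<alpha> (n - 1) c))" for n
  have "(nD \<alpha> ^^ n) (D \<alpha> (h (up \<alpha> n c)) + low \<alpha> h (up \<alpha> n c)) = F n - F (Suc n)" for n
  proof -
    have "low \<alpha> h (up \<alpha> n c) = (if n = 0 then 0 else h (up \<alpha> (n - 1) c))"
      using c by (cases n) (auto simp: low_def)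
    then have "(nD \<alpha> ^^ n) (D \<alpha> (h (up \<alpha> n c)) + low \<alpha> h (up \<alpha> n c)) = (nD \<alpha> ^^ n) (D \<alpha> (h (up \<alpha> n c))) + F n"
      unfolding F_def by (subst nD_pow_add) (use \<alpha> h in \<open>auto intro: D_smooth\<close>)
    also have "(nD \<alpha> ^^ n) (D \<alpha> (h (up \<alpha> n c))) = - F (Suc n)"
      unfolding F_def using nD_pow_D[OF \<alpha> \<alpha> h] by (simp add: nD_def[of \<alpha> "(nD \<alpha> ^^ n) _"])
    finally show ?thesis by simp
  qed
  then have "Ls N \<alpha> (\<lambda>c. D \<alpha> (h c) + low \<alpha> h c) c = (\<Sum>n<N. F n - F (Suc n))"
    unfolding Ls_def by simp
  also have "\<dots> = F 0 - F N" by (rule sum_lessThan_telescope')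
  also have "F N = 0" unfolding F_def using bd[of "up \<alpha> (N - 1) c"] c by (cases N) (auto simp: nD_def)
  also have "F 0 = 0" unfolding F_def by simp
  finally show ?thesis by simp
qed

text \<open>The operators inside the one for \<open>\<alpha>\<close> commute with
  \<open>D \<alpha>\<close> and \<open>low \<alpha>\<close>, so the expression keeps its form until
  \<open>\<alpha>\<close> is reached, where it telescopes; the operators further out act on
  zero.\<close>

lemma LL_kill:
  assumes "distinct \<alpha>s" "set \<alpha>s \<subseteq> {1..m}" "\<alpha> \<in> set \<alpha>s" and h: "\<And>c. h c \<in> A"
    and bd: "\<And>c. jet c \<Longrightarrow> cnt \<alpha> c \<ge> N - 1 \<Longrightarrow> h c = 0"
    and c: "jet c" "\<And>\<beta>. \<beta> \<in> set \<alpha>s \<Longrightarrow> cnt \<beta> c = 0"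
  shows "LL N \<alpha>s (\<lambda>c. D \<alpha> (h c) + low \<alpha> h c) c = 0"
  using assms(1-3) c
proof (induction \<alpha>s arbitrary: c)
  case (Cons \<beta> \<alpha>s)
  show ?case
  proof (cases "\<alpha> = \<beta>")
    case True
    have ni: "\<alpha> \<notin> set \<alpha>s" and s: "set \<alpha>s \<subseteq> {1..m}" and \<alpha>: "\<alpha> \<in> {1..m}"
      using Cons.prems True by auto
    have "LL N \<alpha>s (\<lambda>c. D \<alpha> (h c) + low \<alpha> h c) = (\<lambda>c. LL N \<alpha>s (\<lambda>c. D \<alpha> (h c)) c + LL N \<alpha>s (low \<alpha> h) c)"
      using LL_add[OF s D_smooth[OF \<alpha> h] low_smooth[OF h]] .
    also have "\<dots> = (\<lambda>c. D \<alpha> (LL N \<alpha>s h c) + low \<alpha> (LL N \<alpha>s h) c)"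
      by (simp only: LL_D[OF s \<alpha> h] LL_low[OF ni])
    finally have "LL N (\<beta> # \<alpha>s) (\<lambda>c. D \<alpha> (h c) + low \<alpha> h c) c = Ls N \<alpha> (\<lambda>c. D \<alpha> (LL N \<alpha>s h c) + low \<alpha> (LL N \<alpha>s h) c) c"
      using True by simp
    also have "\<dots> = 0"
      by (rule Ls_kill[OF \<alpha> LL_smooth[OF s h]])
         (use Cons.prems True LL_vanish[OF bd ni] in auto)
    finally show ?thesis .
  next
    case False
    have "LL N \<alpha>s (\<lambda>c. D \<alpha> (h c) + low \<alpha> h c) (up \<beta> n c) = 0" for n
      using Cons.prems False by (intro Cons.IH) (auto, metis cnt_up_other)
    then show ?thesis by (simp add: Ls_def)
  qed
qed simp

end

section \<open>Scaling homotopies\<close>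

definition scl :: "coord set \<Rightarrow> coord \<Rightarrow> fnB" where
  "scl C c = (if c \<in> C then 0 else cx c)"

lemma hmix_scl: "hmix e (scl C) d y = (if d \<in> C then y e * y d else y d)"
  by (simp add: hmix_def scl_def plus_fun_apply times_fun_apply minus_apply zero_fun_apply cx_apply)

lemma scl_smooth: "c \<in> K \<Longrightarrow> scl C c \<in> smooth K"
  by (auto simp: scl_def)

lemma pd_hmix:
  assumes h: "h \<in> smooth K" and c: "c \<noteq> e" and e: "e \<notin> C"
  shows "pd c (\<lambda>y. h (\<lambda>d. hmix e (scl C) d y)) =
     (if c \<in> C then cx e else 1) * (\<lambda>y. pd c h (\<lambda>d. hmix e (scl C) d y))"
proof (rule pd_eqI)
  fix y :: "coord \<Rightarrow> real"
  define z where "z = (\<lambda>d. hmix e (scl C) d y)"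
  define \<kappa> where "\<kappa> = (if c \<in> C then y e else 1)"
  have z: "(\<lambda>d. hmix e (scl C) d (y(c := t))) = z(c := \<kappa> * t)" for t
    using c by (auto simp: z_def \<kappa>_def hmix_scl fun_eq_iff)
  have zc: "z(c := \<kappa> * y c) = z" by (auto simp: z_def \<kappa>_def hmix_scl)
  have "((\<lambda>t. h (z(c := t))) has_real_derivative pd c h (z(c := \<kappa> * y c))) (at (\<kappa> * y c))"
    by (rule part_diff_DERIV[OF smooth_part_diff[OF h]])
  from DERIV_chain2[OF this DERIV_cmult_Id]
  have "((\<lambda>t. h (z(c := \<kappa> * t))) has_real_derivative pd c h z * \<kappa>) (at (y c))"
    unfolding zc .
  then show "((\<lambda>t. h (\<lambda>d. hmix e (scl C) d (y(c := t)))) has_real_derivative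
     ((if c \<in> C then cx e else 1) * (\<lambda>y. pd c h (\<lambda>d. hmix e (scl C) d y))) y) (at (y c))"
    unfolding z by (auto simp: times_fun_apply one_fun_apply cx_apply z_def \<kappa>_def mult.commute)
qed

lemma pint_sum:
  assumes "\<And>i. i \<in> I \<Longrightarrow> f i \<in> smooth K"
  shows "pint e (\<Sum>i\<in>I. f i) = (\<Sum>i\<in>I. pint e (f i))"
proof (cases "finite I")
  case True
  show ?thesis
    unfolding pint_def fun_eq_iff sum_fun_apply
    by (intro allI integral_sum True integrable_upd) (rule smooth_continuous[OF assms])
next
  case False
  then show ?thesis by (simp add: pint_def zero_fun_apply zero_fun_def)
qed

lemma pint_mult:
  assumes "g \<in> smooth K" "e \<notin> K"
  shows "pint e (g * f) = g * pint e f"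
  by (simp add: pint_def fun_eq_iff times_fun_apply smooth_upd_other[OF assms])

lemma hint_sum:
  assumes "\<And>i. i \<in> I \<Longrightarrow> f i \<in> smooth K" "\<And>c. c \<in> K \<Longrightarrow> \<tau> c \<in> smooth K"
  shows "hint e \<tau> (\<Sum>i\<in>I. f i) = (\<Sum>i\<in>I. hint e \<tau> (f i))"
proof -
  have "(\<lambda>y. (\<Sum>i\<in>I. f i) (\<lambda>d. hmix e \<tau> d y)) = (\<Sum>i\<in>I. (\<lambda>y. f i (\<lambda>d. hmix e \<tau> d y)))"
    by (simp add: fun_eq_iff sum_fun_apply)
  then show ?thesis
    unfolding hint_def by (simp only:) (rule pint_sum, rule hmix_compose_smooth, use assms in auto)
qed

lemma hint_uminus: "hint e \<tau> (- f) = - hint e \<tau> f"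
  by (simp add: hint_def pint_def fun_eq_iff uminus_apply)

lemma hint_const [simp]: "hint e \<tau> (\<lambda>y. a) = (\<lambda>y. a)" "hint e \<tau> 0 = 0"
  by (simp_all add: hint_def pint_def fun_eq_iff zero_fun_apply)

lemma pd_hint:
  assumes h: "h \<in> smooth K" and c: "c \<noteq> e" and e: "e \<notin> C"
  shows "pd c (hint e (scl C) h) = pint e ((if c \<in> C then cx e else 1) * (\<lambda>y. pd c h (\<lambda>d. hmix e (scl C) d y)))"
  unfolding hint_def pd_hmix[OF h c e, symmetric]
  by (rule smooth_pd_pint[OF hmix_compose_smooth[OF h scl_smooth] c])

text \<open>The product is x_s times the integral of g(t x_s) over t in [0,1], a primitive vanishing
  at x_s = 0. Its derivative is the integral of the t-derivative of t g(t x_s).\<close>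

lemma pd_antiderivative:
  assumes g: "g \<in> smooth K" and s: "s \<in> K" and e: "e \<notin> K"
  shows "pd s (cx s * hint e (scl {s}) g) = g"
proof -
  have se: "s \<noteq> e" using s e by auto
  have hs: "hint e (scl {s}) g \<in> smooth K" by (rule hint_smooth[OF g scl_smooth e])
  have "pd s (cx s * hint e (scl {s}) g) = hint e (scl {s}) g
      + cx s * pint e (cx e * (\<lambda>y. pd s g (\<lambda>d. hmix e (scl {s}) d y)))"
    using se by (simp add: smooth_pd_mult[OF smooth_cx[OF s] hs] pd_cx pd_hint[OF g se])
  also have "\<dots> = g"
  proof
    fix y :: "coord \<Rightarrow> real"
    define u where "u t = y(s := t * y s)" for t
    have u: "g (\<lambda>d. hmix e (scl {s}) d (y(e := t))) = g (u t)" if "g \<in> smooth K" for t g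
      by (rule depends_onD[OF smooth_dep(3)[OF that]])
         (use smooth_dep(2)[OF that] e se in \<open>auto simp: hmix_scl u_def\<close>)
    have "continuous_on {0..1} (\<lambda>t. k (u t))" if "k \<in> smooth K" for k
      unfolding u_def
      by (rule continuous_on_comp_upd[OF smooth_continuous[OF that]]) (auto intro!: continuous_on_mult continuous_on_id)
    note cont = this[OF g] this[OF smooth_pd[OF g, of s]]
    have "((\<lambda>t. g (y(s := t))) has_real_derivative pd s g (y(s := t * y s))) (at (t * y s))" for t
      by (rule part_diff_DERIV[OF smooth_part_diff[OF g]])
    from DERIV_chain2[OF this DERIV_cmult_right[OF DERIV_ident]]
    have du: "((\<lambda>t. g (u t)) has_real_derivative pd s g (u t) * y s) (at t)" for t
      unfolding u_def by simp
    have "((\<lambda>t. g (u t) + y s * (t * pd s g (u t))) has_integral 1 * g (u 1) - 0 * g (u 0)) {0..1}"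
    proof (rule fundamental_theorem_of_calculus)
      fix t
      have "((\<lambda>t. t * g (u t)) has_real_derivative 1 * g (u t) + pd s g (u t) * y s * t) (at t)"
        by (rule DERIV_mult[OF DERIV_ident du])
      then show "((\<lambda>t. t * g (u t)) has_vector_derivative g (u t) + y s * (t * pd s g (u t))) (at t within {0..1})"
        unfolding has_real_derivative_iff_has_vector_derivative[symmetric]
        by (auto simp: mult_ac intro: has_field_derivative_at_within)
    qed simp
    moreover have "((\<lambda>t. g (u t) + y s * (t * pd s g (u t))) has_integral
        integral {0..1} (\<lambda>t. g (u t)) + y s * integral {0..1} (\<lambda>t. t * pd s g (u t))) {0..1}"
      by (intro has_integral_add has_integral_mult_right integrable_integral integrable_continuous_real cont
            continuous_on_mult continuous_on_id)
    ultimately have "1 * g (u 1) - 0 * g (u 0) = integral {0..1} (\<lambda>t. g (u t)) + y s * integral {0..1} (\<lambda>t. t * pd s g (u t))"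
      by (rule has_integral_unique)
    moreover have "u 1 = y" by (simp add: u_def)
    ultimately have "integral {0..1} (\<lambda>t. g (u t)) + y s * integral {0..1} (\<lambda>t. t * pd s g (u t)) = g y"
      by simp
    then show "(hint e (scl {s}) g + cx s * pint e (cx e * (\<lambda>y. pd s g (\<lambda>d. hmix e (scl {s}) d y)))) y = g y"
      by (simp add: hint_def pint_def u[OF g] u[OF smooth_pd[OF g]] plus_fun_apply times_fun_apply cx_apply)
  qed
  finally show ?thesis .
qed

context cont_eq
begin

definition XS :: "coord set" where "XS = Xc ` {1..m}"

lemma XS_rc: "XS \<subseteq> rc m" by (auto simp: XS_def)

lemma Xc0: "Xc 0 \<notin> rc m" "Xc 0 \<notin> XS" by (auto simp: XS_def)

lemma D_XS:
  assumes f: "f \<in> smooth XS"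
  shows "D \<mu> f = pd (Xc \<mu>) f"
proof -
  have fin: "finite (dep f)" and sub: "dep f \<subseteq> XS" using smooth_dep[OF f] by auto
  have "red m (tdb \<mu> c) * pd c f = (if c = Xc \<mu> then pd (Xc \<mu>) f else 0)" if "c \<in> dep f" for c
  proof -
    have "c \<in> XS" using that sub by blast
    then obtain \<nu> where "c = Xc \<nu>" by (auto simp: XS_def)
    then show ?thesis by simp
  qed
  then have "D \<mu> f = (\<Sum>c\<in>dep f. if c = Xc \<mu> then pd (Xc \<mu>) f else 0)"
    unfolding Dr_def vf_def by (rule sum.cong[OF refl])
  then show ?thesis using fin pd_notin_dep[of "Xc \<mu>" f] by simp
qed

text \<open>Integration in x^s keeps independence of the other variables; the last conclusion lets a
  primitive stay in the kernel of other total derivatives.\<close>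

lemma antiderivative:
  assumes g: "g \<in> smooth XS" and s: "s \<in> {1..m}"
  shows "\<exists>h\<in>smooth XS. D s h = g \<and> (\<forall>\<mu>. \<mu> \<in> {1..m} \<longrightarrow> \<mu> \<noteq> s \<longrightarrow> pd (Xc \<mu>) g = 0 \<longrightarrow> D \<mu> h = 0)"
proof -
  let ?e = "Xc 0"
  define h where "h = cx (Xc s) * hint ?e (scl {Xc s}) g"
  have hs: "hint ?e (scl {Xc s}) g \<in> smooth XS"
    by (rule hint_smooth[OF g scl_smooth Xc0(2)])
  have sX: "Xc s \<in> XS" using s by (auto simp: XS_def)
  have h: "h \<in> smooth XS" unfolding h_def using hs sX by auto
  have "D s h = g"
    unfolding D_XS[OF h] unfolding h_def by (rule pd_antiderivative[OF g sX Xc0(2)])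
  moreover have "D \<mu> h = 0" if "\<mu> \<in> {1..m}" "\<mu> \<noteq> s" "pd (Xc \<mu>) g = 0" for \<mu>
  proof -
    have "pd (Xc \<mu>) (hint ?e (scl {Xc s}) g) = 0"
    proof (subst pd_hint[OF g])
      have "(if Xc \<mu> \<in> {Xc s} then cx (Xc 0) else 1) * (\<lambda>y. pd (Xc \<mu>) g (\<lambda>d. hmix (Xc 0) (scl {Xc s}) d y)) = (0 :: fnB)"
        by (simp add: that(3) fun_eq_iff times_fun_apply zero_fun_apply)
      then show "pint (Xc 0) ((if Xc \<mu> \<in> {Xc s} then cx (Xc 0) else 1) * (\<lambda>y. pd (Xc \<mu>) g (\<lambda>d. hmix (Xc 0) (scl {Xc s}) d y))) = 0"
        by (simp add: pint_def fun_eq_iff zero_fun_apply)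
    qed (use that s in auto)
    then show ?thesis
      unfolding D_XS[OF h] unfolding h_def using that(2)
      by (simp add: smooth_pd_mult[OF smooth_cx[OF sX] hs] pd_cx)
  qed
  ultimately show ?thesis using h by blast
qed

text \<open>The average of a function over the scalings by t in [0,1] of all u- and p-coordinates,
  with x held fixed.\<close>

definition G :: "fnB \<Rightarrow> fnB" where "G = hint (Xc 0) (scl (Collect jet))"

lemma G_smooth: "h \<in> A \<Longrightarrow> G h \<in> A"
  unfolding G_def by (rule hint_smooth[OF _ scl_smooth Xc0(1)])

lemma G_sum: "(\<And>i. i \<in> I \<Longrightarrow> f i \<in> A) \<Longrightarrow> G (\<Sum>i\<in>I. f i) = (\<Sum>i\<in>I. G (f i))"
  unfolding G_def by (rule hint_sum[where K="rc m"]) (auto intro: scl_smooth)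

text \<open>The components of \<open>D \<alpha>\<close> are linear in the jets at jet coordinates
  and constant at x, so \<open>D \<alpha>\<close> is invariant under scaling of the jets: the factor
  t from the chain rule is the one that scales the component.\<close>

lemma G_D:
  assumes h: "h \<in> A" and \<alpha>: "\<alpha> \<in> {2..m}"
  shows "D \<alpha> (G h) = G (D \<alpha> h)"
proof -
  let ?e = "Xc 0"
  let ?hm = "\<lambda>y d. hmix ?e (scl (Collect jet)) d y"
  have \<alpha>1: "\<alpha> \<in> {1..m}" using \<alpha> by auto
  define S where "S = dep h \<union> dep (G h)"
  have S: "finite S" "S \<subseteq> rc m" using smooth_dep[OF h] smooth_dep[OF G_smooth[OF h]] by (auto simp: S_def)
  have "D \<alpha> (G h) = (\<Sum>c\<in>S. red m (tdb \<alpha> c) * pd c (G h))"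
    unfolding Dr_def by (rule vf_eq) (use S in \<open>auto simp: S_def\<close>)
  also have "\<dots> = (\<Sum>c\<in>S. pint ?e (\<lambda>y. (red m (tdb \<alpha> c) * pd c h) (?hm y)))"
  proof (rule sum.cong[OF refl])
    fix c assume "c \<in> S"
    then have c: "c \<in> rc m" "c \<noteq> ?e" using S Xc0 by auto
    let ?\<kappa> = "if c \<in> Collect jet then cx ?e else 1"
    have r: "red m (tdb \<alpha> c) = tdb \<alpha> c" by (rule red_tdb[OF c(1) \<alpha>])
    have t: "tdb \<alpha> c \<in> A" using tdb_red_smooth[OF c(1) \<alpha>1] r by simp
    have "tdb \<alpha> c * (?\<kappa> * (\<lambda>y. pd c h (?hm y))) = (\<lambda>y. (tdb \<alpha> c * pd c h) (?hm y))"
      by (cases c) (auto simp: fun_eq_iff times_fun_apply one_fun_apply zero_fun_apply cx_apply hmix_scl)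
    then show "red m (tdb \<alpha> c) * pd c (G h) = pint ?e (\<lambda>y. (red m (tdb \<alpha> c) * pd c h) (?hm y))"
      unfolding r G_def by (subst pd_hint[OF h c(2)]) (simp_all add: pint_mult[OF t Xc0(1), symmetric])
  qed
  also have "\<dots> = (\<Sum>c\<in>S. G (red m (tdb \<alpha> c) * pd c h))"
    unfolding G_def hint_def ..
  also have "\<dots> = G (\<Sum>c\<in>S. red m (tdb \<alpha> c) * pd c h)"
    using S h by (intro G_sum[symmetric] smooth_mult tdb_red_smooth \<alpha>1) auto
  also have "(\<Sum>c\<in>S. red m (tdb \<alpha> c) * pd c h) = D \<alpha> h"
    unfolding Dr_def by (rule vf_eq[symmetric]) (use S in \<open>auto simp: S_def\<close>)
  finally show ?thesis .
qed

lemma G_nD_pow: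
  assumes "h \<in> A" "\<alpha> \<in> {2..m}"
  shows "(nD \<alpha> ^^ n) (G h) = G ((nD \<alpha> ^^ n) h)"
proof (induction n)
  case (Suc n)
  have "(nD \<alpha> ^^ n) h \<in> A" by (rule nD_pow_smooth) (use assms in auto)
  then show ?case using Suc G_D[OF _ assms(2)]
    by (simp add: nD_def[of \<alpha> "G _"] nD_def[of \<alpha> "(nD \<alpha> ^^ n) h"]) (simp add: G_def hint_uminus)
qed simp

lemma LL_G:
  assumes "set \<alpha>s \<subseteq> {2..m}" "\<And>c. h c \<in> A"
  shows "LL N \<alpha>s (\<lambda>c. G (h c)) = (\<lambda>c. G (LL N \<alpha>s h c))"
  using assms(1)
proof (induction \<alpha>s)
  case (Cons \<alpha> \<alpha>s)
  have s: "\<alpha> \<in> {2..m}" "\<alpha> \<in> {1..m}" "set \<alpha>s \<subseteq> {1..m}" using Cons.prems by auto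
  have l: "LL N \<alpha>s h c \<in> A" for c by (rule LL_smooth[OF s(3) assms(2)])
  have "LL N \<alpha>s (\<lambda>c. G (h c)) = (\<lambda>c. G (LL N \<alpha>s h c))" using Cons by simp
  then show ?case
    by (simp add: Ls_def G_nD_pow[OF l s(1)] G_sum nD_pow_smooth[OF s(2) l])
qed simp

section \<open>Integration by parts modulo sums of total derivatives\<close>

definition im :: "nat set \<Rightarrow> fnB set" where
  "im S = {f. \<exists>g. (\<forall>\<alpha>. g \<alpha> \<in> A) \<and> f = (\<Sum>\<alpha>\<in>S. D \<alpha> (g \<alpha>))}"

lemma im_0: "0 \<in> im S"
  unfolding im_def by (auto intro!: exI[of _ "\<lambda>_. 0"])

lemma im_add: "f \<in> im S \<Longrightarrow> g \<in> im S \<Longrightarrow> f + g \<in> im S"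
proof -
  assume "f \<in> im S" "g \<in> im S"
  then obtain a b where "\<forall>\<alpha>. a \<alpha> \<in> A" "f = (\<Sum>\<alpha>\<in>S. D \<alpha> (a \<alpha>))" "\<forall>\<alpha>. b \<alpha> \<in> A" "g = (\<Sum>\<alpha>\<in>S. D \<alpha> (b \<alpha>))"
    unfolding im_def by blast
  then show ?thesis
    unfolding im_def by (auto intro!: exI[of _ "\<lambda>\<alpha>. a \<alpha> + b \<alpha>"] simp: Dr_add sum.distrib)
qed

lemma im_sum: "(\<And>i. i \<in> I \<Longrightarrow> f i \<in> im S) \<Longrightarrow> (\<Sum>i\<in>I. f i) \<in> im S"
  by (induction I rule: infinite_finite_induct) (auto intro: im_0 im_add)

lemma im_D:
  assumes "finite S" "\<alpha> \<in> S" "g \<in> A"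
  shows "D \<alpha> g \<in> im S"
proof -
  have "D \<alpha> g = (\<Sum>\<beta>\<in>S. D \<beta> (if \<beta> = \<alpha> then g else 0))"
    using assms by (subst sum.remove[of S \<alpha>]) (auto intro!: sum.neutral)
  then show ?thesis unfolding im_def using assms(3)
    by (auto intro!: exI[of _ "\<lambda>\<beta>. if \<beta> = \<alpha> then g else 0"])
qed

text \<open>Integration by parts, repeated \<open>n\<close> times in direction
  \<open>\<alpha>\<close>.\<close>

lemma up_mult_im:
  assumes c: "c \<in> RJ" and \<alpha>: "\<alpha> \<in> {2..m}" "\<alpha> \<in> S" "finite S" and g: "g \<in> A"
  shows "cx (up \<alpha> n c) * g - cx c * (nD \<alpha> ^^ n) g \<in> im S"
  using g
proof (induction n arbitrary: g)
  case 0
  then show ?case by (simp add: im_0)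
next
  case (Suc n)
  have \<alpha>1: "\<alpha> \<in> {1..m}" using \<alpha> by auto
  have ng: "nD \<alpha> g \<in> A" using nD_pow_smooth[OF \<alpha>1 Suc.prems, of 1] by simp
  have u: "up \<alpha> n c \<in> RJ" by (rule RJ_up2[OF c \<alpha>(1)])
  have "D \<alpha> (cx (up \<alpha> n c) * g) = cx (up \<alpha> (Suc n) c) * g + cx (up \<alpha> n c) * D \<alpha> g"
    by (simp add: Dr_mult[OF cx_RJ[OF u] Suc.prems] D_cx[OF u \<alpha>(1), simplified] up_up)
  then have "cx (up \<alpha> (Suc n) c) * g - cx c * (nD \<alpha> ^^ Suc n) g =
      D \<alpha> (cx (up \<alpha> n c) * g) + (cx (up \<alpha> n c) * nD \<alpha> g - cx c * (nD \<alpha> ^^ n) (nD \<alpha> g))"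
    by (simp add: funpow_swap1 nD_def[of \<alpha> g] algebra_simps)
  moreover have "D \<alpha> (cx (up \<alpha> n c) * g) \<in> im S"
    by (rule im_D[OF \<alpha>(3,2)]) (use cx_RJ[OF u] Suc.prems in auto)
  ultimately show ?case using Suc.IH[OF ng] by (simp add: im_add)
qed

text \<open>What remains of the jet coordinates of bounded order once all derivatives in the
  directions \<open>\<alpha>s\<close> have been integrated away.\<close>

definition Bx :: "nat \<Rightarrow> nat list \<Rightarrow> coord set" where
  "Bx N \<alpha>s = {c \<in> RJ. \<forall>\<beta>\<in>{1..m}. cnt \<beta> c < N \<and> (\<beta> \<in> set \<alpha>s \<longrightarrow> cnt \<beta> c = 0)}"

lemma finite_Bx: "finite (Bx N \<alpha>s)"
proof -
  define F where "F = {i. \<forall>x. (x \<in> {1..m} \<longrightarrow> i x \<in> {..<N}) \<and> (x \<notin> {1..m} \<longrightarrow> i x = 0)}"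
  have "finite F" unfolding F_def by (rule finite_set_of_finite_funs) auto
  then have "finite ((\<lambda>(l, i). Uc l i) ` ({1..m} \<times> F) \<union> Pc ` F)" by auto
  moreover have "Bx N \<alpha>s \<subseteq> (\<lambda>(l, i). Uc l i) ` ({1..m} \<times> F) \<union> Pc ` F"
  proof
    fix c assume "c \<in> Bx N \<alpha>s"
    then show "c \<in> (\<lambda>(l, i). Uc l i) ` ({1..m} \<times> F) \<union> Pc ` F"
      by (cases c) (auto simp: Bx_def RJ_def F_def MI_def)
  qed
  ultimately show ?thesis by (rule finite_subset[rotated])
qed

text \<open>A coordinate is determined by its order in direction \<open>\<alpha>\<close> together
  with the coordinate obtained by setting that order to zero.\<close>

lemma Bx_sum:
  assumes \<alpha>: "\<alpha> \<in> {2..m}" "\<alpha> \<notin> set \<alpha>s"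
  shows "(\<Sum>c\<in>Bx N \<alpha>s. \<phi> c) = (\<Sum>c\<in>Bx N (\<alpha> # \<alpha>s). \<Sum>n<N. \<phi> (up \<alpha> n c) :: fnB)"
proof -
  have zr: "up \<alpha> (cnt \<alpha> c) (zr \<alpha> c) = c" "zr \<alpha> (up \<alpha> n c) = zr \<alpha> c"
    "cnt \<beta> (zr \<alpha> c) = (if \<beta> = \<alpha> then 0 else cnt \<beta> c)" "cnt \<alpha> c = 0 \<Longrightarrow> zr \<alpha> c = c" for c n \<beta>
    by (cases c; auto)+
  have zrRJ: "zr \<alpha> c \<in> RJ" if "c \<in> RJ" for c
    using that \<alpha> by (cases c) (auto simp: RJ_def intro!: MI_upd)
  have "(\<Sum>c\<in>Bx N \<alpha>s. \<phi> c) = (\<Sum>(c, n)\<in>Bx N (\<alpha> # \<alpha>s) \<times> {..<N}. \<phi> (up \<alpha> n c))"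
  proof (rule sum.reindex_bij_witness[where i="\<lambda>(c, n). up \<alpha> n c" and j="\<lambda>c. (zr \<alpha> c, cnt \<alpha> c)"])
    fix c assume c: "c \<in> Bx N \<alpha>s"
    show "(zr \<alpha> c, cnt \<alpha> c) \<in> Bx N (\<alpha> # \<alpha>s) \<times> {..<N}"
    proof -
      have "\<alpha> \<in> {1..m}" using \<alpha> by auto
      then have *: "cnt \<alpha> c < N" using c by (simp add: Bx_def)
      then have N0: "0 < N" by simp
      have "cnt \<beta> (zr \<alpha> c) < N \<and> (\<beta> \<in> set (\<alpha> # \<alpha>s) \<longrightarrow> cnt \<beta> (zr \<alpha> c) = 0)" if "\<beta> \<in> {1..m}" for \<beta>
        using c that N0 by (simp add: zr(3) Bx_def)
      moreover have "zr \<alpha> c \<in> RJ" using c zrRJ by (simp add: Bx_def)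
      ultimately show ?thesis using * by (simp add: Bx_def)
    qed
  next
    fix p assume "p \<in> Bx N (\<alpha> # \<alpha>s) \<times> {..<N}"
    then obtain c n where p: "p = (c, n)" "c \<in> Bx N (\<alpha> # \<alpha>s)" "n < N" by auto
    have c: "jet c" "cnt \<alpha> c = 0" "c \<in> RJ" using p \<alpha> by (auto simp: Bx_def RJ_def)
    show "(zr \<alpha> (case p of (c, n) \<Rightarrow> up \<alpha> n c), cnt \<alpha> (case p of (c, n) \<Rightarrow> up \<alpha> n c)) = p"
      using c p by (simp add: zr)
    have "cnt \<beta> (up \<alpha> n c) = (if \<beta> = \<alpha> then n else cnt \<beta> c)" for \<beta>
      using c by auto
    then show "(case p of (c, n) \<Rightarrow> up \<alpha> n c) \<in> Bx N \<alpha>s"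
      using p \<alpha> RJ_up2[OF c(3) \<alpha>(1)] by (auto simp: Bx_def)
  qed (auto simp: zr)
  then show ?thesis by (simp add: sum.cartesian_product)
qed

text \<open>Integrating by parts in one direction collects the coefficients of all
  \<open>up \<alpha> n c\<close> at \<open>c\<close>, which is the sum defining \<open>Ls\<close>;
  iteration over the directions builds \<open>LL\<close>.\<close>

lemma Bx_reduce:
  assumes "set \<alpha>s \<subseteq> {2..m}" "distinct \<alpha>s" "set \<alpha>s \<subseteq> S" "finite S" and h: "\<And>c. h c \<in> A"
  shows "(\<Sum>c\<in>Bx N []. cx c * h c) - (\<Sum>c\<in>Bx N \<alpha>s. cx c * LL N \<alpha>s h c) \<in> im S"
  using assms(1-3)
proof (induction \<alpha>s)
  case Nil
  then show ?case by (simp add: im_0)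
next
  case (Cons \<alpha> \<alpha>s)
  have \<alpha>: "\<alpha> \<in> {2..m}" "\<alpha> \<notin> set \<alpha>s" "\<alpha> \<in> S" and s: "set \<alpha>s \<subseteq> {1..m}" using Cons.prems by auto
  let ?k = "LL N \<alpha>s h"
  have k: "?k c \<in> A" for c by (rule LL_smooth[OF s h])
  have "(\<Sum>c\<in>Bx N \<alpha>s. cx c * ?k c) - (\<Sum>c\<in>Bx N (\<alpha> # \<alpha>s). cx c * LL N (\<alpha> # \<alpha>s) h c)
     = (\<Sum>c\<in>Bx N (\<alpha> # \<alpha>s). \<Sum>n<N. cx (up \<alpha> n c) * ?k (up \<alpha> n c) - cx c * (nD \<alpha> ^^ n) (?k (up \<alpha> n c)))"
    by (simp add: Bx_sum[OF \<alpha>(1,2)] Ls_def sum_subtractf sum_distrib_left)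
  also have "\<dots> \<in> im S"
    by (intro im_sum up_mult_im) (use \<alpha> k assms(4) in \<open>auto simp: Bx_def\<close>)
  finally have "(\<Sum>c\<in>Bx N \<alpha>s. cx c * ?k c) - (\<Sum>c\<in>Bx N (\<alpha> # \<alpha>s). cx c * LL N (\<alpha> # \<alpha>s) h c) \<in> im S" .
  from im_add[OF Cons.IH this] Cons.prems show ?case by simp
qed

text \<open>Modulo total derivatives a function is recovered from its Euler derivatives: integrate along
  the scaling of all jet coordinates and integrate by parts.\<close>
lemma euler_homotopy:
  assumes f: "f \<in> A" and \<alpha>s: "set \<alpha>s \<subseteq> {2..m}" "distinct \<alpha>s" "\<alpha>s \<noteq> []"
    and N: "\<And>c \<alpha>. jet c \<Longrightarrow> cnt \<alpha> c \<ge> N \<Longrightarrow> pd c f = 0"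
  shows "f - (\<Sum>c\<in>Bx N \<alpha>s. cx c * G (LL N \<alpha>s (\<lambda>c. pd c f) c)) \<in> im (set \<alpha>s)"
proof -
  let ?\<tau> = "scl (Collect jet)"
  have fin: "finite (dep f)" and sub: "dep f \<subseteq> rc m" using smooth_dep[OF f] by auto
  define f0 where "f0 = (\<lambda>y. f (\<lambda>d. ?\<tau> d y))"
  have f0: "f0 \<in> smooth XS"
    unfolding f0_def
  proof (rule smooth_compose[OF f])
    fix c assume "c \<in> rc m"
    then show "?\<tau> c \<in> smooth XS"
      by (cases c) (auto simp: scl_def XS_def)
  qed
  \<comment> \<open>The endpoint of the homotopy is a function of x alone, hence a total derivative
    in any one direction; nonemptiness of \<open>\<alpha>s\<close> supplies the direction.\<close>
  obtain \<alpha> where \<alpha>: "\<alpha> \<in> set \<alpha>s" using \<alpha>s(3) by (cases \<alpha>s) auto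
  then have "\<alpha> \<in> {1..m}" using \<alpha>s(1) by auto
  then obtain h where h: "h \<in> smooth XS" "D \<alpha> h = f0" using antiderivative[OF f0] by blast
  have 0: "f0 \<in> im (set \<alpha>s)"
    unfolding h(2)[symmetric] by (rule im_D) (use \<alpha> h smooth_mono[OF _ XS_rc] in auto)
  have "f - f0 = (\<Sum>c\<in>dep f. (cx c - ?\<tau> c) * G (pd c f))"
    unfolding f0_def G_def by (rule hadamard[OF f scl_smooth Xc0(1)])
  also have "\<dots> = (\<Sum>c\<in>Bx N []. cx c * G (pd c f))"
  proof (rule sum.mono_neutral_cong[OF finite_Bx fin])
    fix c assume "c \<in> Bx N [] - dep f"
    then show "cx c * G (pd c f) = 0" by (simp add: pd_notin_dep G_def)
  next
    fix c assume c: "c \<in> dep f - Bx N []"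
    show "(cx c - ?\<tau> c) * G (pd c f) = 0"
    proof (cases "jet c")
      case True
      then have "pd c f = 0" using c sub N[OF True] by (auto simp: Bx_def RJ_def not_less)
      then show ?thesis by (simp add: G_def)
    qed (simp add: scl_def)
  next
    fix c assume "c \<in> dep f \<inter> Bx N []"
    then show "(cx c - ?\<tau> c) * G (pd c f) = cx c * G (pd c f)"
      by (simp add: scl_def Bx_def RJ_def)
  qed
  finally have 1: "f - f0 = (\<Sum>c\<in>Bx N []. cx c * G (pd c f))" .
  have 2: "(\<Sum>c\<in>Bx N []. cx c * G (pd c f)) - (\<Sum>c\<in>Bx N \<alpha>s. cx c * LL N \<alpha>s (\<lambda>c. G (pd c f)) c) \<in> im (set \<alpha>s)"
    by (rule Bx_reduce[OF \<alpha>s(1,2)]) (use f in \<open>auto intro: G_smooth\<close>)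
  have "f - (\<Sum>c\<in>Bx N \<alpha>s. cx c * LL N \<alpha>s (\<lambda>c. G (pd c f)) c) =
     ((\<Sum>c\<in>Bx N []. cx c * G (pd c f)) - (\<Sum>c\<in>Bx N \<alpha>s. cx c * LL N \<alpha>s (\<lambda>c. G (pd c f)) c)) + f0"
    unfolding 1[symmetric] by simp
  also have "\<dots> \<in> im (set \<alpha>s)" by (rule im_add[OF 2 0])
  finally show ?thesis unfolding LL_G[OF \<alpha>s(1) smooth_pd[OF f]] .
qed

section \<open>Kernels of total derivatives\<close>

lemma jet_bound:
  assumes "f \<in> A"
  shows "\<exists>B. \<forall>c \<alpha>. jet c \<longrightarrow> B \<le> cnt \<alpha> c \<longrightarrow> pd c f = 0"
proof -
  have fin: "finite (dep f)" and sub: "dep f \<subseteq> rc m" using smooth_dep[OF assms] by auto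
  define B where "B = Suc (\<Sum>c\<in>dep f. \<Sum>\<alpha>\<in>{1..m}. cnt \<alpha> c)"
  have "cnt \<alpha> c < B" if c: "c \<in> dep f" for c \<alpha>
  proof (cases "\<alpha> \<in> {1..m}")
    case True
    have "cnt \<alpha> c \<le> (\<Sum>\<alpha>\<in>{1..m}. cnt \<alpha> c)" by (rule member_le_sum[OF True]) auto
    also have "\<dots> \<le> (\<Sum>c\<in>dep f. \<Sum>\<alpha>\<in>{1..m}. cnt \<alpha> c)" by (rule member_le_sum[OF c]) (use fin in auto)
    finally show ?thesis unfolding B_def by simp
  next
    case False
    then have "cnt \<alpha> c = 0" using c sub by (cases c) (auto simp: MI_def)
    then show ?thesis unfolding B_def by simp
  qed
  then show ?thesis using pd_notin_dep by (metis not_le)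
qed

lemma jet_bound_family:
  assumes "finite S" "\<And>\<alpha>. \<alpha> \<in> S \<Longrightarrow> g \<alpha> \<in> A"
  shows "\<exists>B. \<forall>\<alpha>\<in>S. \<forall>c \<beta>. jet c \<longrightarrow> B \<le> cnt \<beta> c \<longrightarrow> pd c (g \<alpha>) = 0"
  using assms
proof (induction S rule: finite_induct)
  case (insert a S)
  then obtain B where B: "\<forall>\<alpha>\<in>S. \<forall>c \<beta>. jet c \<longrightarrow> B \<le> cnt \<beta> c \<longrightarrow> pd c (g \<alpha>) = 0" by blast
  obtain B' where "\<forall>c \<beta>. jet c \<longrightarrow> B' \<le> cnt \<beta> c \<longrightarrow> pd c (g a) = 0" using insert.prems jet_bound by blast
  with B have "\<forall>\<alpha>\<in>insert a S. \<forall>c \<beta>. jet c \<longrightarrow> max B B' \<le> cnt \<beta> c \<longrightarrow> pd c (g \<alpha>) = 0" by auto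
  then show ?case by blast
qed simp

text \<open>The relation expresses \<open>h c\<close> through its value one order higher, and values
  of high order vanish. \<open>Q\<close> must be closed under raising in direction \<open>s\<close>;
  within \<open>RJ\<close> and for \<open>s = 1\<close> this keeps u^1 out of it.\<close>

lemma descend:
  assumes Q: "\<And>c. c \<in> Q \<Longrightarrow> jet c" "\<And>c. c \<in> Q \<Longrightarrow> up s 1 c \<in> Q"
    and van: "\<And>c. c \<in> Q \<Longrightarrow> B \<le> cnt s c \<Longrightarrow> h c = 0"
    and step: "\<And>c. c \<in> Q \<Longrightarrow> D s (h (up s 1 c)) + h c = 0"
    and c: "c \<in> Q"
  shows "h c = 0"
  using c
proof (induction "B - cnt s c" arbitrary: c)
  case 0
  then show ?case using van by simp
next
  case (Suc n)
  have "n = B - cnt s (up s 1 c)" using Suc.hyps(2) Q(1)[OF Suc.prems] by simp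
  from Suc.hyps(1)[OF this Q(2)[OF Suc.prems]] step[OF Suc.prems] show ?case by simp
qed

text \<open>Commuting a jet derivative past D_m f = 0 gives the descending relation for the partial
  derivatives themselves. Direction m belongs to every index set {s..m}, so one lemma serves degree
  0 of all the complexes.\<close>

lemma smooth_XS_if_D_0:
  assumes f: "f \<in> A" and D0: "D m f = 0"
  shows "f \<in> smooth XS"
proof -
  have mm: "m \<in> {2..m}" using m2 by auto
  obtain B where B: "\<forall>c \<alpha>. jet c \<longrightarrow> B \<le> cnt \<alpha> c \<longrightarrow> pd c f = 0" using jet_bound[OF f] by blast
  have "pd c f = 0" if "c \<in> Collect jet" for c
  proof (rule descend[where Q="Collect jet" and s=m and B=B])
    fix d assume "d \<in> Collect jet"
    then show "D m (pd (up m 1 d) f) + pd d f = 0"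
      using pd_D[OF f mm, of "up m 1 d"] D0 by (simp add: low_def)
  qed (use that B in auto)
  then have "\<not> jet c" if "c \<in> dep f" for c
    using notin_dep_if_pd_0[OF smooth_part_diff[OF f]] that by blast
  moreover have "c \<in> XS" if "c \<in> rc m" "\<not> jet c" for c
    using that by (cases c) (auto simp: XS_def)
  ultimately have "dep f \<subseteq> XS" using smooth_dep(2)[OF f] by blast
  then show ?thesis by (rule smooth_if_dep[OF f])
qed

text \<open>The kernel over {s+1..m} is not zero, but it consists of functions of x, on which
  integration in x^s is a right inverse of D_s.\<close>

lemma kernel_antiderivative:
  assumes s: "1 \<le> s" "s < m" and f: "f \<in> A" and D0: "\<And>\<alpha>. \<alpha> \<in> {Suc s..m} \<Longrightarrow> D \<alpha> f = 0"
  shows "\<exists>h\<in>A. D s h = f \<and> (\<forall>\<alpha>\<in>{Suc s..m}. D \<alpha> h = 0)"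
proof -
  have fX: "f \<in> smooth XS" by (rule smooth_XS_if_D_0[OF f D0]) (use s in auto)
  have "s \<in> {1..m}" using s by auto
  then obtain h where h: "h \<in> smooth XS" "D s h = f"
    "\<forall>\<mu>. \<mu> \<in> {1..m} \<longrightarrow> \<mu> \<noteq> s \<longrightarrow> pd (Xc \<mu>) f = 0 \<longrightarrow> D \<mu> h = 0"
    using antiderivative[OF fX] by blast
  have "D \<alpha> h = 0" if "\<alpha> \<in> {Suc s..m}" for \<alpha>
  proof -
    have "pd (Xc \<alpha>) f = 0" using D0[OF that] D_XS[OF fX] by simp
    moreover have "\<alpha> \<in> {1..m}" "\<alpha> \<noteq> s" using that s by auto
    ultimately show ?thesis using h(3) by blast
  qed
  then show ?thesis using h smooth_mono[OF _ XS_rc] by blast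
qed

lemma constant_if_D_0:
  assumes f: "f \<in> A" and D0: "\<And>\<alpha>. \<alpha> \<in> {1..m} \<Longrightarrow> D \<alpha> f = 0"
  shows "\<exists>a. f = (\<lambda>_. a)"
proof -
  have fX: "f \<in> smooth XS" by (rule smooth_XS_if_D_0[OF f D0]) (use m2 in auto)
  have "c \<notin> dep f" for c
  proof
    assume c: "c \<in> dep f"
    then have "c \<in> XS" using smooth_dep(2)[OF fX] by blast
    then obtain \<mu> where \<mu>: "c = Xc \<mu>" "\<mu> \<in> {1..m}" by (auto simp: XS_def)
    then have "pd c f = 0" using D0 D_XS[OF fX] by simp
    then show False using notin_dep_if_pd_0[OF smooth_part_diff[OF f]] c by blast
  qed
  then have "depends_on {} f" using smooth_dep(3)[OF f] by (metis equals0I)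
  then have "f = (\<lambda>_. f 0)" unfolding depends_on_def by auto
  then show ?thesis by blast
qed

section \<open>The top cohomology of the auxiliary complexes\<close>

lemma LL_im_0:
  assumes \<alpha>s: "distinct \<alpha>s" "set \<alpha>s \<subseteq> {2..m}" and g: "\<And>\<alpha>. g \<alpha> \<in> A"
    and bd: "\<And>\<alpha> c \<beta>. \<alpha> \<in> set \<alpha>s \<Longrightarrow> jet c \<Longrightarrow> N - 1 \<le> cnt \<beta> c \<Longrightarrow> pd c (g \<alpha>) = 0"
    and c: "c \<in> RJ" "\<And>\<beta>. \<beta> \<in> set \<alpha>s \<Longrightarrow> cnt \<beta> c = 0"
  shows "LL N \<alpha>s (\<lambda>c. pd c (\<Sum>\<alpha>\<in>set \<alpha>s. D \<alpha> (g \<alpha>))) c = 0"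
proof -
  have s1: "set \<alpha>s \<subseteq> {1..m}" using \<alpha>s by auto
  define P where "P \<alpha> c = D \<alpha> (pd c (g \<alpha>)) + low \<alpha> (\<lambda>c. pd c (g \<alpha>)) c" for \<alpha> c
  have PA: "P \<alpha> c \<in> A" if "\<alpha> \<in> set \<alpha>s" for \<alpha> c
    unfolding P_def by (intro smooth_add D_smooth low_smooth) (use that s1 g in auto)
  have "LL N \<alpha>s (\<lambda>c. pd c (\<Sum>\<alpha>\<in>set \<alpha>s. D \<alpha> (g \<alpha>))) c = LL N \<alpha>s (\<lambda>c. \<Sum>\<alpha>\<in>set \<alpha>s. P \<alpha> c) c"
  proof (rule LL_cong[OF \<alpha>s(2) _ c(1)])
    fix d assume d: "d \<in> RJ"
    have "pd d (\<Sum>\<alpha>\<in>set \<alpha>s. D \<alpha> (g \<alpha>)) = (\<Sum>\<alpha>\<in>set \<alpha>s. pd d (D \<alpha> (g \<alpha>)))"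
      by (rule smooth_pd_sum[of _ _ "rc m"]) (use s1 g in \<open>auto intro!: D_smooth\<close>)
    also have "\<dots> = (\<Sum>\<alpha>\<in>set \<alpha>s. P \<alpha> d)"
      unfolding P_def by (rule sum.cong[OF refl], rule pd_D[OF g]) (use \<alpha>s(2) RJ_jet[OF d] in auto)
    finally show "pd d (\<Sum>\<alpha>\<in>set \<alpha>s. D \<alpha> (g \<alpha>)) = (\<Sum>\<alpha>\<in>set \<alpha>s. P \<alpha> d)" .
  qed
  also have "\<dots> = (\<Sum>\<alpha>\<in>set \<alpha>s. LL N \<alpha>s (P \<alpha>) c)"
    using LL_sum[OF s1, of "set \<alpha>s" P N] PA by simp
  also have "\<dots> = 0"
  proof (rule sum.neutral, rule ballI)
    fix \<alpha> assume "\<alpha> \<in> set \<alpha>s"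
    then show "LL N \<alpha>s (P \<alpha>) c = 0"
      unfolding P_def
      by (intro LL_kill[OF \<alpha>s(1) s1]) (use bd c g RJ_jet in auto)
  qed
  finally show ?thesis .
qed

lemma top_injective:
  assumes s: "2 \<le> s" "s < m" and f: "f \<in> A" and Df: "D s f \<in> im {Suc s..m}"
  shows "f \<in> im {Suc s..m}"
proof -
  define \<alpha>s where "\<alpha>s = [Suc s..<Suc m]"
  have set\<alpha>s: "set \<alpha>s = {Suc s..m}" unfolding \<alpha>s_def by auto
  have \<alpha>s: "distinct \<alpha>s" "set \<alpha>s \<subseteq> {2..m}" "set \<alpha>s \<subseteq> {1..m}" "\<alpha>s \<noteq> []" "s \<notin> set \<alpha>s"
    unfolding set\<alpha>s using s by (auto simp: \<alpha>s_def)
  have s1: "s \<in> {1..m}" "s \<in> {2..m}" using s by auto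
  obtain g where g: "\<And>\<alpha>. g \<alpha> \<in> A" "D s f = (\<Sum>\<alpha>\<in>set \<alpha>s. D \<alpha> (g \<alpha>))"
    using Df unfolding im_def set\<alpha>s by blast
  obtain B1 where B1: "\<forall>c \<alpha>. jet c \<longrightarrow> B1 \<le> cnt \<alpha> c \<longrightarrow> pd c f = 0" using jet_bound[OF f] by blast
  obtain B2 where B2: "\<forall>\<alpha>\<in>set \<alpha>s. \<forall>c \<beta>. jet c \<longrightarrow> B2 \<le> cnt \<beta> c \<longrightarrow> pd c (g \<alpha>) = 0"
    using jet_bound_family[of "set \<alpha>s" g] g by auto
  \<comment> \<open>\<open>N\<close> exceeds the order of \<open>f\<close>; the additional 1 serves
    the telescoping, which asks the derivatives of \<open>g\<close> to vanish already from order
    \<open>N - 1\<close> on.\<close>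
  define N where "N = Suc (B1 + B2)"
  have B2': "pd c (g \<alpha>) = 0" if "\<alpha> \<in> set \<alpha>s" "jet c" "N - 1 \<le> cnt \<beta> c" for \<alpha> c \<beta>
    using that B2 unfolding N_def by (metis add_leD2 diff_Suc_1)
  define h where "h = LL N \<alpha>s (\<lambda>c. pd c f)"
  \<comment> \<open>Euler derivatives are taken at coordinates without derivatives in the directions
    \<open>\<alpha>s\<close>. Derivatives in direction \<open>s\<close> and below stay free, because
    no integration by parts takes place in these directions.\<close>
  define Q where "Q = {c \<in> RJ. \<forall>\<beta>\<in>set \<alpha>s. cnt \<beta> c = 0}"
  have pA: "pd c f \<in> A" for c using f by blast
  have eq: "D s (h c) + low s h c = 0" if c: "c \<in> Q" for c
  proof -
    have "LL N \<alpha>s (\<lambda>c. pd c (D s f)) c = LL N \<alpha>s (\<lambda>c. D s (pd c f) + low s (\<lambda>c. pd c f) c) c"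
      by (rule LL_cong[OF \<alpha>s(2) pd_D[OF f s1(2) RJ_jet]]) (use c Q_def in auto)
    also have "\<dots> = D s (h c) + low s h c"
      unfolding h_def
      by (simp only: LL_add[OF \<alpha>s(3) D_smooth[OF s1(1) pA] low_smooth[OF pA]] LL_D[OF \<alpha>s(3) s1(1) pA] LL_low[OF \<alpha>s(5)])
    finally have "D s (h c) + low s h c = LL N \<alpha>s (\<lambda>c. pd c (D s f)) c" by simp
    also have "\<dots> = 0"
      unfolding g(2) by (rule LL_im_0[OF \<alpha>s(1,2) g(1) B2']) (use c in \<open>auto simp: Q_def\<close>)
    finally show ?thesis .
  qed
  have Qup: "up s 1 c \<in> Q" if "c \<in> Q" for c
    using that RJ_up2[OF _ s1(2)] \<alpha>s(5) unfolding Q_def by (auto, metis cnt_up_other)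
  have h0: "h c = 0" if c: "c \<in> Q" for c
  proof (rule descend[where Q=Q and s=s and B=B1])
    fix d assume d: "d \<in> Q"
    then have "jet d" by (auto simp: Q_def RJ_def)
    then show "D s (h (up s 1 d)) + h d = 0" using eq[OF Qup[OF d]] by (simp add: low_def)
    show "h d = 0" if "B1 \<le> cnt s d"
      unfolding h_def by (rule LL_vanish[OF _ \<alpha>s(5) \<open>jet d\<close> that]) (use B1 in blast)
  qed (use c Qup in \<open>auto simp: Q_def RJ_def\<close>)
  have "f - (\<Sum>c\<in>Bx N \<alpha>s. cx c * G (h c)) \<in> im (set \<alpha>s)"
    unfolding h_def
  proof (rule euler_homotopy[OF f \<alpha>s(2,1,4)])
    show "pd c f = 0" if "jet c" "N \<le> cnt \<alpha> c" for c \<alpha>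
      using that B1 unfolding N_def by (metis Suc_leD add_leD1)
  qed
  moreover have "(\<Sum>c\<in>Bx N \<alpha>s. cx c * G (h c)) = 0"
  proof (rule sum.neutral, rule ballI)
    fix c assume "c \<in> Bx N \<alpha>s"
    then have "c \<in> Q" using \<alpha>s(3) unfolding Bx_def Q_def by auto
    then show "cx c * G (h c) = 0" by (simp add: h0 G_def)
  qed
  ultimately show ?thesis unfolding set\<alpha>s by simp
qed

text \<open>At coordinates raised in direction 1 the additional terms D_beta (E_u f) involve only
  eliminated u^1-coordinates and vanish, so the descent succeeds for every coordinate other than
  u^1. The equations at u^beta and u^1 themselves then say that every D_mu annihilates E_u f, and
  \<open>a\<close> is its constant value.\<close>

lemma top_kernel_D1:
  assumes f: "f \<in> A" and Df: "D 1 f \<in> im {2..m}"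
  shows "\<exists>a. f - (\<lambda>_. a) * cx (Uc 1 (\<lambda>_. 0)) \<in> im {2..m}"
proof -
  define \<alpha>s where "\<alpha>s = [2..<Suc m]"
  have set\<alpha>s: "set \<alpha>s = {2..m}" unfolding \<alpha>s_def by auto
  have \<alpha>s: "distinct \<alpha>s" "set \<alpha>s \<subseteq> {2..m}" "set \<alpha>s \<subseteq> {1..m}" "\<alpha>s \<noteq> []" "1 \<notin> set \<alpha>s"
    unfolding set\<alpha>s using m2 by (auto simp: \<alpha>s_def)
  have s1: "1 \<in> {1..m}" using m1 by auto
  obtain g where g: "\<And>\<alpha>. g \<alpha> \<in> A" "D 1 f = (\<Sum>\<alpha>\<in>set \<alpha>s. D \<alpha> (g \<alpha>))"
    using Df unfolding im_def set\<alpha>s by blast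
  obtain B1 where B1: "\<forall>c \<alpha>. jet c \<longrightarrow> B1 \<le> cnt \<alpha> c \<longrightarrow> pd c f = 0" using jet_bound[OF f] by blast
  obtain B2 where B2: "\<forall>\<alpha>\<in>set \<alpha>s. \<forall>c \<beta>. jet c \<longrightarrow> B2 \<le> cnt \<beta> c \<longrightarrow> pd c (g \<alpha>) = 0"
    using jet_bound_family[of "set \<alpha>s" g] g by auto
  define N where "N = Suc (B1 + B2)"
  have B2': "pd c (g \<alpha>) = 0" if "\<alpha> \<in> set \<alpha>s" "jet c" "N - 1 \<le> cnt \<beta> c" for \<alpha> c \<beta>
    using that B2 unfolding N_def by (metis add_leD2 diff_Suc_1)
  define df where "df c = pd c f" for c
  define h where "h = LL N \<alpha>s df"
  define Q where "Q = {c \<in> RJ. \<forall>\<beta>\<in>set \<alpha>s. cnt \<beta> c = 0}"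
  let ?u = "Uc 1 (\<lambda>_. 0)"
  have pA: "df c \<in> A" for c using f unfolding df_def by blast
  have hA: "h c \<in> A" for c unfolding h_def by (rule LL_smooth[OF \<alpha>s(3) pA])
  \<comment> \<open>As \<open>\<beta>\<close> is among \<open>\<alpha>s\<close>, the Euler operator
    annihilates the derivative and the lowered term together; the lowered term alone therefore
    contributes minus a total derivative.\<close>
  have lowrel: "LL N \<alpha>s (low \<beta> (relab \<beta> df)) c = - D \<beta> (relab \<beta> h c)" if c: "c \<in> Q" and \<beta>: "\<beta> \<in> {2..m}" for c \<beta>
  proof -
    have \<beta>1: "\<beta> \<in> {1..m}" using \<beta> by auto
    have rA: "relab \<beta> df c \<in> A" for c by (rule relab_smooth[OF pA])
    have "LL N \<alpha>s (\<lambda>c. D \<beta> (relab \<beta> df c) + low \<beta> (relab \<beta> df) c) c = 0"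
    proof (rule LL_kill[OF \<alpha>s(1,3) _ rA])
      show "relab \<beta> df d = 0" if "jet d" "N - 1 \<le> cnt \<beta> d" for d
        using that B1 by (cases d) (auto simp: df_def N_def, metis add_leD1 cnt.simps(2) jet.simps(2))
    qed (use c \<beta> set\<alpha>s RJ_jet in \<open>auto simp: Q_def\<close>)
    then have "D \<beta> (relab \<beta> h c) + LL N \<alpha>s (low \<beta> (relab \<beta> df)) c = 0"
      unfolding h_def LL_relab[symmetric]
      by (simp only: LL_add[OF \<alpha>s(3) D_smooth[OF \<beta>1 rA] low_smooth[OF rA]] LL_D[OF \<alpha>s(3) \<beta>1 rA])
    then show ?thesis by (simp add: add_eq_0_iff)
  qed
  have eq: "D 1 (h c) + low 1 h c + (\<Sum>\<beta>=2..m. D \<beta> (relab \<beta> h c)) = 0" if c: "c \<in> Q" for c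
  proof -
    have lA: "low \<beta> (relab \<beta> df) c \<in> A" for \<beta> c by (rule low_smooth[OF relab_smooth[OF pA]])
    have "LL N \<alpha>s (\<lambda>c. pd c (D 1 f)) c
        = LL N \<alpha>s (\<lambda>c. (D 1 (df c) + low 1 df c) + - (\<Sum>\<beta>=2..m. low \<beta> (relab \<beta> df) c)) c"
      by (rule LL_cong[OF \<alpha>s(2)]) (use c pd_D1[OF f] in \<open>auto simp: Q_def df_def[abs_def]\<close>)
    also have "\<dots> = D 1 (h c) + low 1 h c + - (\<Sum>\<beta>=2..m. LL N \<alpha>s (low \<beta> (relab \<beta> df)) c)"
    proof -
      have 1: "LL N \<alpha>s (\<lambda>c. D 1 (df c) + low 1 df c) = (\<lambda>c. D 1 (h c) + low 1 h c)"
        unfolding h_def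
        by (simp only: LL_add[OF \<alpha>s(3) D_smooth[OF s1 pA] low_smooth[OF pA]] LL_D[OF \<alpha>s(3) s1 pA] LL_low[OF \<alpha>s(5)])
      have 2: "LL N \<alpha>s (\<lambda>c. - (\<Sum>\<beta>=2..m. low \<beta> (relab \<beta> df) c)) = (\<lambda>c. - (\<Sum>\<beta>=2..m. LL N \<alpha>s (low \<beta> (relab \<beta> df)) c))"
        by (simp only: LL_uminus[OF \<alpha>s(3) smooth_sum[OF lA]] LL_sum[OF \<alpha>s(3) lA])
      show ?thesis
        by (subst LL_add[OF \<alpha>s(3)]) (simp_all only: 1 2 smooth_add D_smooth[OF s1 pA] low_smooth[OF pA] smooth_uminus smooth_sum lA)
    qed
    also have "\<dots> = D 1 (h c) + low 1 h c + (\<Sum>\<beta>=2..m. D \<beta> (relab \<beta> h c))"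
      using lowrel[OF c] by (simp add: sum_negf)
    finally have "D 1 (h c) + low 1 h c + (\<Sum>\<beta>=2..m. D \<beta> (relab \<beta> h c)) = LL N \<alpha>s (\<lambda>c. pd c (D 1 f)) c" by simp
    also have "\<dots> = 0"
      unfolding g(2) by (rule LL_im_0[OF \<alpha>s(1,2) g(1) B2']) (use c in \<open>auto simp: Q_def\<close>)
    finally show ?thesis .
  qed
  \<comment> \<open>These u^1-coordinates are eliminated, so \<open>f\<close> depends neither on
    them nor on their shifts in directions at least 2.\<close>
  have hred: "h (Uc 1 i) = 0" if "0 < i 1" for i
  proof -
    have "LL N bs df (Uc 1 i) = 0" if "set bs \<subseteq> {2..m}" "0 < i 1" for bs i
      using that
    proof (induction bs arbitrary: i)
      case Nil
      then have "Uc 1 i \<notin> rc m" by simp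
      then show ?case using smooth_dep(2)[OF f] pd_notin_dep unfolding df_def by (metis LL.simps(1) subsetD)
    next
      case (Cons \<beta> bs)
      then show ?case by (auto simp: Ls_def)
    qed
    then show ?thesis unfolding h_def using \<alpha>s(2) that by blast
  qed
  \<comment> \<open>Raising u^1 in direction 1 leaves the coordinates of CE, so the descent runs on
    the others.\<close>
  define Q' where "Q' = {c \<in> Q. \<forall>i. c \<noteq> Uc 1 i}"
  have Qup: "up 1 1 c \<in> Q'" if "c \<in> Q'" for c
  proof -
    have "up 1 1 c \<in> RJ" using that s1 by (intro RJ_up) (auto simp: Q'_def Q_def)
    moreover have "cnt \<beta> (up 1 1 c) = 0" if "\<beta> \<in> set \<alpha>s" for \<beta>
    proof -
      have "1 \<noteq> \<beta>" using that \<alpha>s(5) by auto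
      from cnt_up_other[OF this, of 1 c] show ?thesis using \<open>c \<in> Q'\<close> that by (simp add: Q'_def Q_def)
    qed
    moreover have "up 1 1 c \<noteq> Uc 1 i" for i using that by (cases c) (auto simp: Q'_def)
    ultimately show ?thesis unfolding Q'_def Q_def by blast
  qed
  have h0: "h c = 0" if c: "c \<in> Q'" for c
  proof (rule descend[where Q=Q' and s=1 and B=B1])
    fix d assume d: "d \<in> Q'"
    then have j: "jet d" by (auto simp: Q'_def Q_def RJ_def)
    have "relab \<beta> h (up 1 1 d) = 0" for \<beta> using hred j by (cases d) auto
    then show "D 1 (h (up 1 1 d)) + h d = 0"
      using eq[of "up 1 1 d"] Qup[OF d] j by (simp add: low_def Q'_def)
    show "h d = 0" if "B1 \<le> cnt 1 d"
      unfolding h_def by (rule LL_vanish[OF _ \<alpha>s(5) j that]) (use B1 df_def in auto)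
  qed (use c Qup in \<open>auto simp: Q'_def Q_def RJ_def\<close>)
  have MI0: "(\<lambda>_. 0) \<in> MI m" by (simp add: MI_def)
  \<comment> \<open>For \<open>\<mu> = 1\<close> the equation at u^1 is used, where the additional
    terms vanish because beta is at least 2; otherwise the equation at u^mu, where only D_mu (E_u f)
    survives.\<close>
  have Dh: "D \<mu> (h ?u) = 0" if \<mu>: "\<mu> \<in> {1..m}" for \<mu>
  proof (cases "\<mu> = 1")
    case True
    have "?u \<in> Q" using MI0 m1 by (auto simp: Q_def RJ_def)
    then show ?thesis using eq[of ?u] True by (simp add: low_def)
  next
    case False
    then have \<mu>2: "\<mu> \<in> {2..m}" using \<mu> by auto
    have "Uc \<mu> (\<lambda>_. 0) \<in> Q'" using MI0 \<mu> False by (auto simp: Q'_def Q_def RJ_def)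
    moreover from this have "Uc \<mu> (\<lambda>_. 0) \<in> Q" by (simp add: Q'_def)
    ultimately have "(\<Sum>\<beta>=2..m. D \<beta> (if \<mu> = \<beta> then h ?u else 0)) = 0"
      using eq[of "Uc \<mu> (\<lambda>_. 0)"] h0[of "Uc \<mu> (\<lambda>_. 0)"] by (simp add: low_def)
    moreover have "D \<beta> (if \<mu> = \<beta> then h ?u else 0) = (if \<mu> = \<beta> then D \<mu> (h ?u) else 0)" for \<beta> by simp
    ultimately show ?thesis using \<mu>2 by (simp only:) simp
  qed
  obtain a where a: "h ?u = (\<lambda>_. a)" using constant_if_D_0[OF hA Dh] by blast
  have "f - (\<Sum>c\<in>Bx N \<alpha>s. cx c * G (h c)) \<in> im (set \<alpha>s)"
    unfolding h_def df_def[abs_def]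
  proof (rule euler_homotopy[OF f \<alpha>s(2,1,4)])
    show "pd c f = 0" if "jet c" "N \<le> cnt \<alpha> c" for c \<alpha>
      using that B1 unfolding N_def by (metis Suc_leD add_leD1)
  qed
  moreover have "(\<Sum>c\<in>Bx N \<alpha>s. cx c * G (h c)) = (\<Sum>c\<in>{?u}. cx c * G (h c))"
  proof (rule sum.mono_neutral_right[OF finite_Bx])
    show "{?u} \<subseteq> Bx N \<alpha>s" using MI0 m1 by (auto simp: Bx_def RJ_def N_def)
    show "\<forall>c\<in>Bx N \<alpha>s - {?u}. cx c * G (h c) = 0"
    proof
      fix c assume c: "c \<in> Bx N \<alpha>s - {?u}"
      then have cQ: "c \<in> Q" using \<alpha>s(3) unfolding Bx_def Q_def by auto
      \<comment> \<open>A u^1-coordinate in this set has zero multi-index: the first entry by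
        elimination, the others because there are no derivatives in directions 2, ..., m.\<close>
      have "c \<noteq> Uc 1 i" for i
      proof
        assume ci: "c = Uc 1 i"
        have "i k = 0" for k
        proof -
          consider "k = 1" | "k \<in> {2..m}" | "k \<notin> {1..m}" by force
          then show ?thesis
            using cQ ci set\<alpha>s by cases (auto simp: Q_def RJ_def MI_def)
        qed
        then have "c = ?u" using ci by auto
        with c show False by simp
      qed
      then have "c \<in> Q'" using cQ by (auto simp: Q'_def)
      then show "cx c * G (h c) = 0" by (simp add: h0 G_def)
    qed
  qed
  moreover have "(\<Sum>c\<in>{?u}. cx c * G (h c)) = (\<lambda>_. a) * cx ?u"
    using a by (simp add: G_def mult.commute)
  ultimately have "f - (\<lambda>_. a) * cx ?u \<in> im {2..m}" unfolding set\<alpha>s by simp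
  then show ?thesis by blast
qed

section \<open>The long exact sequence\<close>

text \<open>The alternating sum for the coefficient of the differential at an index list, arranged
  so that signs come from peeling off the leading index; this is the form in which one variable can
  be split off.\<close>

primrec dd :: "nat list \<Rightarrow> form \<Rightarrow> fnB" where
  "dd [] \<omega> = 0"
| "dd (j # J) \<omega> = D j (\<omega> J) - dd J (\<lambda>K. \<omega> (j # K))"

definition sl :: "nat \<Rightarrow> nat list \<Rightarrow> bool" where
  "sl s J \<longleftrightarrow> sorted_wrt (<) J \<and> set J \<subseteq> {s..m}"

text \<open>Neither the degree nor the order of the indices is constrained, so fixing a leading
  index stays within this class. By \<open>dd_cong\<close> only values at increasing lists of the
  right length matter at an increasing list.\<close>

definition Av :: "form \<Rightarrow> bool" where
  "Av \<omega> \<longleftrightarrow> (\<forall>K. set K \<subseteq> {1..m} \<longrightarrow> \<omega> K \<in> A)"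

lemma sl_Nil [simp]: "sl s []" by (simp add: sl_def)

lemma sl_Cons: "sl s (j # J) \<longleftrightarrow> j \<in> {s..m} \<and> sl (Suc j) J"
  by (auto simp: sl_def Suc_le_eq)

lemma sl_mono: "sl t J \<Longrightarrow> s \<le> t \<Longrightarrow> sl s J"
  by (auto simp: sl_def)

lemma sl_set: "sl s J \<Longrightarrow> 1 \<le> s \<Longrightarrow> set J \<subseteq> {1..m}"
  by (auto simp: sl_def)

lemma sl_cases:
  assumes "sl s J"
  obtains "sl (Suc s) J" | K where "J = s # K" "sl (Suc s) K"
  using assms
proof (cases J)
  case (Cons j K)
  show ?thesis
  proof (cases "j = s")
    case True
    then show ?thesis using that(2) assms Cons by (simp add: sl_Cons)
  next
    case False
    then have "sl (Suc s) J" using assms Cons by (simp add: sl_Cons)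
    then show ?thesis by (rule that(1))
  qed
qed (use that in simp)

lemma sl_length: "sl s J \<Longrightarrow> length J \<le> Suc m - s"
proof -
  assume s: "sl s J"
  then have "distinct J" by (auto simp: sl_def strict_sorted_iff)
  then have "length J = card (set J)" by (simp add: distinct_card)
  also have "\<dots> \<le> card {s..m}" using s by (intro card_mono) (auto simp: sl_def)
  finally show ?thesis by simp
qed

lemma sl_upt: "sl s [s..<Suc m]"
  by (auto simp: sl_def strict_sorted_iff simp del: upt_Suc)

lemma sl_full:
  assumes "sl s J" "length J = Suc m - s"
  shows "J = [s..<Suc m]"
proof -
  have d: "distinct J" "sorted J" using assms(1) by (auto simp: sl_def strict_sorted_iff)
  have sub: "set J \<subseteq> {s..m}" using assms(1) by (simp add: sl_def)
  have "card (set J) = card {s..m}" using assms(2) distinct_card[OF d(1)] by simp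
  then have "set J = {s..m}" by (rule card_subset_eq[OF finite_atLeastAtMost sub])
  also have "{s..m} = set [s..<Suc m]" by (simp add: atLeastLessThanSuc_atLeastAtMost del: upt_Suc)
  finally show ?thesis
    by (intro sorted_distinct_set_unique d sorted_upt distinct_upt)
qed

lemma AvD: "Av \<omega> \<Longrightarrow> set K \<subseteq> {1..m} \<Longrightarrow> \<omega> K \<in> A" by (simp add: Av_def)

lemma Av_Cons: "Av \<omega> \<Longrightarrow> j \<in> {1..m} \<Longrightarrow> Av (\<lambda>K. \<omega> (j # K))" by (simp add: Av_def)

lemma dd_smooth: "set J \<subseteq> {1..m} \<Longrightarrow> Av \<omega> \<Longrightarrow> dd J \<omega> \<in> A"
proof (induction J arbitrary: \<omega>)
  case (Cons j J)
  have "dd J (\<lambda>K. \<omega> (j # K)) \<in> A" using Cons.prems by (intro Cons.IH Av_Cons) auto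
  moreover have "D j (\<omega> J) \<in> A" using Cons.prems by (intro D_smooth AvD) auto
  ultimately show ?case by (simp add: smooth_diff)
qed simp

lemma dd_cong:
  assumes "sl s J" "\<And>K. sl s K \<Longrightarrow> Suc (length K) = length J \<Longrightarrow> \<omega> K = \<omega>' K"
  shows "dd J \<omega> = dd J \<omega>'"
  using assms
proof (induction J arbitrary: s \<omega> \<omega>')
  case (Cons j J)
  have j: "j \<in> {s..m}" "sl (Suc j) J" using Cons.prems by (auto simp: sl_Cons)
  have "sl s J" using sl_mono[OF j(2)] j(1) by auto
  then have "\<omega> J = \<omega>' J" using Cons.prems(2) by simp
  moreover have "dd J (\<lambda>K. \<omega> (j # K)) = dd J (\<lambda>K. \<omega>' (j # K))"
    by (rule Cons.IH[OF j(2)]) (rule Cons.prems(2), use j in \<open>auto simp: sl_Cons\<close>)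
  ultimately show ?case by simp
qed simp

lemma dd_diff:
  "set J \<subseteq> {1..m} \<Longrightarrow> Av \<omega> \<Longrightarrow> Av \<eta> \<Longrightarrow> dd J (\<lambda>K. \<omega> K - \<eta> K) = dd J \<omega> - dd J \<eta>"
proof (induction J arbitrary: \<omega> \<eta>)
  case (Cons j J)
  have "dd J (\<lambda>K. \<omega> (j # K) - \<eta> (j # K)) = dd J (\<lambda>K. \<omega> (j # K)) - dd J (\<lambda>K. \<eta> (j # K))"
    using Cons.prems by (intro Cons.IH Av_Cons) auto
  moreover have "D j (\<omega> J - \<eta> J) = D j (\<omega> J) - D j (\<eta> J)"
    using Cons.prems by (intro Dr_diff AvD) auto
  ultimately show ?case by simp
qed simp

lemma dd_0 [simp]: "dd J (\<lambda>K. 0) = 0"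
  by (induction J) auto

lemma Av_0: "Av (\<lambda>K. 0)" by (simp add: Av_def)

lemma dd_uminus: "set J \<subseteq> {1..m} \<Longrightarrow> Av \<omega> \<Longrightarrow> dd J (\<lambda>K. - \<omega> K) = - dd J \<omega>"
  using dd_diff[OF _ Av_0, of J \<omega>] by simp

lemma dd_D:
  "set J \<subseteq> {1..m} \<Longrightarrow> Av \<omega> \<Longrightarrow> \<mu> \<in> {1..m} \<Longrightarrow> dd J (\<lambda>K. D \<mu> (\<omega> K)) = D \<mu> (dd J \<omega>)"
proof (induction J arbitrary: \<omega>)
  case (Cons j J)
  have "dd J (\<lambda>K. D \<mu> (\<omega> (j # K))) = D \<mu> (dd J (\<lambda>K. \<omega> (j # K)))"
    using Cons.prems by (intro Cons.IH Av_Cons) auto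
  moreover have "D j (D \<mu> (\<omega> J)) = D \<mu> (D j (\<omega> J))"
    using Cons.prems by (intro D_commute AvD) auto
  moreover have "D \<mu> (D j (\<omega> J) - dd J (\<lambda>K. \<omega> (j # K))) = D \<mu> (D j (\<omega> J)) - D \<mu> (dd J (\<lambda>K. \<omega> (j # K)))"
    using Cons.prems by (intro Dr_diff D_smooth dd_smooth Av_Cons AvD) auto
  ultimately show ?case by simp
qed simp

lemma Av_D: "Av \<omega> \<Longrightarrow> \<mu> \<in> {1..m} \<Longrightarrow> Av (\<lambda>K. D \<mu> (\<omega> K))"
  unfolding Av_def by (auto intro!: D_smooth)

lemma Av_dd: "Av \<omega> \<Longrightarrow> Av (\<lambda>K. dd K \<omega>)"
  unfolding Av_def using dd_smooth Av_def by blast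

text \<open>Peeling off the leading index j gives D_j of the shorter coefficient twice with opposite
  signs, because D_j passes through \<open>dd\<close>; what remains is the same identity for the
  shorter list.\<close>

lemma dd_dd: "set J \<subseteq> {1..m} \<Longrightarrow> Av \<omega> \<Longrightarrow> dd J (\<lambda>K. dd K \<omega>) = 0"
proof (induction J arbitrary: \<omega>)
  case (Cons j J)
  have j: "j \<in> {1..m}" "set J \<subseteq> {1..m}" and a: "Av (\<lambda>K. \<omega> (j # K))"
    using Cons.prems Av_Cons by auto
  have "dd J (\<lambda>K. dd (j # K) \<omega>) = dd J (\<lambda>K. D j (\<omega> K)) - dd J (\<lambda>K. dd K (\<lambda>L. \<omega> (j # L)))"
    unfolding dd.simps by (rule dd_diff[OF j(2) Av_D[OF Cons.prems(2) j(1)] Av_dd[OF a]])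
  also have "\<dots> = D j (dd J \<omega>)"
    using Cons.IH[OF j(2) a] dd_D[OF j(2) Cons.prems(2) j(1)] by simp
  finally show ?case by simp
qed simp

section \<open>Total divergences as exact forms of top degree\<close>

lemma im_uminus: "f \<in> im S \<Longrightarrow> - f \<in> im S"
proof -
  assume "f \<in> im S"
  then obtain g where "\<forall>\<alpha>. g \<alpha> \<in> A" "f = (\<Sum>\<alpha>\<in>S. D \<alpha> (g \<alpha>))" unfolding im_def by blast
  then show ?thesis
    unfolding im_def by (auto intro!: exI[of _ "\<lambda>\<alpha>. - g \<alpha>"] simp: Dr_uminus sum_negf)
qed

lemma im_diff: "f \<in> im S \<Longrightarrow> g \<in> im S \<Longrightarrow> f - g \<in> im S"
  using im_add[OF _ im_uminus] by (metis diff_conv_add_uminus)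

lemma dd_im: "set J \<subseteq> S \<Longrightarrow> S \<subseteq> {1..m} \<Longrightarrow> Av \<omega> \<Longrightarrow> dd J \<omega> \<in> im S"
proof (induction J arbitrary: \<omega>)
  case (Cons j J)
  have "finite S" using Cons.prems(2) finite_subset by blast
  then show ?case
    using Cons.prems by (auto intro!: im_diff im_D Cons.IH AvD Av_Cons)
qed (simp add: im_0)

lemma im_dd:
  assumes "distinct J" "set J \<subseteq> {1..m}" "\<And>\<alpha>. g \<alpha> \<in> A"
  shows "\<exists>\<eta>. Av \<eta> \<and> dd J \<eta> = (\<Sum>\<alpha>\<in>set J. D \<alpha> (g \<alpha>))"
  using assms(1,2)
proof (induction J)
  case Nil
  then show ?case using Av_0 by auto
next
  case (Cons j J)
  then obtain \<eta> where \<eta>: "Av \<eta>" "dd J \<eta> = (\<Sum>\<alpha>\<in>set J. D \<alpha> (g \<alpha>))" by auto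
  \<comment> \<open>Lists beginning with \<open>j\<close> carry the family for the shorter list,
    with the sign of the recursion; all others take \<open>g j\<close>. Since \<open>j\<close> does
    not occur in \<open>J\<close>, the value at \<open>J\<close> is \<open>g j\<close>.\<close>
  define \<zeta> where "\<zeta> K = (if K \<noteq> [] \<and> hd K = j then - \<eta> (tl K) else g j)" for K
  have "set (tl K) \<subseteq> {1..m}" if "set K \<subseteq> {1..m}" for K :: "nat list"
    using that by (cases K) auto
  then have "Av \<zeta>" using \<eta>(1) assms(3) unfolding Av_def \<zeta>_def by auto
  moreover have "\<zeta> J = g j" using Cons.prems by (cases J) (auto simp: \<zeta>_def)
  moreover have "(\<lambda>K. \<zeta> (j # K)) = (\<lambda>K. - \<eta> K)" by (simp add: \<zeta>_def)
  ultimately have "Av \<zeta>" "dd (j # J) \<zeta> = D j (g j) + dd J \<eta>"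
    using dd_uminus[OF _ \<eta>(1), of J] Cons.prems by auto
  then show ?case using \<eta>(2) Cons.prems by auto
qed

lemma dd_image_eq_im:
  assumes "1 \<le> s"
  shows "(\<exists>\<eta>. Av \<eta> \<and> f = dd [s..<Suc m] \<eta>) \<longleftrightarrow> f \<in> im {s..m}"
proof
  assume "\<exists>\<eta>. Av \<eta> \<and> f = dd [s..<Suc m] \<eta>"
  then show "f \<in> im {s..m}" using assms by (auto intro!: dd_im)
next
  assume "f \<in> im {s..m}"
  then obtain g where g: "\<And>\<alpha>. g \<alpha> \<in> A" "f = (\<Sum>\<alpha>\<in>{s..m}. D \<alpha> (g \<alpha>))" unfolding im_def by blast
  have "set [s..<Suc m] = {s..m}" by auto
  then show "\<exists>\<eta>. Av \<eta> \<and> f = dd [s..<Suc m] \<eta>"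
    using im_dd[of "[s..<Suc m]" g] g assms by (auto simp del: upt_Suc)
qed

section \<open>Closed and exact forms over the variables x^s, ..., x^m\<close>

definition closed_form :: "nat \<Rightarrow> nat \<Rightarrow> form \<Rightarrow> bool" where
  "closed_form s q \<omega> \<longleftrightarrow> (\<forall>J. sl s J \<longrightarrow> length J = Suc q \<longrightarrow> dd J \<omega> = 0)"

definition exact_form :: "nat \<Rightarrow> nat \<Rightarrow> form \<Rightarrow> bool" where
  "exact_form s q \<omega> \<longleftrightarrow> (\<exists>\<eta>. Av \<eta> \<and> (\<forall>J. sl s J \<longrightarrow> length J = q \<longrightarrow> \<omega> J = dd J \<eta>))"

lemma exact_imp_closed:
  assumes "exact_form s q \<omega>" "1 \<le> s"
  shows "closed_form s q \<omega>"
  unfolding closed_form_def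
proof (intro allI impI)
  fix J assume J: "sl s J" "length J = Suc q"
  obtain \<eta> where \<eta>: "Av \<eta>" "\<And>J. sl s J \<Longrightarrow> length J = q \<Longrightarrow> \<omega> J = dd J \<eta>"
    using assms(1) unfolding exact_form_def by blast
  have "dd J \<omega> = dd J (\<lambda>K. dd K \<eta>)" by (rule dd_cong[OF J(1)]) (use \<eta>(2) J(2) in auto)
  then show "dd J \<omega> = 0" using dd_dd[OF sl_set[OF J(1) assms(2)] \<eta>(1)] by simp
qed

lemma exact_form_top:
  assumes "1 \<le> s"
  shows "exact_form s (Suc m - s) \<omega> \<longleftrightarrow> \<omega> [s..<Suc m] \<in> im {s..m}"
proof -
  have "sl s J \<and> length J = Suc m - s \<longleftrightarrow> J = [s..<Suc m]" for J
    using sl_full[of s J] sl_upt[of s] by (auto simp del: upt_Suc)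
  then have "exact_form s (Suc m - s) \<omega> \<longleftrightarrow> (\<exists>\<eta>. Av \<eta> \<and> \<omega> [s..<Suc m] = dd [s..<Suc m] \<eta>)"
    unfolding exact_form_def by metis
  then show ?thesis using dd_image_eq_im[OF assms] by simp
qed

lemma closed_form_Suc: "closed_form s q \<omega> \<Longrightarrow> closed_form (Suc s) q \<omega>"
  unfolding closed_form_def using sl_mono[of "Suc s" _ s] by simp

text \<open>\<open>glue s \<tau> \<psi>\<close> is \<open>\<tau> - dx\<^sup>s \<and> \<psi>\<close> for forms \<open>\<tau>, \<psi>\<close> in the variables after \<open>x\<^sup>s\<close>.\<close>
definition glue :: "nat \<Rightarrow> form \<Rightarrow> form \<Rightarrow> form" where
  "glue s \<tau> \<psi> K = (case K of [] \<Rightarrow> \<tau> [] | k # K' \<Rightarrow> if k = s then - \<psi> K' else \<tau> K)"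

lemma Av_glue: "Av \<tau> \<Longrightarrow> Av \<psi> \<Longrightarrow> Av (glue s \<tau> \<psi>)"
  unfolding Av_def glue_def by (auto split: list.splits)

lemma glue_sl: "sl (Suc s) K \<Longrightarrow> glue s \<tau> \<psi> K = \<tau> K"
  by (cases K) (auto simp: glue_def sl_Cons)

lemma dd_glue: "sl (Suc s) J \<Longrightarrow> dd J (glue s \<tau> \<psi>) = dd J \<tau>"
  by (rule dd_cong) (auto simp: glue_sl)

lemma dd_glue_Cons:
  assumes "sl (Suc s) J" "Av \<psi>"
  shows "dd (s # J) (glue s \<tau> \<psi>) = D s (\<tau> J) + dd J \<psi>"
proof -
  have "(\<lambda>K. glue s \<tau> \<psi> (s # K)) = (\<lambda>K. - \<psi> K)" by (simp add: glue_def)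
  then show ?thesis
    using dd_uminus[OF sl_set[OF assms(1)] assms(2)] glue_sl[OF assms(1)] by simp
qed

text \<open>A primitive \<open>\<tau>\<close> of the components without dx^s exists by assumption.
  What the dx^s-components still lack is the form \<open>\<rho>\<close>, closed of degree q - 1 in
  the later variables; if it is exact, its primitive completes \<open>\<tau>\<close>. For q = 1 it
  is a function in a kernel that need not vanish, and integration in x^s takes the place of
  exactness.\<close>

lemma exact_form_step:
  assumes s: "1 \<le> s" "s < m" and q: "1 \<le> q" and \<omega>: "Av \<omega>" and cl: "closed_form s q \<omega>"
    and ex: "exact_form (Suc s) q \<omega>"
    and X: "\<And>\<rho>. 2 \<le> q \<Longrightarrow> Av \<rho> \<Longrightarrow> closed_form (Suc s) (q - 1) \<rho> \<Longrightarrow> exact_form (Suc s) (q - 1) \<rho>"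
  shows "exact_form s q \<omega>"
proof -
  obtain \<tau> where \<tau>: "Av \<tau>" "\<And>J. sl (Suc s) J \<Longrightarrow> length J = q \<Longrightarrow> \<omega> J = dd J \<tau>"
    using ex unfolding exact_form_def by blast
  have s1: "s \<in> {1..m}" using s by auto
  have a: "Av (\<lambda>K. \<omega> (s # K))" by (rule Av_Cons[OF \<omega> s1])
  define \<rho> where "\<rho> K = \<omega> (s # K) - D s (\<tau> K)" for K
  have \<rho>: "Av \<rho>" unfolding \<rho>_def using a Av_D[OF \<tau>(1) s1] unfolding Av_def by auto
  have cl\<rho>: "dd J \<rho> = 0" if J: "sl (Suc s) J" "length J = q" for J
  proof -
    have Js: "set J \<subseteq> {1..m}" by (rule sl_set[OF J(1)]) simp
    have "dd (s # J) \<omega> = 0"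
      using cl[unfolded closed_form_def, rule_format, of "s # J"] J s by (simp add: sl_Cons del: dd.simps)
    moreover have "dd J \<rho> = dd J (\<lambda>K. \<omega> (s # K)) - D s (dd J \<tau>)"
      unfolding \<rho>_def by (simp only: dd_diff[OF Js a Av_D[OF \<tau>(1) s1]] dd_D[OF Js \<tau>(1) s1])
    ultimately show ?thesis using \<tau>(2)[OF J] by simp
  qed
  show ?thesis
  proof (cases "q = 1")
    case False
    have "closed_form (Suc s) (q - 1) \<rho>" unfolding closed_form_def using cl\<rho> q by simp
    then obtain \<psi> where \<psi>: "Av \<psi>" "\<And>J. sl (Suc s) J \<Longrightarrow> length J = q - 1 \<Longrightarrow> \<rho> J = dd J \<psi>"
      using X[OF _ \<rho>] False q unfolding exact_form_def by auto
    have "\<omega> J = dd J (glue s \<tau> \<psi>)" if J: "sl s J" "length J = q" for J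
      using J(1)
    proof (cases rule: sl_cases)
      case 1
      then show ?thesis using \<tau>(2) J dd_glue by simp
    next
      case (2 K)
      then have "\<rho> K = dd K \<psi>" using J \<psi>(2) by simp
      then show ?thesis unfolding 2(1) dd_glue_Cons[OF 2(2) \<psi>(1)] \<rho>_def by (simp add: algebra_simps)
    qed
    then show ?thesis unfolding exact_form_def using Av_glue[OF \<tau>(1) \<psi>(1)] by blast
  next
    case True
    have \<rho>0: "D \<alpha> (\<rho> []) = 0" if "\<alpha> \<in> {Suc s..m}" for \<alpha>
      using cl\<rho>[of "[\<alpha>]"] that True by (simp add: sl_Cons)
    have "\<rho> [] \<in> A" using \<rho> by (simp add: AvD)
    then have "\<exists>h\<in>A. D s h = \<rho> [] \<and> (\<forall>\<alpha>\<in>{Suc s..m}. D \<alpha> h = 0)"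
      by (rule kernel_antiderivative[OF s _ \<rho>0])
    then obtain h where h: "h \<in> A" "D s h = \<rho> []" "\<And>\<alpha>. \<alpha> \<in> {Suc s..m} \<Longrightarrow> D \<alpha> h = 0"
      by blast
    have t0: "\<tau> [] \<in> A" using \<tau>(1) by (simp add: AvD)
    \<comment> \<open>Adding \<open>h\<close> does not change the derivatives in later directions
      and supplies the missing \<open>\<rho>\<close> in direction \<open>s\<close>.\<close>
    define \<eta> where "\<eta> K = (if K = [] then \<tau> [] + h else 0)" for K :: "nat list"
    have "Av \<eta>" unfolding Av_def \<eta>_def using t0 h(1) by auto
    moreover have "\<omega> J = dd J \<eta>" if J: "sl s J" "length J = q" for J
      using J(1)
    proof (cases rule: sl_cases)
      case 1
      then obtain \<alpha> where \<alpha>: "J = [\<alpha>]" "\<alpha> \<in> {Suc s..m}"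
        using J True by (cases J) (auto simp: sl_Cons)
      then have "\<omega> J = D \<alpha> (\<tau> [])" using \<tau>(2)[OF 1 J(2)] by simp
      then show ?thesis using \<alpha> h(3) by (simp add: \<eta>_def Dr_add[OF t0 h(1)])
    next
      case (2 K)
      then have "J = [s]" using J True by simp
      then show ?thesis using h(2) by (simp add: \<eta>_def Dr_add[OF t0 h(1)] \<rho>_def)
    qed
    ultimately show ?thesis unfolding exact_form_def by blast
  qed
qed

text \<open>Downward induction on \<open>s\<close>; at s = m the range of \<open>q\<close> is empty.
  Passing from {s+1..m} to {s..m} adds the degree q = m - s, which is the top degree over {s+1..m}.
  There exactness comes from \<open>top_injective\<close>, hence \<open>2 \<le> s\<close>.\<close>

lemma closed_form_exact:
  assumes "2 \<le> s" "s \<le> m" "1 \<le> q" "q \<le> m - s" "Av \<omega>" "closed_form s q \<omega>"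
  shows "exact_form s q \<omega>"
  using assms(2,1,3-)
proof (induction s arbitrary: q \<omega> rule: inc_induct)
  case (step s)
  have s: "1 \<le> s" "s < m" using step by auto
  have ex: "exact_form (Suc s) q \<omega>"
  proof (cases "q \<le> m - Suc s")
    case True
    then show ?thesis using step closed_form_Suc by simp
  next
    case False
    then have q: "q = Suc m - Suc s" using step.prems by simp
    let ?J = "[Suc s..<Suc m]"
    have "sl s (s # ?J)" using sl_upt[of "Suc s"] s by (simp add: sl_Cons del: upt_Suc)
    then have "dd (s # ?J) \<omega> = 0"
      using step.prems(5) q s unfolding closed_form_def by (auto simp del: dd.simps upt_Suc)
    \<comment> \<open>Closedness at the full list makes D_s of the top coefficient a total
      divergence in the later variables.\<close>
    then have "D s (\<omega> ?J) = dd ?J (\<lambda>K. \<omega> (s # K))" by (simp del: upt_Suc)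
    moreover have "Av (\<lambda>K. \<omega> (s # K))" using step.prems s by (intro Av_Cons) auto
    ultimately have "D s (\<omega> ?J) \<in> im {Suc s..m}"
      by (simp only:) (rule dd_im, use s in auto)
    moreover have "\<omega> ?J \<in> A" by (rule AvD[OF step.prems(4)]) auto
    ultimately have "\<omega> ?J \<in> im {Suc s..m}"
      using top_injective[OF step.prems(1) s(2)] by blast
    then show ?thesis unfolding q using exact_form_top[of "Suc s" \<omega>] by simp
  qed
  show ?case
    by (rule exact_form_step[OF s _ _ _ ex]) (use step in auto)
qed simp

text \<open>\<open>top_injective\<close> does not reach s = 1, so exactness over {2..m} becomes a
  hypothesis: in degree m - 1 it says that the image in the top cohomology of the auxiliary complex
  vanishes.\<close>

lemma closed_form_exact_1:
  assumes "1 \<le> q" "q < m" "Av \<omega>" "closed_form 1 q \<omega>" "exact_form 2 q \<omega>"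
  shows "exact_form 1 q \<omega>"
  using exact_form_step[of 1 q \<omega>] assms m2 closed_form_exact[of 2 "q - 1"]
  by (auto simp: numeral_2_eq_2)

end

section \<open>The horizontal cohomology\<close>

lemmas pointwise = plus_fun_apply zero_fun_apply minus_apply uminus_apply scaleR_fun_def

lemma scaleR_fnB: "c *\<^sub>R (f :: fnB) = (\<lambda>_. c) * f"
  by (simp add: fun_eq_iff scaleR_fun_def times_fun_apply)

lemma AB_0: "0 \<in> AB m"
  and AB_diff: "f \<in> AB m \<Longrightarrow> g \<in> AB m \<Longrightarrow> f - g \<in> AB m"
  and AB_scaleR: "f \<in> AB m \<Longrightarrow> c *\<^sub>R f \<in> AB m"
  unfolding AB_eq_smooth scaleR_fnB by (auto intro: smooth_add smooth_diff smooth_mult)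

lemma TD_0 [simp]: "TD \<mu> 0 = 0"
  using TD_eq_vf[OF smooth_0[of UNIV], of \<mu>] by simp

context cont_eq
begin

section \<open>Representatives over A(B) and their restrictions to CE\<close>

definition dT :: "nat list \<Rightarrow> form \<Rightarrow> fnB" where
  "dT J \<omega> = (\<lambda>y. \<Sum>k<length J. (-1) ^ k * TD (J ! k) (\<omega> (take k J @ drop (Suc k) J)) y)"

lemma dT_Nil [simp]: "dT [] \<omega> = 0"
  by (simp add: dT_def zero_fun_def)

lemma dT_Cons [simp]: "dT (j # J) \<omega> = TD j (\<omega> J) - dT J (\<lambda>K. \<omega> (j # K))"
  by (simp add: dT_def fun_eq_iff minus_apply sum.lessThan_Suc_shift sum_negf del: sum.lessThan_Suc)

lemma dH_eq: "dH m {s..m} \<omega> J = (if sl s J then dT J \<omega> else 0)"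
  unfolding dH_def sl_def dT_def ..

lemma dT_AB: "set J \<subseteq> {1..m} \<Longrightarrow> (\<And>K. \<omega> K \<in> AB m) \<Longrightarrow> dT J \<omega> \<in> AB m"
proof (induction J arbitrary: \<omega>)
  case (Cons j J)
  then have "TD j (\<omega> J) \<in> AB m" "dT J (\<lambda>K. \<omega> (j # K)) \<in> AB m" by (auto intro!: TD_AB)
  then show ?case by (simp add: AB_diff)
qed (simp add: AB_0)

lemma red_dT: "set J \<subseteq> {1..m} \<Longrightarrow> (\<And>K. \<omega> K \<in> AB m) \<Longrightarrow> red m (dT J \<omega>) = dd J (\<lambda>K. red m (\<omega> K))"
proof (induction J arbitrary: \<omega>)
  case (Cons j J)
  then have "red m (TD j (\<omega> J)) = D j (red m (\<omega> J))" by (intro red_TD m1) auto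
  moreover have "red m (dT J (\<lambda>K. \<omega> (j # K))) = dd J (\<lambda>K. red m (\<omega> (j # K)))"
    using Cons by auto
  ultimately show ?case by (simp add: red_diff)
qed simp

lemma ICE_iff: "f \<in> ICE m \<longleftrightarrow> f \<in> AB m \<and> red m f = 0"
  using ICE_eq[OF m1] by simp

lemma dT_0: "dT J (\<lambda>K. 0) = 0"
  by (induction J) auto

lemma zero_form: "(0 :: form) = (\<lambda>K. 0)"
  by (rule ext) (simp add: zero_fun_apply)

lemma dH_0: "dH m {s..m} 0 J = 0"
  by (simp add: dH_eq zero_form dT_0)

lemma Omega_0: "0 \<in> Omega m S q"
  by (simp add: Omega_def zero_fun_apply AB_0)

lemma ICE_0: "0 \<in> ICE m"
  by (simp add: ICE_iff AB_0)

lemma Zc_0: "0 \<in> Zc m {s..m} q"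
  by (simp add: Zc_def Omega_0 dH_0 ICE_0)

lemma Bc_0: "0 \<in> Bc m {s..m} q"
proof -
  have "(\<lambda>y. (0 :: form) J y - dH m {s..m} 0 J y) = 0" for J
    by (simp add: dH_0 fun_eq_iff zero_fun_apply)
  then have "\<forall>J. (\<lambda>y. (0 :: form) J y - dH m {s..m} 0 J y) \<in> ICE m" using ICE_0 by simp
  then show ?thesis unfolding Bc_def using Omega_0 by blast
qed

lemma OmegaI:
  assumes "\<And>J. \<omega> J \<in> AB m" "\<And>J. \<not> (sl s J \<and> length J = n) \<Longrightarrow> \<omega> J = 0"
  shows "\<omega> \<in> Omega m {s..m} (int n)"
  using assms unfolding Omega_def sl_def by auto

lemma OmegaD:
  assumes "\<omega> \<in> Omega m {s..m} (int n)"
  shows "\<omega> J \<in> AB m" "\<not> (sl s J \<and> length J = n) \<Longrightarrow> \<omega> J = 0"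
  using assms unfolding Omega_def sl_def by auto

lemma Av_red: "(\<And>J. \<omega> J \<in> AB m) \<Longrightarrow> Av (\<lambda>J. red m (\<omega> J))"
  unfolding Av_def AB_eq_smooth by (auto intro: red_smooth)

lemma dd_vanish:
  assumes "sl s J" "\<And>K. sl s K \<Longrightarrow> Suc (length K) = length J \<Longrightarrow> \<omega> K = 0"
  shows "dd J \<omega> = 0"
proof -
  have "dd J \<omega> = dd J (\<lambda>K. 0)" by (rule dd_cong[OF assms(1)]) (rule assms(2))
  then show ?thesis by simp
qed

text \<open>\<open>red\<close> turns congruence modulo the ideal into equality and carries the
  differential to \<open>dd\<close>; at lists of length other than n + 1 the restricted differential
  vanishes for reasons of degree.\<close>

lemma Zc_iff:
  assumes "1 \<le> s"
  shows "\<omega> \<in> Zc m {s..m} (int n) \<longleftrightarrow>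
    \<omega> \<in> Omega m {s..m} (int n) \<and> closed_form s n (\<lambda>J. red m (\<omega> J))"
proof (cases "\<omega> \<in> Omega m {s..m} (int n)")
  case True
  note o = OmegaD[OF True]
  have "dH m {s..m} \<omega> J \<in> ICE m \<longleftrightarrow> (sl s J \<longrightarrow> length J = Suc n \<longrightarrow> dd J (\<lambda>J. red m (\<omega> J)) = 0)" for J
  proof (cases "sl s J")
    case sJ: True
    have "dH m {s..m} \<omega> J \<in> ICE m \<longleftrightarrow> dd J (\<lambda>J. red m (\<omega> J)) = 0"
      using sJ dT_AB[OF sl_set[OF sJ assms] o(1)] red_dT[OF sl_set[OF sJ assms] o(1)]
      by (simp add: dH_eq ICE_iff)
    moreover have "dd J (\<lambda>J. red m (\<omega> J)) = 0" if "length J \<noteq> Suc n"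
      by (rule dd_vanish[OF sJ]) (use o(2) that in auto)
    ultimately show ?thesis using sJ by auto
  qed (simp add: dH_eq ICE_0)
  then show ?thesis using True unfolding Zc_def closed_form_def by auto
qed (simp add: Zc_def)

text \<open>Primitives found as families in \<open>Av\<close> may be nonzero anywhere; extension by
  zero makes them elements of \<open>Omega\<close> without changing the coefficients that
  \<open>dd\<close> reads.\<close>

definition cut :: "nat \<Rightarrow> nat \<Rightarrow> form \<Rightarrow> form" where
  "cut s n \<eta> = (\<lambda>K. if sl s K \<and> length K = n then \<eta> K else 0)"

lemma cut_AB:
  assumes "Av \<eta>" "1 \<le> s"
  shows "cut s n \<eta> K \<in> AB m"
proof (cases "sl s K")
  case True
  have "\<eta> K \<in> AB m" by (rule rc_smooth_AB[OF AvD[OF assms(1) sl_set[OF True assms(2)]]])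
  then show ?thesis by (simp add: cut_def AB_0)
qed (simp add: cut_def AB_0)

lemma cut_Omega: "Av \<eta> \<Longrightarrow> 1 \<le> s \<Longrightarrow> cut s n \<eta> \<in> Omega m {s..m} (int n)"
  by (rule OmegaI) (auto simp: cut_AB, auto simp: cut_def)

lemma red_cut: "Av \<eta> \<Longrightarrow> 1 \<le> s \<Longrightarrow> sl s K \<Longrightarrow> length K = n \<Longrightarrow> red m (cut s n \<eta> K) = \<eta> K"
  unfolding cut_def using red_id[OF AvD[OF _ sl_set]] by simp

lemma Bc_iff:
  assumes s: "1 \<le> s" and n: "1 \<le> n"
  shows "\<omega> \<in> Bc m {s..m} (int n) \<longleftrightarrow>
    \<omega> \<in> Omega m {s..m} (int n) \<and> exact_form s n (\<lambda>J. red m (\<omega> J))"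
proof (cases "\<omega> \<in> Omega m {s..m} (int n)")
  case True
  note o = OmegaD[OF True]
  have n1: "int n - 1 = int (n - 1)" using n by simp
  have key: "(\<lambda>y. \<omega> J y - dH m {s..m} \<eta> J y) \<in> ICE m \<longleftrightarrow> (sl s J \<longrightarrow> red m (\<omega> J) = dd J (\<lambda>K. red m (\<eta> K)))"
    if \<eta>: "\<eta> \<in> Omega m {s..m} (int (n - 1))" for \<eta> J
  proof (cases "sl s J")
    case sJ: True
    note e = OmegaD[OF \<eta>]
    have "(\<lambda>y. \<omega> J y - dH m {s..m} \<eta> J y) = \<omega> J - dT J \<eta>"
      using sJ by (simp add: dH_eq fun_eq_iff minus_apply)
    then show ?thesis
      using sJ o(1) dT_AB[OF sl_set[OF sJ s] e(1)] red_dT[OF sl_set[OF sJ s] e(1)]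
      by (simp add: ICE_iff AB_diff red_diff)
  next
    case False
    then have "(\<lambda>y. \<omega> J y - dH m {s..m} \<eta> J y) = 0"
      using o(2)[of J] by (simp add: dH_eq fun_eq_iff zero_fun_apply)
    then show ?thesis using False ICE_0 by simp
  qed
  show ?thesis
  proof
    assume "\<omega> \<in> Bc m {s..m} (int n)"
    then obtain \<eta> where \<eta>: "\<eta> \<in> Omega m {s..m} (int (n - 1))"
      "\<And>J. (\<lambda>y. \<omega> J y - dH m {s..m} \<eta> J y) \<in> ICE m" unfolding Bc_def n1 by blast
    have "Av (\<lambda>K. red m (\<eta> K))" by (rule Av_red[OF OmegaD(1)[OF \<eta>(1)]])
    then show "\<omega> \<in> Omega m {s..m} (int n) \<and> exact_form s n (\<lambda>J. red m (\<omega> J))"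
      unfolding exact_form_def using True \<eta>(2) key[OF \<eta>(1)] by blast
  next
    assume "\<omega> \<in> Omega m {s..m} (int n) \<and> exact_form s n (\<lambda>J. red m (\<omega> J))"
    then obtain \<eta> where \<eta>: "Av \<eta>" "\<And>J. sl s J \<Longrightarrow> length J = n \<Longrightarrow> red m (\<omega> J) = dd J \<eta>"
      unfolding exact_form_def by blast
    let ?\<eta> = "cut s (n - 1) \<eta>"
    have O: "?\<eta> \<in> Omega m {s..m} (int (n - 1))" by (rule cut_Omega[OF \<eta>(1) s])
    have "red m (\<omega> J) = dd J (\<lambda>K. red m (?\<eta> K))" if sJ: "sl s J" for J
    proof (cases "length J = n")
      case True
      have "dd J (\<lambda>K. red m (?\<eta> K)) = dd J \<eta>"
        by (rule dd_cong[OF sJ]) (use True red_cut[OF \<eta>(1) s] in auto)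
      then show ?thesis using \<eta>(2)[OF sJ True] by simp
    next
      case False
      have "dd J (\<lambda>K. red m (?\<eta> K)) = 0"
        by (rule dd_vanish[OF sJ]) (use False n in \<open>auto simp: cut_def\<close>)
      then show ?thesis using o(2)[of J] False by simp
    qed
    then show "\<omega> \<in> Bc m {s..m} (int n)"
      unfolding Bc_def n1 using True O key[OF O] by blast
  qed
qed (simp add: Bc_def)

lemma Omega_trivial:
  assumes "q < 0 \<or> q > int m" "\<omega> \<in> Omega m {1..m} q"
  shows "\<omega> = 0"
proof
  fix J
  show "\<omega> J = 0 J"
  proof (rule ccontr)
    assume "\<omega> J \<noteq> 0 J"
    then have "sl 1 J" "int (length J) = q" using assms(2) unfolding Omega_def sl_def by (auto simp: zero_fun_apply)
    then show False using assms(1) sl_length[of 1 J] by auto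
  qed
qed

text \<open>For 1 \<le> q \<le> m - 2 a closed form is also closed over {2..m}, where q lies below
  the top degree m - 1, and exactness there lifts to {1..m}. In the other degrees there are no
  nonzero forms.\<close>

lemma cohomology_vanishing:
  assumes "q < 0 \<or> (1 \<le> q \<and> q \<le> int m - 2) \<or> q > int m"
  shows "ZH m q = BH m q"
proof (cases "1 \<le> q \<and> q \<le> int m - 2")
  case True
  define n where "n = nat q"
  have n: "q = int n" "1 \<le> n" "n \<le> m - 2" "n < m" using True by (auto simp: n_def)
  have "closed_form 1 n (\<lambda>J. red m (\<omega> J)) \<longleftrightarrow> exact_form 1 n (\<lambda>J. red m (\<omega> J))"
    if "\<omega> \<in> Omega m {1..m} (int n)" for \<omega>
  proof
    have a: "Av (\<lambda>J. red m (\<omega> J))" by (rule Av_red[OF OmegaD(1)[OF that]])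
    assume c: "closed_form 1 n (\<lambda>J. red m (\<omega> J))"
    then have "closed_form 2 n (\<lambda>J. red m (\<omega> J))" using closed_form_Suc[of 1] by (simp add: numeral_2_eq_2)
    then have "exact_form 2 n (\<lambda>J. red m (\<omega> J))"
      by (intro closed_form_exact a) (use n m2 in auto)
    then show "exact_form 1 n (\<lambda>J. red m (\<omega> J))" by (intro closed_form_exact_1 a c n)
  qed (rule exact_imp_closed, auto)
  then show ?thesis unfolding n(1) using Zc_iff[of 1] Bc_iff[of 1] n(2) by auto
next
  case False
  with assms have "q < 0 \<or> q > int m" by auto
  then have "ZH m q \<subseteq> {0}" "BH m q \<subseteq> {0}" using Omega_trivial unfolding Zc_def Bc_def by auto
  then show ?thesis using Zc_0[of 1 q] Bc_0[of 1 q] by blast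
qed

section \<open>Degree 0\<close>

lemma rho_0: "rho m c 0 = 0"
  by (cases c) (auto simp: pointwise sum_fun_apply cx_apply)

text \<open>The continuity equations are linear and homogeneous, so the origin lies on CE and
  evaluation there is well defined on the quotient.\<close>

lemma red_at_0: "red m f 0 = f 0"
proof -
  have "(\<lambda>c. rho m c 0) = 0" by (rule ext) (simp add: rho_0 zero_fun_apply)
  then show ?thesis by (simp add: red_def)
qed

text \<open>The isomorphism evaluates a representative at the origin: a closed function is constant
  on CE, and the constant is that value.\<close>

lemma cohomology_0: "quot_isomorphic (ZH m 0) (BH m 0) (UNIV :: real set) {0}"
proof -
  define ev where "ev \<omega> = \<omega> [] 0" for \<omega> :: form
  have Z: "\<omega> \<in> ZH m 0 \<longleftrightarrow> \<omega> \<in> Omega m {1..m} (int 0) \<and> closed_form 1 0 (\<lambda>J. red m (\<omega> J))" for \<omega>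
    using Zc_iff[of 1 \<omega> 0] by simp
  have B: "\<omega> \<in> BH m 0 \<longleftrightarrow> \<omega> \<in> Omega m {1..m} (int 0) \<and> red m (\<omega> []) = 0" for \<omega>
  proof (cases "\<omega> \<in> Omega m {1..m} (int 0)")
    case True
    note o = OmegaD[OF True]
    have "\<eta> = 0" if "\<eta> \<in> Omega m {1..m} (0 - 1)" for \<eta>
      using that by (intro Omega_trivial[of "0 - 1"]) auto
    then have "\<omega> \<in> BH m 0 \<longleftrightarrow> (\<forall>J. (\<lambda>y. \<omega> J y - dH m {1..m} 0 J y) \<in> ICE m)"
      unfolding Bc_def using True Omega_0 by auto
    also have "\<dots> \<longleftrightarrow> (\<forall>J. \<omega> J \<in> ICE m)" by (simp add: dH_0 zero_fun_apply)
    also have "\<dots> \<longleftrightarrow> red m (\<omega> []) = 0"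
    proof -
      have "\<omega> J \<in> ICE m" if "J \<noteq> []" for J using o(2)[of J] that ICE_0 by simp
      then show ?thesis using ICE_iff o(1) by metis
    qed
    finally show ?thesis using True by simp
  qed (simp add: Bc_def)
  have "quot_iso ev (ZH m 0) (BH m 0) UNIV {0}"
    unfolding quot_iso_def
  proof (intro conjI ballI impI)
    show "linear ev" by (rule linearI) (simp_all add: ev_def pointwise)
    show "ev ` BH m 0 \<subseteq> {0}"
      using B red_at_0 by (auto simp: ev_def) (metis zero_fun_apply)
  next
    fix z :: real
    define \<omega> :: form where "\<omega> = (\<lambda>J. if J = [] then (\<lambda>_. z) else 0)"
    have O: "\<omega> \<in> Omega m {1..m} (int 0)"
      by (rule OmegaI) (auto simp: \<omega>_def AB_eq_smooth)
    have "closed_form 1 0 (\<lambda>J. red m (\<omega> J))"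
      unfolding closed_form_def
    proof (intro allI impI)
      fix J assume "sl 1 J" "length J = Suc 0"
      then obtain \<alpha> where "J = [\<alpha>]" by (metis length_0_conv length_Suc_conv)
      then show "dd J (\<lambda>J. red m (\<omega> J)) = 0"
        by (simp add: \<omega>_def red_id)
    qed
    with O have "\<omega> \<in> ZH m 0" using Z by simp
    then show "\<exists>a\<in>ZH m 0. z - ev a \<in> {0}" by (intro bexI[of _ \<omega>]) (auto simp: ev_def \<omega>_def)
  next
    fix \<omega> assume z: "\<omega> \<in> ZH m 0" and e: "ev \<omega> \<in> {0}"
    then have O: "\<omega> \<in> Omega m {1..m} (int 0)" and c: "closed_form 1 0 (\<lambda>J. red m (\<omega> J))" using Z by auto
    have "D \<alpha> (red m (\<omega> [])) = 0" if "\<alpha> \<in> {1..m}" for \<alpha>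
      using c[unfolded closed_form_def, rule_format, of "[\<alpha>]"] that by (simp add: sl_Cons)
    moreover have "red m (\<omega> []) \<in> A" using OmegaD(1)[OF O] red_smooth by (simp add: AB_eq_smooth)
    ultimately obtain a where a: "red m (\<omega> []) = (\<lambda>_. a)" using constant_if_D_0 by blast
    then have "a = \<omega> [] 0" using red_at_0[of "\<omega> []"] by simp
    then have "red m (\<omega> []) = 0" using a e by (simp add: ev_def zero_fun_def)
    then show "\<omega> \<in> BH m 0" using B O by simp
  qed auto
  then show ?thesis unfolding quot_isomorphic_def by blast
qed

section \<open>Degree m - 1\<close>

lemma im1: "int m - 1 = int (m - 1)" using m2 by simp

lemma sl2: "sl 2 J \<longleftrightarrow> sl 1 J \<and> 1 \<notin> set J"
proof -
  have "{2..m} = {1..m} - {1}" by auto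
  then show ?thesis unfolding sl_def by auto
qed

lemma ZTh_top: "ZTh m (int (m - 1)) = Omega m {2..m} (int (m - 1))"
proof -
  have "closed_form 2 (m - 1) \<omega>" for \<omega>
    unfolding closed_form_def using sl_length[of 2] m2 by fastforce
  then show ?thesis using Zc_iff[of 2] by auto
qed

lemma BTh_top: "\<omega> \<in> BTh m (int (m - 1)) \<longleftrightarrow>
    \<omega> \<in> Omega m {2..m} (int (m - 1)) \<and> exact_form 2 (m - 1) (\<lambda>J. red m (\<omega> J))"
  by (rule Bc_iff) (use m2 in auto)

lemma D1f_Omega:
  assumes "\<theta> \<in> Omega m {2..m} (int n)"
  shows "D1f \<theta> \<in> Omega m {2..m} (int n)"
  unfolding D1f_def
  by (rule OmegaI) (use OmegaD[OF assms] TD_AB m1 in auto)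

lemma red_D1f:
  assumes "\<theta> \<in> Omega m {2..m} (int n)"
  shows "red m (D1f \<theta> J) = D 1 (red m (\<theta> J))"
  unfolding D1f_def by (rule red_TD[OF m1 OmegaD(1)[OF assms]]) (use m1 in auto)

lemma kerD1_iff: "\<theta> \<in> kerD1 m (int (m - 1)) \<longleftrightarrow>
    \<theta> \<in> Omega m {2..m} (int (m - 1)) \<and> exact_form 2 (m - 1) (\<lambda>J. D 1 (red m (\<theta> J)))"
  unfolding kerD1_def ZTh_top BTh_top using D1f_Omega red_D1f by auto

text \<open>The projection onto the auxiliary complex obtained by setting dx^1 = 0.\<close>

definition restr :: "form \<Rightarrow> form" where
  "restr \<omega> = (\<lambda>J. if 1 \<in> set J then 0 else \<omega> J)"

lemma restr_Omega: "\<omega> \<in> Omega m {1..m} (int n) \<Longrightarrow> restr \<omega> \<in> Omega m {2..m} (int n)"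
  by (rule OmegaI) (auto simp: restr_def AB_0 OmegaD(1) sl2 intro: OmegaD(2))

lemma sl1_full: "sl 1 J \<Longrightarrow> length J = m \<Longrightarrow> \<exists>K. J = 1 # K \<and> sl 2 K \<and> length K = m - 1"
proof -
  assume J: "sl 1 J" "length J = m"
  have "\<not> sl (Suc 1) J" using sl_length[of "Suc 1" J] J(2) m2 by auto
  then show ?thesis using sl_cases[OF J(1)] J(2) by (metis Suc_1 diff_Suc_1 length_Cons)
qed

lemma exact_form_cong:
  assumes "\<And>J. sl s J \<Longrightarrow> length J = n \<Longrightarrow> \<omega> J = \<omega>' J"
  shows "exact_form s n \<omega> \<longleftrightarrow> exact_form s n \<omega>'"
  unfolding exact_form_def using assms by simp

lemma exact_form_restr: "exact_form 2 n (\<lambda>J. red m (restr \<omega> J)) \<longleftrightarrow> exact_form 2 n (\<lambda>J. red m (\<omega> J))"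
  by (rule exact_form_cong) (auto simp: restr_def sl2)

lemma exact_form_mono: "exact_form s n \<omega> \<Longrightarrow> s \<le> t \<Longrightarrow> exact_form t n \<omega>"
  unfolding exact_form_def using sl_mono by blast

text \<open>The isomorphism is \<open>restr\<close>. Closedness at the full list reads D_1 theta = d
  eta, with eta the dx^1-part and theta the rest, so theta represents an element of the kernel of
  D_1; conversely such an eta completes theta to a closed form. Injectivity is
  \<open>closed_form_exact_1\<close>.\<close>

lemma cohomology_m1:
  "quot_isomorphic (ZH m (int m - 1)) (BH m (int m - 1)) (kerD1 m (int m - 1)) (BTh m (int m - 1))"
proof -
  let ?n = "m - 1"
  have n: "1 \<le> ?n" "Suc ?n = m" using m2 by auto
  have Z: "\<omega> \<in> ZH m (int ?n) \<longleftrightarrow> \<omega> \<in> Omega m {1..m} (int ?n) \<and> closed_form 1 ?n (\<lambda>J. red m (\<omega> J))" for \<omega>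
    by (rule Zc_iff) simp
  have B: "\<omega> \<in> BH m (int ?n) \<longleftrightarrow> \<omega> \<in> Omega m {1..m} (int ?n) \<and> exact_form 1 ?n (\<lambda>J. red m (\<omega> J))" for \<omega>
    by (rule Bc_iff) (use n in auto)
  have "quot_iso restr (ZH m (int ?n)) (BH m (int ?n)) (kerD1 m (int ?n)) (BTh m (int ?n))"
    unfolding quot_iso_def
  proof (intro conjI ballI impI subsetI)
    show "linear restr" by (rule linearI) (auto simp: restr_def pointwise fun_eq_iff)
  next
    fix \<theta> assume "\<theta> \<in> restr ` ZH m (int ?n)"
    then obtain \<omega> where \<omega>: "\<theta> = restr \<omega>" "\<omega> \<in> Omega m {1..m} (int ?n)"
      and c: "closed_form 1 ?n (\<lambda>J. red m (\<omega> J))" using Z by blast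
    have a: "Av (\<lambda>J. red m (\<omega> J))" by (rule Av_red[OF OmegaD(1)[OF \<omega>(2)]])
    have "D 1 (red m (\<theta> J)) = dd J (\<lambda>K. red m (\<omega> (1 # K)))" if J: "sl 2 J" "length J = ?n" for J
    proof -
      have "sl 1 (1 # J)" using J(1) m1 by (simp add: sl_Cons numeral_2_eq_2)
      then have "dd (1 # J) (\<lambda>J. red m (\<omega> J)) = 0"
        using c J(2) unfolding closed_form_def by (metis length_Cons)
      moreover have "\<theta> J = \<omega> J" using J(1) \<omega>(1) by (simp add: restr_def sl2)
      ultimately show ?thesis by simp
    qed
    then have "exact_form 2 ?n (\<lambda>J. D 1 (red m (\<theta> J)))"
      unfolding exact_form_def using Av_Cons[OF a, of 1] m1 by auto
    then show "\<theta> \<in> kerD1 m (int ?n)" using kerD1_iff restr_Omega \<omega> by auto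
  next
    fix \<theta> assume "\<theta> \<in> restr ` BH m (int ?n)"
    then show "\<theta> \<in> BTh m (int ?n)"
      using B BTh_top restr_Omega exact_form_restr exact_form_mono[of 1 ?n _ 2] by auto
  next
    fix \<theta> assume "\<theta> \<in> kerD1 m (int ?n)"
    then have O: "\<theta> \<in> Omega m {2..m} (int ?n)" and "exact_form 2 ?n (\<lambda>J. D 1 (red m (\<theta> J)))"
      using kerD1_iff by auto
    then obtain \<eta> where \<eta>: "Av \<eta>" "\<And>J. sl 2 J \<Longrightarrow> length J = ?n \<Longrightarrow> D 1 (red m (\<theta> J)) = dd J \<eta>"
      unfolding exact_form_def by blast
    \<comment> \<open>The form theta + dx^1 \<and> eta, for which the two contributions to the
      differential at the full list cancel.\<close>
    define \<omega> where "\<omega> J = (if J \<noteq> [] \<and> hd J = 1 then cut 2 (?n - 1) \<eta> (tl J) else \<theta> J)" for J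
    note o = OmegaD[OF O]
    have \<omega>O: "\<omega> \<in> Omega m {1..m} (int ?n)"
    proof (rule OmegaI)
      show "\<omega> J \<in> AB m" for J unfolding \<omega>_def using o(1) cut_AB[OF \<eta>(1)] by auto
      show "\<omega> J = 0" if J: "\<not> (sl 1 J \<and> length J = ?n)" for J
      proof (cases "J \<noteq> [] \<and> hd J = 1")
        case True
        then obtain K where K: "J = 1 # K" by (cases J) auto
        have "\<not> (sl 2 K \<and> length K = ?n - 1)"
          using J m1 n unfolding K by (auto simp: sl_Cons numeral_2_eq_2)
        then show ?thesis unfolding \<omega>_def K by (auto simp: cut_def)
      next
        case False
        have "\<theta> J = 0" by (rule o(2)) (use J sl2 in auto)
        then show ?thesis unfolding \<omega>_def using False by auto
      qed
    qed
    have r: "restr \<omega> = \<theta>"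
    proof
      fix J
      show "restr \<omega> J = \<theta> J"
      proof (cases "1 \<in> set J")
        case True
        then have "\<theta> J = 0" by (intro o(2)) (auto simp: sl2)
        then show ?thesis using True by (simp add: restr_def)
      next
        case False
        then show ?thesis by (cases J) (auto simp: restr_def \<omega>_def)
      qed
    qed
    have "closed_form 1 ?n (\<lambda>J. red m (\<omega> J))"
      unfolding closed_form_def n(2)
    proof (intro allI impI)
      fix J assume "sl 1 J" "length J = m"
      then obtain K where K: "J = 1 # K" "sl 2 K" "length K = ?n" using sl1_full by blast
      have "\<omega> K = \<theta> K" using K(2) sl2 unfolding \<omega>_def by (cases K) auto
      moreover have "dd K (\<lambda>L. red m (\<omega> (1 # L))) = dd K \<eta>"
        by (rule dd_cong[OF K(2)]) (use K(3) red_cut[OF \<eta>(1), of 2] in \<open>auto simp: \<omega>_def\<close>)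
      ultimately show "dd J (\<lambda>J. red m (\<omega> J)) = 0" unfolding K(1) using \<eta>(2)[OF K(2,3)] by simp
    qed
    with \<omega>O have "\<omega> \<in> ZH m (int ?n)" using Z by simp
    then show "\<exists>a\<in>ZH m (int ?n). \<theta> - restr a \<in> BTh m (int ?n)"
      using r Bc_0[of 2 "int ?n"] by (intro bexI[of _ \<omega>]) auto
  next
    fix \<omega> assume "\<omega> \<in> ZH m (int ?n)" "restr \<omega> \<in> BTh m (int ?n)"
    then have O: "\<omega> \<in> Omega m {1..m} (int ?n)" and c: "closed_form 1 ?n (\<lambda>J. red m (\<omega> J))"
      and e: "exact_form 2 ?n (\<lambda>J. red m (\<omega> J))" using Z BTh_top exact_form_restr by auto
    have "exact_form 1 ?n (\<lambda>J. red m (\<omega> J))"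
      by (rule closed_form_exact_1[OF n(1) _ Av_red[OF OmegaD(1)[OF O]] c e]) (use m2 in simp)
    then show "\<omega> \<in> BH m (int ?n)" using B O by simp
  qed
  then show ?thesis unfolding quot_isomorphic_def im1 by blast
qed

section \<open>The kernel of D_1 on the top cohomology of the auxiliary complex\<close>

lemma BTh_top_im: "\<omega> \<in> Omega m {2..m} (int (m - 1)) \<Longrightarrow>
    \<omega> \<in> BTh m (int (m - 1)) \<longleftrightarrow> red m (\<omega> [2..<Suc m]) \<in> im {2..m}"
  using BTh_top exact_form_top[of 2 "\<lambda>J. red m (\<omega> J)"] by (simp add: numeral_2_eq_2 del: upt_Suc)

lemma u1d1x_Omega: "u1d1x m \<in> Omega m {2..m} (int (m - 1))"
proof (rule OmegaI)
  have "cx (Uc 1 (\<lambda>_. 0)) \<in> AB m"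
    unfolding AB_eq_smooth by (rule smooth_cx) (use m1 in \<open>simp add: MI_def\<close>)
  then show "u1d1x m J \<in> AB m" for J by (simp add: u1d1x_def AB_0 cx_def del: upt_Suc)
  show "u1d1x m J = 0" if "\<not> (sl 2 J \<and> length J = m - 1)" for J
    using that sl_upt[of 2] by (auto simp: u1d1x_def simp del: upt_Suc)
qed

lemma red_u1d1x: "red m (u1d1x m [2..<Suc m]) = cx (Uc 1 (\<lambda>_. 0))"
  using red_cx[of m "Uc 1 (\<lambda>_. 0)"] by (simp add: u1d1x_def cx_def del: upt_Suc)

lemma Omega_sub_u1d1x:
  "\<theta> \<in> Omega m {2..m} (int (m - 1)) \<Longrightarrow> \<theta> - c *\<^sub>R u1d1x m \<in> Omega m {2..m} (int (m - 1))"
  using OmegaD[OF u1d1x_Omega] OmegaD[of \<theta> 2 "m - 1"]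
  by (intro OmegaI) (auto simp: minus_apply scaleR_fun_def[of c "u1d1x m"] AB_diff AB_scaleR)

lemma red_sub_u1d1x:
  "red m ((\<theta> - c *\<^sub>R u1d1x m) [2..<Suc m]) = red m (\<theta> [2..<Suc m]) - (\<lambda>_. c) * cx (Uc 1 (\<lambda>_. 0))"
  unfolding red_u1d1x[symmetric]
  by (simp add: minus_apply scaleR_fun_def[of c "u1d1x m"] scaleR_fnB red_diff red_mult red_id del: upt_Suc)

lemma im_D1: "f \<in> im {2..m} \<Longrightarrow> D 1 f \<in> im {2..m}"
proof -
  assume "f \<in> im {2..m}"
  then obtain g where g: "\<And>\<alpha>. g \<alpha> \<in> A" "f = (\<Sum>\<alpha>\<in>{2..m}. D \<alpha> (g \<alpha>))" unfolding im_def by blast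
  have 1: "1 \<in> {1..m}" using m1 by auto
  have "D 1 f = (\<Sum>\<alpha>\<in>{2..m}. D 1 (D \<alpha> (g \<alpha>)))"
    unfolding g(2) by (rule Dr_sum) (use g(1) in \<open>auto intro!: D_smooth\<close>)
  also have "\<dots> = (\<Sum>\<alpha>\<in>{2..m}. D \<alpha> (D 1 (g \<alpha>)))"
    by (rule sum.cong[OF refl], rule D_commute[OF 1]) (use g(1) in auto)
  finally show ?thesis
    unfolding im_def mem_Collect_eq using D_smooth[OF 1 g(1)] by (intro exI[of _ "\<lambda>\<alpha>. D 1 (g \<alpha>)"]) simp
qed

text \<open>This is the continuity equation itself: D_1 u^1 = -(D_2 u^2 + ... + D_m u^m).\<close>

lemma D1_u1_im: "(\<lambda>_. a) * D 1 (cx (Uc 1 (\<lambda>_. 0))) \<in> im {2..m}"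
proof -
  let ?z = "\<lambda>_::nat. 0::nat"
  have z: "?z \<in> MI m" by (simp add: MI_def)
  have c: "cx (Uc \<beta> ?z) \<in> A" if "\<beta> \<in> {2..m}" for \<beta> using that z by (intro smooth_cx) auto
  have "D 1 (cx (Uc 1 ?z)) = rho m (Uc 1 (addm ?z 1))" by (simp add: Dr_cx red_cx)
  also have "\<dots> = - (\<Sum>\<beta>=2..m. cx (Uc \<beta> (addm ?z \<beta>)))"
    using dn_addm[of ?z 1] by (simp add: addm_def)
  also have "\<dots> = - (\<Sum>\<beta>=2..m. D \<beta> (cx (Uc \<beta> ?z)))"
  proof -
    have "D \<beta> (cx (Uc \<beta> ?z)) = cx (Uc \<beta> (addm ?z \<beta>))" if "\<beta> \<in> {2..m}" for \<beta>
      using D_cx[of "Uc \<beta> ?z" \<beta>] that z by (simp add: RJ_def addm_def)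
    then show ?thesis by simp
  qed
  finally have "(\<lambda>_. a) * D 1 (cx (Uc 1 ?z)) = (\<Sum>\<beta>=2..m. (\<lambda>_. - a) * D \<beta> (cx (Uc \<beta> ?z)))"
    by (simp add: fun_eq_iff times_fun_apply uminus_apply sum_fun_apply sum_distrib_left sum_negf)
  also have "\<dots> = (\<Sum>\<beta>=2..m. D \<beta> ((\<lambda>_. - a) * cx (Uc \<beta> ?z)))"
    by (rule sum.cong[OF refl]) (simp add: Dr_mult[OF smooth_const c])
  also have "\<dots> \<in> im {2..m}"
    by (intro im_sum im_D smooth_mult smooth_const c) auto
  finally show ?thesis .
qed

text \<open>Setting dx^1 = 0 turns u^mu d_mu x into u^1 d_1 x, since every other d_mu x contains
  dx^1; hence the representative \<open>u1d1x\<close>. In top degree everything reduces to the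
  single coefficient, where \<open>top_kernel_D1\<close> and \<open>D1_u1_im\<close> give the two
  inclusions.\<close>

lemma kerD1_eq:
  "kerD1 m (int m - 1) = {\<theta> \<in> Omega m {2..m} (int m - 1). \<exists>c::real. \<theta> - c *\<^sub>R u1d1x m \<in> BTh m (int m - 1)}"
  unfolding im1
proof (intro set_eqI)
  fix \<theta>
  let ?u = "cx (Uc 1 (\<lambda>_. 0))" and ?f = "red m (\<theta> [2..<Suc m])"
  show "\<theta> \<in> kerD1 m (int (m - 1)) \<longleftrightarrow>
     \<theta> \<in> {\<theta> \<in> Omega m {2..m} (int (m - 1)). \<exists>c::real. \<theta> - c *\<^sub>R u1d1x m \<in> BTh m (int (m - 1))}"
  proof (cases "\<theta> \<in> Omega m {2..m} (int (m - 1))")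
    case True
    have f: "?f \<in> A" using OmegaD(1)[OF True] red_smooth by (simp add: AB_eq_smooth del: upt_Suc)
    have u: "?u \<in> A" using m1 by (intro smooth_cx) (auto simp: MI_def)
    have "\<theta> \<in> kerD1 m (int (m - 1)) \<longleftrightarrow> D 1 ?f \<in> im {2..m}"
      using kerD1_iff True exact_form_top[of 2 "\<lambda>J. D 1 (red m (\<theta> J))"]
      by (simp add: numeral_2_eq_2 del: upt_Suc)
    also have "\<dots> \<longleftrightarrow> (\<exists>c. ?f - (\<lambda>_. c) * ?u \<in> im {2..m})"
    proof
      assume "\<exists>c. ?f - (\<lambda>_. c) * ?u \<in> im {2..m}"
      then obtain c where c: "?f - (\<lambda>_. c) * ?u \<in> im {2..m}" by blast
      have "D 1 ?f = D 1 (?f - (\<lambda>_. c) * ?u) + (\<lambda>_. c) * D 1 ?u"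
        using Dr_diff[OF f smooth_mult[OF smooth_const u], of 1 c] Dr_mult[OF smooth_const u, of 1 c]
        by simp
      also have "\<dots> \<in> im {2..m}" by (rule im_add[OF im_D1[OF c] D1_u1_im])
      finally show "D 1 ?f \<in> im {2..m}" .
    qed (rule top_kernel_D1[OF f])
    also have "\<dots> \<longleftrightarrow> (\<exists>c::real. \<theta> - c *\<^sub>R u1d1x m \<in> BTh m (int (m - 1)))"
      using BTh_top_im[OF Omega_sub_u1d1x[OF True]] red_sub_u1d1x by (simp del: upt_Suc)
    finally show ?thesis using True by simp
  qed (use kerD1_iff in auto)
qed

text \<open>The isomorphism strips dx^1 from a top form. In the differential of a primitive, the
  part without dx^1 contributes D_1 zeta and the dx^1-part contributes a coboundary of the auxiliary
  complex, which together are the representatives of the image of D_1.\<close>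

lemma cohomology_m:
  "quot_isomorphic (ZH m (int m)) (BH m (int m)) (ZTh m (int m - 1)) (imD1 m (int m - 1))"
proof -
  let ?n = "m - 1"
  have n: "Suc ?n = m" using m2 by auto
  define fc where "fc \<omega> = (\<lambda>J. \<omega> (1 # J))" for \<omega> :: form
  have sl1: "sl 1 (1 # J) \<longleftrightarrow> sl 2 J" for J using m1 by (simp add: sl_Cons numeral_2_eq_2)
  have "closed_form 1 m \<omega>" for \<omega> unfolding closed_form_def using sl_length[of 1] by fastforce
  then have Z: "ZH m (int m) = Omega m {1..m} (int m)" using Zc_iff[of 1] by auto
  have B: "\<omega> \<in> BH m (int m) \<longleftrightarrow> \<omega> \<in> Omega m {1..m} (int m) \<and> exact_form 1 m (\<lambda>J. red m (\<omega> J))" for \<omega>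
    by (rule Bc_iff) (use m1 in auto)
  have fcO: "fc \<omega> \<in> Omega m {2..m} (int ?n)" if "\<omega> \<in> Omega m {1..m} (int m)" for \<omega>
    unfolding fc_def by (rule OmegaI) (use OmegaD[OF that] sl1 n in auto)
  have "quot_iso fc (ZH m (int m)) (BH m (int m)) (ZTh m (int ?n)) (imD1 m (int ?n))"
    unfolding quot_iso_def
  proof (intro conjI ballI impI subsetI)
    show "linear fc" by (rule linearI) (auto simp: fc_def pointwise fun_eq_iff)
  next
    fix \<theta> assume "\<theta> \<in> fc ` ZH m (int m)"
    then show "\<theta> \<in> ZTh m (int ?n)" unfolding ZTh_top Z using fcO by auto
  next
    fix \<theta> assume "\<theta> \<in> fc ` BH m (int m)"
    then obtain \<omega> where \<omega>: "\<theta> = fc \<omega>" "\<omega> \<in> BH m (int m)" by blast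
    then have \<omega>O: "\<omega> \<in> Omega m {1..m} (int m)" using B by simp
    from \<omega>(2) obtain \<eta> where \<eta>: "Av \<eta>" "\<And>J. sl 1 J \<Longrightarrow> length J = m \<Longrightarrow> red m (\<omega> J) = dd J \<eta>"
      using B unfolding exact_form_def by blast
    define \<zeta> where "\<zeta> = cut 2 ?n \<eta>"
    have \<zeta>: "\<zeta> \<in> Omega m {2..m} (int ?n)" unfolding \<zeta>_def by (rule cut_Omega[OF \<eta>(1)]) simp
    have 1: "1 \<in> {1..m}" using m1 by auto
    \<comment> \<open>Removing D_1 of the dx^1-free part of the primitive leaves the contribution of
      its dx^1-part, a coboundary.\<close>
    define \<beta> where "\<beta> = fc \<omega> - D1f \<zeta>"
    have \<beta>O: "\<beta> \<in> Omega m {2..m} (int ?n)"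
      unfolding \<beta>_def
      by (rule OmegaI) (use OmegaD[OF fcO[OF \<omega>O]] OmegaD[OF D1f_Omega[OF \<zeta>]] in \<open>auto simp: minus_apply AB_diff\<close>)
    have "red m (\<beta> J) = dd J (\<lambda>K. - \<eta> (1 # K))" if J: "sl 2 J" "length J = ?n" for J
    proof -
      have "red m (\<omega> (1 # J)) = dd (1 # J) \<eta>" using J sl1 n by (intro \<eta>(2)) auto
      moreover have "red m (\<zeta> J) = \<eta> J" unfolding \<zeta>_def by (rule red_cut[OF \<eta>(1) _ J]) simp
      moreover have "dd J (\<lambda>K. - \<eta> (1 # K)) = - dd J (\<lambda>K. \<eta> (1 # K))"
        using Av_Cons[OF \<eta>(1) 1] sl_set[OF J(1)] by (intro dd_uminus) auto
      ultimately show ?thesis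
        by (simp add: \<beta>_def minus_apply red_diff red_D1f[OF \<zeta>, simplified] fc_def)
    qed
    moreover have "Av (\<lambda>K. - \<eta> (1 # K))" using Av_Cons[OF \<eta>(1) 1] unfolding Av_def by auto
    ultimately have "\<beta> \<in> BTh m (int ?n)" using BTh_top \<beta>O unfolding exact_form_def by blast
    moreover have "\<theta> = \<beta> + D1f \<zeta>" unfolding \<beta>_def \<omega>(1) by simp
    ultimately show "\<theta> \<in> imD1 m (int ?n)" unfolding imD1_def ZTh_top using \<zeta> by blast
  next
    fix z assume "z \<in> ZTh m (int ?n)"
    then have z: "z \<in> Omega m {2..m} (int ?n)" unfolding ZTh_top .
    define \<omega> where "\<omega> J = (if J \<noteq> [] \<and> hd J = 1 then z (tl J) else 0)" for J
    have "\<omega> \<in> Omega m {1..m} (int m)"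
    proof (rule OmegaI)
      show "\<omega> J \<in> AB m" for J unfolding \<omega>_def using OmegaD(1)[OF z] AB_0 by auto
      show "\<omega> J = 0" if J: "\<not> (sl 1 J \<and> length J = m)" for J
      proof (cases "J \<noteq> [] \<and> hd J = 1")
        case True
        then obtain K where K: "J = 1 # K" by (cases J) auto
        have "\<not> (sl 2 K \<and> length K = ?n)" using J n sl1 unfolding K by auto
        then show ?thesis unfolding \<omega>_def K using OmegaD(2)[OF z] by simp
      qed (auto simp: \<omega>_def)
    qed
    moreover have "fc \<omega> = z" by (simp add: fc_def \<omega>_def)
    moreover have "0 \<in> imD1 m (int ?n)"
    proof -
      have "(0 :: form) = 0 + D1f 0" by (simp add: D1f_def fun_eq_iff pointwise)
      then show ?thesis unfolding imD1_def using Bc_0[of 2] Zc_0[of 2] by blast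
    qed
    ultimately show "\<exists>a\<in>ZH m (int m). z - fc a \<in> imD1 m (int ?n)"
      unfolding Z by (intro bexI[of _ \<omega>]) auto
  next
    fix \<omega> assume "\<omega> \<in> ZH m (int m)" "fc \<omega> \<in> imD1 m (int ?n)"
    then obtain \<beta> \<zeta> where \<omega>: "\<omega> \<in> Omega m {1..m} (int m)" and eq: "fc \<omega> = \<beta> + D1f \<zeta>"
      and \<beta>: "\<beta> \<in> BTh m (int ?n)" and \<zeta>: "\<zeta> \<in> Omega m {2..m} (int ?n)"
      unfolding Z imD1_def ZTh_top by blast
    obtain \<psi> where \<psi>: "Av \<psi>" "\<And>J. sl 2 J \<Longrightarrow> length J = ?n \<Longrightarrow> red m (\<beta> J) = dd J \<psi>"
      using \<beta> BTh_top unfolding exact_form_def by blast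
    let ?\<eta> = "glue 1 (\<lambda>J. red m (\<zeta> J)) \<psi>"
    have "red m (\<omega> J) = dd J ?\<eta>" if J: "sl 1 J" "length J = m" for J
    proof -
      obtain K where K: "J = 1 # K" "sl 2 K" "length K = ?n" using sl1_full[OF J] by blast
      have "red m (\<omega> J) = red m (\<beta> K) + D 1 (red m (\<zeta> K))"
        using fun_cong[OF eq, of K] red_D1f[OF \<zeta>, of K] by (simp add: fc_def K(1) plus_fun_apply red_add)
      also have "\<dots> = dd J ?\<eta>"
        unfolding K(1) using dd_glue_Cons[of 1 K \<psi>] K(2) \<psi> K(3) by (simp add: numeral_2_eq_2 add.commute)
      finally show ?thesis .
    qed
    moreover have "Av ?\<eta>" by (intro Av_glue Av_red \<psi>(1) OmegaD(1)[OF \<zeta>])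
    ultimately show "\<omega> \<in> BH m (int m)" using B \<omega> unfolding exact_form_def by blast
  qed
  then show ?thesis unfolding quot_isomorphic_def im1 by blast
qed

end

theorem mainTheorem3:
  fixes m :: nat
  assumes "m \<ge> 2"
  shows "(\<forall>q::int. (q < 0 \<or> (1 \<le> q \<and> q \<le> int m - 2) \<or> q > int m) \<longrightarrow> ZH m q = BH m q)
    \<and> quot_isomorphic (ZH m 0) (BH m 0) (UNIV :: real set) {0}
    \<and> quot_isomorphic (ZH m (int m - 1)) (BH m (int m - 1)) (kerD1 m (int m - 1)) (BTh m (int m - 1))
    \<and> kerD1 m (int m - 1) = {\<theta> \<in> Omega m {2..m} (int m - 1). \<exists>c::real. \<theta> - c *\<^sub>R u1d1x m \<in> BTh m (int m - 1)}
    \<and> quot_isomorphic (ZH m (int m)) (BH m (int m)) (ZTh m (int m - 1)) (imD1 m (int m - 1))"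
proof -
  interpret cont_eq m using assms by unfold_locales
  show ?thesis
    using cohomology_vanishing cohomology_0 cohomology_m1 kerD1_eq cohomology_m by blast
qed

end
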